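(* Let $R$ be a skew-invertible Hecke symmetry, let $(\mathcal{D}(R^{-1}),\mathcal{M}(R))$ be the associated quantum double, and let $\hat K=I-(q-q^{-1})\hat L$ with $\hat L=MD$. For every integer $n\ge1$ and every (noncommutative) polynomial $Q(R_1,\dots,R_{n-1})$ in $R_1,\dots,R_{n-1}$, the action on $\mathcal{M}(R)$ of the generalized quantum Casimir operator $$C_Q^{(n)}(\hat K)=\mathrm{Tr}_{R(1\dots n)}\bigl(Q(R_1,\dots,R_{n-1})\,\hat K_{\underline{n\to1}}\bigr)$$ maps the characteristic subalgebra of $\mathcal{M}(R)$ into itself.
   Context: **Hecke symmetry.** $V$ is a complex vector space of dimension $N$. $I$ is the identity operator on $V$ or the $N\times N$ unit matrix, and $P$ is the flip on $V^{\otimes 2}$. A Hecke symmetry is $R\in\mathrm{End}(V^{\otimes 2})$ satisfying $(R\otimes I)(I\otimes R)(R\otimes I)=(I\otimes R)(R\otimes I)(I\otimes R)$ and $(qI\otimes I-R)(q^{-1}I\otimes I+R)=0$. Here $q\in\mathbb{C}\setminus\{0,\pm1\}$ is generic: $q^n\neq1$ for all positive integers $n$. Standing assumptions: $R$ is skew-invertible, i.e. there is $\Psi\in\mathrm{End}(V^{\otimes2})$ with $\mathrm{Tr}_2R_{12}\Psi_{23}=\mathrm{Tr}_2\Psi_{12}R_{23}=P_{13}$; $R^{-1}$ is also skew-invertible; and $R$ is taken from a family having a limit as $q\to1$ which is an involutive symmetry ($R^2=I\otimes I$ in the limit). **Matrix notation.** $R_i=I^{\otimes(i-1)}\otimes R\otimes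 I^{\otimes(k-i-1)}$ acts on $V^{\otimes k}$, with $k$ sufficiently large. For an $N\times N$ matrix $X$ (possibly with noncommuting entries, row index lower and column index upper) put $X_{\overline1}=X_1=X\otimes I^{\otimes(k-1)}$, $X_{\overline{r+1}}=R_rX_{\overline r}R_r^{-1}$, and $X_{\overline{1\to n}}=X_{\overline1}X_{\overline2}\cdots X_{\overline n}$. For $\hat K$ put also $\hat K_{\underline1}=\hat K_1$, $\hat K_{\underline{r+1}}=R_r^{-1}\hat K_{\underline r}R_r$, and $\hat K_{\underline{n\to1}}=\hat K_{\underline n}\hat K_{\underline{n-1}}\cdots\hat K_{\underline1}$. **R-trace.** $C$ is the $N\times N$ matrix with entries $C_i^j=\sum_k\Psi_{ik}^{jk}$, and $\mathrm{Tr}_{R(1\dots n)}(X)=\mathrm{Tr}_1(\cdots\mathrm{Tr}_n(C_1C_2\cdots C_nX)\cdots)$ for $X\in(\mathrm{Mat}_N)^{\otimes n}$, where $C_i$ is $C$ placed in the $i$-th tensor factor. **Algebras.** $\mathcal{M}(R)$ is the unital associative algebra generated by the entries of $M=\|m_i^j\|$ with relations $R_1M_1R_1M_1=M_1R_1M_1R_1$. $\mathcal{D}(R^{-1})$ is the unital associative algebra generated by the entries of $D=\|\partial_i^j\|$ with relations $R_1^{-1}D_1R_1^{-1}D_1=D_1R_1^{-1}D_1R_1^{-1}$. The quantum double $(\mathcal{D}(R^{-1}),\mathcal{M}(R))$ is the algebra formed by these two algebras together with the permutation relations $D_1R_1M_1R_1=R_1M_1R_1^{-1}D_1+R_1$,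 which allow any product $ab$ with $a\in\mathcal{D}(R^{-1})$, $b\in\mathcal{M}(R)$ to be rewritten as $\sum_i b_ia_i$ with $b_i\in\mathcal{M}(R)$, $a_i\in\mathcal{D}(R^{-1})$. The entries of $\hat L=MD$ are $\hat l_i^j=\sum_km_i^k\partial_k^j$. **Action.** Let $\varepsilon:\mathcal{D}(R^{-1})\to\mathbb{C}$ be the one-dimensional representation with $\varepsilon(1)=1$, $\varepsilon(\partial_i^j)=0$. For $a\in\mathcal{D}(R^{-1})$ and $b\in\mathcal{M}(R)$, if the permutation relations $D_1R_1M_1R_1=R_1M_1R_1^{-1}D_1+R_1$ rewrite the product $ab$ as $ab=\sum_ib_ia_i$ with $b_i\in\mathcal{M}(R)$, $a_i\in\mathcal{D}(R^{-1})$, then $a\triangleright b=\sum_i\varepsilon(a_i)b_i$. An element of the double of the form $b'a$ with $b'\in\mathcal{M}(R)$, $a\in\mathcal{D}(R^{-1})$ acts by $(b'a)\triangleright b=b'(a\triangleright b)$, and products in the double act as compositions of operators. **Characteristic subalgebra.** $H_n(q)$ is the Hecke algebra with generators $\tau_1,\dots,\tau_{n-1}$ and relations $\tau_i\tau_{i+1}\tau_i=\tau_{i+1}\tau_i\tau_{i+1}$, $\tau_i\tau_j=\tau_j\tau_i$ for $|i-j|\ge2$, $(q-\tau_i)(q^{-1}+\tau_i)=0$; $H_1(q)=\mathbb{C}$. Its $R$-matrix representation is $\rho_R(\tau_i)=R_i$. For $z\in H_n(q)$ put $ch_n(z)=\mathrm{Tr}_{R(1\dots n)}(\rho_R(z)M_{\overline{1\to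 n}})$. The characteristic subalgebra of $\mathcal{M}(R)$ is the (central, unital) subalgebra consisting of finite linear combinations of the elements $ch_n(z)$, $n\ge1$, $z\in H_n(q)$, and of the unit $1$ (the degree-zero component). *)

theory Defs
  imports "HOL-Analysis.Analysis" "HOL-Algebra.QuotRing" "HOL-Library.Poly_Mapping"
begin

section \<open>Free algebras and algebras given by generators and relations\<close>

text \<open>Words form a monoid under concatenation, so finitely supported functions from words to
  the complex numbers, with the convolution product of \<open>Poly_Mapping\<close>, form the free unital
  associative algebra.\<close>

datatype 'a word = Word (letters: "'a list")

instantiation word :: (type) monoid_add
begin
definition "0 = Word []"
definition "u + v = Word (letters u @ letters v)"
instance by standard (auto simp: zero_word_def plus_word_def)
end

type_synonym 'a falg = "'a word \<Rightarrow>\<^sub>0 complex"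

definition const :: "complex \<Rightarrow> 'a falg" where
  "const c = Poly_Mapping.single 0 c"

definition gen :: "'a \<Rightarrow> 'a falg" where
  "gen x = Poly_Mapping.single (Word [x]) 1"

definition free_algebra :: "'a set \<Rightarrow> 'a falg ring" where
  "free_algebra A = \<lparr>carrier = {p. \<forall>w\<in>Poly_Mapping.keys p. set (letters w) \<subseteq> A},
     mult = (*), one = 1, zero = 0, add = (+)\<rparr>"

text \<open>The algebra generated by \<open>A\<close> with relations \<open>r = 0\<close> for \<open>r \<in> S\<close>.\<close>

definition presented_algebra :: "'a set \<Rightarrow> 'a falg set \<Rightarrow> 'a falg set ring" where
  "presented_algebra A S =
     free_algebra A Quot (genideal (free_algebra A) S)"

definition presented_class :: "'a set \<Rightarrow> 'a falg set \<Rightarrow> 'a falg \<Rightarrow> 'a falg set" where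
  "presented_class A S x = a_r_coset (free_algebra A) (genideal (free_algebra A) S) x"


section \<open>Matrices on tensor powers\<close>

text \<open>A basis of the \<open>k\<close>-th tensor power of \<open>V\<close> is indexed by the lists of length \<open>k\<close> over
  \<open>'v\<close>, where \<open>N = CARD('v)\<close>. A matrix is a function of its row (lower) index and its column
  (upper) index; its entries at lists of other lengths carry no meaning.\<close>

type_synonym 'v endo2 = "complex ^ ('v \<times> 'v) ^ ('v \<times> 'v)"
type_synonym ('v, 'a) tmat = "'v list \<Rightarrow> 'v list \<Rightarrow> 'a"

definition tensor_index :: "nat \<Rightarrow> 'v list set" where
  "tensor_index k = {u. length u = k}"

definition tmat_one :: "('v, 'a::ring_1) tmat" where
  "tmat_one u v = (if u = v then 1 else 0)"

definition tmat_mult :: "nat \<Rightarrow> ('v, 'a::ring_1) tmat \<Rightarrow> ('v, 'a) tmat \<Rightarrow> ('v, 'a) tmat" where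
  "tmat_mult k A B u v = (\<Sum>w\<in>tensor_index k. A u w * B w v)"

definition tmat_prod :: "nat \<Rightarrow> ('v, 'a::ring_1) tmat list \<Rightarrow> ('v, 'a) tmat" where
  "tmat_prod k As = foldr (tmat_mult k) As tmat_one"

text \<open>\<open>at1 i X\<close> is \<open>X\<close> in the \<open>i\<close>-th tensor factor and \<open>at2 i A\<close> is \<open>A\<close> in the factors
  \<open>i, i + 1\<close>; tensor factors are counted from 1, positions in a list from 0.\<close>

definition at1 :: "nat \<Rightarrow> ('v \<Rightarrow> 'v \<Rightarrow> 'a::ring_1) \<Rightarrow> ('v, 'a) tmat" where
  "at1 i X u v =
     (if \<forall>j<length u. j \<noteq> i - 1 \<longrightarrow> u ! j = v ! j then X (u ! (i - 1)) (v ! (i - 1)) else 0)"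

definition at2 :: "nat \<Rightarrow> 'v::finite endo2 \<Rightarrow> ('v, complex) tmat" where
  "at2 i A u v =
     (if \<forall>j<length u. j \<noteq> i - 1 \<and> j \<noteq> i \<longrightarrow> u ! j = v ! j
      then A $ (u ! (i - 1), u ! i) $ (v ! (i - 1), v ! i) else 0)"

definition lift :: "('v, complex) tmat \<Rightarrow> ('v, 'a falg) tmat" where
  "lift A u v = const (A u v)"

definition matrix_relations ::
    "nat \<Rightarrow> ('v, 'a::ring_1) tmat \<Rightarrow> ('v, 'a) tmat \<Rightarrow> 'a set" where
  "matrix_relations k A B = {A u v - B u v | u v. u \<in> tensor_index k \<and> v \<in> tensor_index k}"


section \<open>Hecke symmetries\<close>

definition braid_relation :: "'v::finite endo2 \<Rightarrow> bool" where
  "braid_relation R \<longleftrightarrow> (\<forall>u\<in>tensor_index 3. \<forall>v\<in>tensor_index 3.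
     tmat_prod 3 [at2 1 R, at2 2 R, at2 1 R] u v = tmat_prod 3 [at2 2 R, at2 1 R, at2 2 R] u v)"

definition hecke_symmetry :: "complex \<Rightarrow> 'v::finite endo2 \<Rightarrow> bool" where
  "hecke_symmetry q R \<longleftrightarrow> q \<notin> {0, 1, -1} \<and> braid_relation R \<and>
     (mat q - R) ** (mat (inverse q) + R) = 0"

definition involutive_symmetry :: "'v::finite endo2 \<Rightarrow> bool" where
  "involutive_symmetry R \<longleftrightarrow> braid_relation R \<and> R ** R = mat 1"

text \<open>The partial trace over the second factor equals the flip of the factors 1 and 3.\<close>

definition is_skew_inverse :: "'v::finite endo2 \<Rightarrow> 'v endo2 \<Rightarrow> bool" where
  "is_skew_inverse R \<Psi> \<longleftrightarrow> (\<forall>i j k l.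
     (\<Sum>a\<in>UNIV. tmat_mult 3 (at2 1 R) (at2 2 \<Psi>) [i, a, j] [k, a, l])
       = (if i = l \<and> j = k then 1 else 0) \<and>
     (\<Sum>a\<in>UNIV. tmat_mult 3 (at2 1 \<Psi>) (at2 2 R) [i, a, j] [k, a, l])
       = (if i = l \<and> j = k then 1 else 0))"

definition skew_invertible :: "'v::finite endo2 \<Rightarrow> bool" where
  "skew_invertible R \<longleftrightarrow> (\<exists>\<Psi>. is_skew_inverse R \<Psi>)"

definition skew_inverse :: "'v::finite endo2 \<Rightarrow> 'v endo2" where
  "skew_inverse R = (THE \<Psi>. is_skew_inverse R \<Psi>)"

definition C_matrix :: "'v::finite endo2 \<Rightarrow> 'v \<Rightarrow> 'v \<Rightarrow> complex" where
  "C_matrix R i j = (\<Sum>k\<in>UNIV. skew_inverse R $ (i, k) $ (j, k))"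

definition R_trace :: "'v::finite endo2 \<Rightarrow> nat \<Rightarrow> ('v, 'a falg) tmat \<Rightarrow> 'a falg" where
  "R_trace R n X = (\<Sum>u\<in>tensor_index n.
     tmat_mult n (lift (tmat_prod n (map (\<lambda>i. at1 i (C_matrix R)) [1..<Suc n]))) X u u)"

text \<open>The recursion is shifted by one: \<open>overlined R k X r\<close> and \<open>underlined R k X r\<close> are the
  copies of \<open>X\<close> with index \<open>r + 1\<close>, acting on the \<open>k\<close>-th tensor power.\<close>

primrec overlined ::
    "'v::finite endo2 \<Rightarrow> nat \<Rightarrow> ('v \<Rightarrow> 'v \<Rightarrow> 'a falg) \<Rightarrow> nat \<Rightarrow> ('v, 'a falg) tmat" where
  "overlined R k X 0 = at1 1 X"
| "overlined R k X (Suc r) = tmat_prod k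
     [lift (at2 (Suc r) R), overlined R k X r, lift (at2 (Suc r) (matrix_inv R))]"

primrec underlined ::
    "'v::finite endo2 \<Rightarrow> nat \<Rightarrow> ('v \<Rightarrow> 'v \<Rightarrow> 'a falg) \<Rightarrow> nat \<Rightarrow> ('v, 'a falg) tmat" where
  "underlined R k X 0 = at1 1 X"
| "underlined R k X (Suc r) = tmat_prod k
     [lift (at2 (Suc r) (matrix_inv R)), underlined R k X r, lift (at2 (Suc r) R)]"

definition overlined_prod ::
    "'v::finite endo2 \<Rightarrow> nat \<Rightarrow> ('v \<Rightarrow> 'v \<Rightarrow> 'a falg) \<Rightarrow> ('v, 'a falg) tmat" where
  "overlined_prod R n X = tmat_prod n (map (overlined R n X) [0..<n])"

definition underlined_prod ::
    "'v::finite endo2 \<Rightarrow> nat \<Rightarrow> ('v \<Rightarrow> 'v \<Rightarrow> 'a falg) \<Rightarrow> ('v, 'a falg) tmat" where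
  "underlined_prod R n X = tmat_prod n (map (underlined R n X) (rev [0..<n]))"

text \<open>The value of a noncommutative polynomial, with letters in \<open>{1..<n}\<close>, at the
  matrices \<open>R\<^sub>1, \<dots>, R\<^sub>n\<^sub>-\<^sub>1\<close> on the \<open>n\<close>-th tensor power.\<close>

definition eval_R :: "'v::finite endo2 \<Rightarrow> nat \<Rightarrow> nat falg \<Rightarrow> ('v, complex) tmat" where
  "eval_R R n Q u v = (\<Sum>w\<in>Poly_Mapping.keys Q.
     Poly_Mapping.lookup Q w * tmat_prod n (map (\<lambda>i. at2 i R) (letters w)) u v)"


section \<open>The quantum double\<close>

text \<open>\<open>MGen i j\<close> is the entry of \<open>M\<close> in row \<open>i\<close> and column \<open>j\<close>, \<open>DGen i j\<close> that of \<open>D\<close>. All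
  three algebras are quotients of subalgebras of one free algebra, so the canonical maps from
  \<open>M(R)\<close> and \<open>D(R\<^sup>-\<^sup>1)\<close> to the double are the identity on representatives.\<close>

datatype 'v dgen = MGen 'v 'v | DGen 'v 'v

definition M_gens :: "'v dgen set" where "M_gens = {MGen i j | i j. True}"
definition D_gens :: "'v dgen set" where "D_gens = {DGen i j | i j. True}"

definition M_mat :: "'v \<Rightarrow> 'v \<Rightarrow> 'v dgen falg" where "M_mat i j = gen (MGen i j)"
definition D_mat :: "'v \<Rightarrow> 'v \<Rightarrow> 'v dgen falg" where "D_mat i j = gen (DGen i j)"

definition M_relations :: "'v::finite endo2 \<Rightarrow> 'v dgen falg set" where
  "M_relations R = (let R\<^sub>1 = lift (at2 1 R); M\<^sub>1 = at1 1 M_mat in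
     matrix_relations 2 (tmat_prod 2 [R\<^sub>1, M\<^sub>1, R\<^sub>1, M\<^sub>1]) (tmat_prod 2 [M\<^sub>1, R\<^sub>1, M\<^sub>1, R\<^sub>1]))"

definition D_relations :: "'v::finite endo2 \<Rightarrow> 'v dgen falg set" where
  "D_relations R = (let S\<^sub>1 = lift (at2 1 (matrix_inv R)); D\<^sub>1 = at1 1 D_mat in
     matrix_relations 2 (tmat_prod 2 [S\<^sub>1, D\<^sub>1, S\<^sub>1, D\<^sub>1]) (tmat_prod 2 [D\<^sub>1, S\<^sub>1, D\<^sub>1, S\<^sub>1]))"

definition permutation_relations :: "'v::finite endo2 \<Rightarrow> 'v dgen falg set" where
  "permutation_relations R =
     (let R\<^sub>1 = lift (at2 1 R); S\<^sub>1 = lift (at2 1 (matrix_inv R));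
          M\<^sub>1 = at1 1 M_mat; D\<^sub>1 = at1 1 D_mat in
      matrix_relations 2 (tmat_prod 2 [D\<^sub>1, R\<^sub>1, M\<^sub>1, R\<^sub>1])
        (\<lambda>u v. tmat_prod 2 [R\<^sub>1, M\<^sub>1, S\<^sub>1, D\<^sub>1] u v + R\<^sub>1 u v))"

definition double_relations :: "'v::finite endo2 \<Rightarrow> 'v dgen falg set" where
  "double_relations R = M_relations R \<union> D_relations R \<union> permutation_relations R"

definition M_algebra :: "'v::finite endo2 \<Rightarrow> 'v dgen falg set ring" where
  "M_algebra R = presented_algebra M_gens (M_relations R)"

definition double_algebra :: "'v::finite endo2 \<Rightarrow> 'v dgen falg set ring" where
  "double_algebra R = presented_algebra UNIV (double_relations R)"

definition M_class :: "'v::finite endo2 \<Rightarrow> 'v dgen falg \<Rightarrow> 'v dgen falg set" where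
  "M_class R = presented_class M_gens (M_relations R)"

definition double_class :: "'v::finite endo2 \<Rightarrow> 'v dgen falg \<Rightarrow> 'v dgen falg set" where
  "double_class R = presented_class UNIV (double_relations R)"

text \<open>On representatives, the character \<open>\<epsilon>\<close> of \<open>D(R\<^sup>-\<^sup>1)\<close> that kills the generators is the
  constant coefficient; it vanishes on the ideal because the relations are homogeneous of
  degree 2.\<close>

definition counit :: "'v dgen falg \<Rightarrow> complex" where
  "counit a = Poly_Mapping.lookup a 0"


section \<open>The action of the double on \<open>M(R)\<close>\<close>

text \<open>\<open>acts R X b c\<close> says that \<open>X\<close>, an element of the double, sends \<open>b\<close> to \<open>c\<close> (elements of
  \<open>M(R)\<close>). The sum rule extends the action linearly from the elements \<open>b' a\<close>.\<close>

inductive acts ::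
    "'v::finite endo2 \<Rightarrow> 'v dgen falg set \<Rightarrow> 'v dgen falg set \<Rightarrow> 'v dgen falg set \<Rightarrow> bool"
  for R :: "'v::finite endo2" where
  rewriting:
    "\<lbrakk>a \<in> carrier (free_algebra D_gens); b \<in> carrier (free_algebra M_gens);
      \<And>i. i < k \<Longrightarrow> bs i \<in> carrier (free_algebra M_gens);
      \<And>i. i < k \<Longrightarrow> ds i \<in> carrier (free_algebra D_gens);
      double_class R (a * b) = double_class R (\<Sum>i<k::nat. bs i * ds i)\<rbrakk>
     \<Longrightarrow> acts R (double_class R a) (M_class R b)
           (M_class R (\<Sum>i<k. const (counit (ds i)) * bs i))"
| left_mult:
    "\<lbrakk>b' \<in> carrier (free_algebra M_gens); a \<in> carrier (free_algebra D_gens);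
      acts R (double_class R a) x y\<rbrakk>
     \<Longrightarrow> acts R (double_class R (b' * a)) x (M_class R b' \<otimes>\<^bsub>M_algebra R\<^esub> y)"
| sum:
    "\<lbrakk>acts R X x y; acts R Y x z\<rbrakk>
     \<Longrightarrow> acts R (X \<oplus>\<^bsub>double_algebra R\<^esub> Y) x (y \<oplus>\<^bsub>M_algebra R\<^esub> z)"
| composition:
    "\<lbrakk>acts R Y x y; acts R X y z\<rbrakk> \<Longrightarrow> acts R (X \<otimes>\<^bsub>double_algebra R\<^esub> Y) x z"

text \<open>Reading the result off with \<open>THE\<close> means that nothing can be proved about it unless the
  rules determine it uniquely.\<close>

definition action ::
    "'v::finite endo2 \<Rightarrow> 'v dgen falg set \<Rightarrow> 'v dgen falg set \<Rightarrow> 'v dgen falg set" where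
  "action R X x = (THE y. acts R X x y)"


section \<open>The characteristic subalgebra\<close>

definition hecke_relations :: "complex \<Rightarrow> nat \<Rightarrow> nat falg set" where
  "hecke_relations q n =
     {gen i * gen (i + 1) * gen i - gen (i + 1) * gen i * gen (i + 1) | i. 1 \<le> i \<and> i + 1 < n}
   \<union> {gen i * gen j - gen j * gen i | i j. i \<in> {1..<n} \<and> j \<in> {1..<n} \<and> (i + 2 \<le> j \<or> j + 2 \<le> i)}
   \<union> {(const q - gen i) * (const (inverse q) + gen i) | i. i \<in> {1..<n}}"

definition hecke_algebra :: "complex \<Rightarrow> nat \<Rightarrow> nat falg set ring" where
  "hecke_algebra q n = presented_algebra {1..<n} (hecke_relations q n)"

text \<open>An element of the Hecke algebra is a coset; the matrices \<open>R\<^sub>i\<close> satisfy its relations, so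
  any representative gives the same matrix on the \<open>n\<close>-th tensor power.\<close>

definition hecke_rep :: "'v::finite endo2 \<Rightarrow> nat \<Rightarrow> nat falg set \<Rightarrow> ('v, complex) tmat" where
  "hecke_rep R n z = eval_R R n (SOME p. p \<in> z)"

definition ch :: "'v::finite endo2 \<Rightarrow> nat \<Rightarrow> nat falg set \<Rightarrow> 'v dgen falg" where
  "ch R n z = R_trace R n (tmat_mult n (lift (hecke_rep R n z)) (overlined_prod R n M_mat))"

definition characteristic_subalgebra ::
    "complex \<Rightarrow> 'v::finite endo2 \<Rightarrow> 'v dgen falg set set" where
  "characteristic_subalgebra q R = M_class R `
     module.span (\<lambda>c x. const c * x)
       (insert 1 {ch R n z | n z. 1 \<le> n \<and> z \<in> carrier (hecke_algebra q n)})"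


section \<open>Generalized quantum Casimir operators\<close>

definition L_mat :: "'v::finite \<Rightarrow> 'v \<Rightarrow> 'v dgen falg" where
  "L_mat i j = (\<Sum>k\<in>UNIV. M_mat i k * D_mat k j)"

definition K_mat :: "complex \<Rightarrow> 'v::finite \<Rightarrow> 'v \<Rightarrow> 'v dgen falg" where
  "K_mat q i j = (if i = j then 1 else 0) - const (q - inverse q) * L_mat i j"

definition casimir ::
    "complex \<Rightarrow> 'v::finite endo2 \<Rightarrow> nat \<Rightarrow> nat falg \<Rightarrow> 'v dgen falg" where
  "casimir q R n Q =
     R_trace R n (tmat_mult n (lift (eval_R R n Q)) (underlined_prod R n (K_mat q)))"

end

(*
Tensor powers of all sizes live in one ring of operators on functions from index sequences to the
free algebra, with matrix units E i a b in infinitely many tensor slots.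

The action is well defined. Solving the permutation relations for the products d m with the skew
inverse of R defines an action of the generators d on the whole free algebra for which the
permutation relations hold exactly. The defect Theta of the relations of D(R^-1) then satisfies
Theta M_3 = M_3 Theta J (M_3 the overlined copy, J numerical) and kills the constants, so it
vanishes; a similar commutation shows that the d preserve the ideal of relations of M(R).

The theorem. Modulo the relations of M(R) one has K R M = R^-1 M R K R^-1, where R = R_1, M = M_1,
K = K_1. With underlined copies mu of M and a = R_n^-1...R_1^-1 (R_n...R_1)^-1 this gives
K_(n->1) M_(n+1) = mu_(n+1) K_(n->1) a. As K acts on constants as the identity, induction on m
yields K_(n->1) M_(n+1)...M_(n+m) = A M_(n+1)...M_(n+m) on constants with A in the Hecke algebra.
The R-trace is cyclic with respect to the Hecke algebra, is invariant under the shift of slots and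
maps H_(n+m) to H_m when the last n slots are contracted. Hence, with z' the shift of z,
  C_Q ch_m(z) = Tr_(1..n+m)(Q z' A M_(n+1)...M_(n+m)) = ch_m(y)
for some y in H_m.
*)

theory Submission
  imports Defs
begin


section \<open>Operators on tensor slots\<close>

text \<open>\<open>action\<close> is read off with \<open>THE\<close> from an inductive relation, so
  nothing can be said about it until that relation is shown to be a function: uniqueness needs a
  genuine representation of the double, existence needs every product of a derivative with an
  element of M(R) to be reordered. The recurring obstacle is that the relations bind whole matrices
  while the action concerns single entries: in D R M the factor R stands between the two matrices,
  and only the skew inverse separates their entries. One cancellation lemma, for sets of operators
  stable under numerical matrices, does this for the relations of D(R^-1), for those of M(R) and for
  the reordering. Congruences are also expressed by sets of operators: those modulo the relations
  may be multiplied on both sides, those on the vacuum only by numerical matrices on the right.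
  Infinitely many slots are available because traces over n, m and n + m slots are compared and
  shifted. The coefficient q - q^-1 in K is the one for which R - (q - q^-1) = R^-1 absorbs the
  constant term of the permutation relations.\<close>

text \<open>Matrices with noncommuting entries on a tensor power are handled inside one ring containing
  matrix units \<open>E i a b\<close> for every tensor slot \<open>i\<close>; slots are counted from 0.\<close>

lemma sum_UNIV_prod:
  "(\<Sum>p\<in>UNIV. f p) = (\<Sum>a\<in>UNIV. \<Sum>b\<in>UNIV. f (a :: 'a::finite, b :: 'b::finite))"
  by (simp add: sum.cartesian_product case_prod_unfold)

locale tensor_slots =
  fixes sc :: "complex \<Rightarrow> 'r::ring_1" and E :: "nat \<Rightarrow> 'v::finite \<Rightarrow> 'v \<Rightarrow> 'r"
  assumes sc_add: "sc (x + y) = sc x + sc y"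
    and sc_mult: "sc (x * y) = sc x * sc y"
    and sc_1 [simp]: "sc 1 = 1"
    and sc_comm: "Z * sc x = sc x * Z"
    and sc_inj: "inj sc"
    and E_mult: "E i a b * E i c d = (if b = c then E i a d else 0)"
    and E_sum: "(\<Sum>a\<in>UNIV. E i a a) = 1"
    and E_comm: "i \<noteq> j \<Longrightarrow> E i a b * E j c d = E j c d * E i a b"
begin

lemma sc_0 [simp]: "sc 0 = 0"
  using sc_add[of 0 0] by simp

lemma sc_minus: "sc (- x) = - sc x"
  using sc_add[of x "- x"] by (simp add: eq_neg_iff_add_eq_0 add.commute)

lemma sc_diff: "sc (x - y) = sc x - sc y"
  using sc_add[of x "- y"] by (simp add: sc_minus)

lemma sc_sum: "sc (sum f A) = (\<Sum>x\<in>A. sc (f x))"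
  by (induction A rule: infinite_finite_induct) (simp_all add: sc_add)

lemma sc_left: "Z * (sc x * Y) = sc x * (Z * Y)"
  by (simp add: sc_comm mult.assoc[symmetric])

lemma E_mult': "E i a b * (E i c d * Z) = (if b = c then E i a d * Z else 0)"
  by (simp add: mult.assoc[symmetric] E_mult)

text \<open>Commuting with all matrix units of a slot is the intrinsic way to say that an operator
  does not touch it; no normal form of elements of the ring is required.\<close>

definition away :: "nat \<Rightarrow> 'r \<Rightarrow> bool" where
  "away i Z \<longleftrightarrow> (\<forall>a b. E i a b * Z = Z * E i a b)"

lemma awayD: "away i Z \<Longrightarrow> E i a b * Z = Z * E i a b"
  by (simp add: away_def)

lemma awayD': "away i Z \<Longrightarrow> E i a b * (Z * Y) = Z * (E i a b * Y)"
  by (simp add: awayD mult.assoc[symmetric])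

lemma away_1 [simp]: "away i 1" and away_0 [simp]: "away i 0"
  by (simp_all add: away_def)

lemma away_add: "away i X \<Longrightarrow> away i Y \<Longrightarrow> away i (X + Y)"
  by (simp add: away_def distrib_left distrib_right)

lemma away_diff: "away i X \<Longrightarrow> away i Y \<Longrightarrow> away i (X - Y)"
  by (simp add: away_def left_diff_distrib right_diff_distrib)

lemma away_mult: "away i X \<Longrightarrow> away i Y \<Longrightarrow> away i (X * Y)"
  by (simp add: away_def mult.assoc) (metis mult.assoc)

lemma away_sum: "(\<And>x. x \<in> A \<Longrightarrow> away i (f x)) \<Longrightarrow> away i (sum f A)"
  by (induction A rule: infinite_finite_induct) (auto intro: away_add)

lemma away_sc [simp]: "away i (sc x)"
  by (simp add: away_def sc_comm)

lemma away_E: "i \<noteq> j \<Longrightarrow> away i (E j a b)"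
  by (simp add: away_def E_comm)

text \<open>\<open>co i a b Z\<close> is the entry of \<open>Z\<close> in row \<open>a\<close> and column \<open>b\<close> of slot \<open>i\<close>.\<close>

definition co :: "nat \<Rightarrow> 'v \<Rightarrow> 'v \<Rightarrow> 'r \<Rightarrow> 'r" where
  "co i a b Z = (\<Sum>s\<in>UNIV. E i s a * Z * E i b s)"

lemma co_add: "co i a b (X + Y) = co i a b X + co i a b Y"
  by (simp add: co_def distrib_left distrib_right sum.distrib)

lemma co_0 [simp]: "co i a b 0 = 0"
  by (simp add: co_def)

lemma co_diff: "co i a b (X - Y) = co i a b X - co i a b Y"
  by (simp add: co_def left_diff_distrib right_diff_distrib sum_subtractf)

lemma co_sum: "co i a b (sum f A) = (\<Sum>x\<in>A. co i a b (f x))"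
  by (induction A rule: infinite_finite_induct) (simp_all add: co_add)

lemma co_away_left: "away i X \<Longrightarrow> co i a b (X * Y) = X * co i a b Y"
  by (simp add: co_def sum_distrib_left mult.assoc awayD' )

lemma co_away_right: "away i Y \<Longrightarrow> co i a b (X * Y) = co i a b X * Y"
  by (simp add: co_def sum_distrib_right mult.assoc awayD)

lemma co_sc: "co i a b (sc x * Y) = sc x * co i a b Y"
  by (simp add: co_away_left)

lemma co_1: "co i a b 1 = (if a = b then 1 else 0)"
  by (auto simp: co_def E_mult E_sum)

lemma co_E: "co i a b (E i c d) = (if a = c \<and> b = d then 1 else 0)"
  by (cases "a = c"; cases "b = d") (simp_all add: co_def E_mult E_sum)

lemma away_co_same: "away i (co i a b Z)"
proof -
  have "E i c d * co i a b Z = E i c a * Z * E i b d" for c d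
  proof -
    have "E i c d * co i a b Z = (\<Sum>s\<in>UNIV. if s = d then E i c a * Z * E i b s else 0)"
      unfolding co_def sum_distrib_left
      by (intro sum.cong refl) (auto simp: mult.assoc[symmetric] E_mult)
    then show ?thesis by simp
  qed
  moreover have "co i a b Z * E i c d = E i c a * Z * E i b d" for c d
  proof -
    have "co i a b Z * E i c d = (\<Sum>s\<in>UNIV. if s = c then E i s a * Z * E i b d else 0)"
      unfolding co_def sum_distrib_right
      by (intro sum.cong refl) (auto simp: mult.assoc E_mult)
    then show ?thesis by simp
  qed
  ultimately show ?thesis by (simp add: away_def)
qed

lemma E_co_E: "E i s a * Z * E i b t = co i a b Z * E i s t"
proof -
  have "co i a b Z * E i s t = (\<Sum>u\<in>UNIV. if u = s then E i u a * Z * E i b t else 0)"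
    unfolding co_def sum_distrib_right
    by (intro sum.cong refl) (auto simp: mult.assoc E_mult)
  then show ?thesis by simp
qed

lemma away_co: "away j Z \<Longrightarrow> away j (co i a b Z)"
proof (cases "i = j")
  case False
  then show "away j Z \<Longrightarrow> ?thesis"
    unfolding co_def by (intro away_sum away_mult away_E) auto
qed (simp add: away_co_same)

text \<open>Inserting the resolution of the identity by the units \<open>E i a a\<close> on both
  sides shows that the whole ring is a matrix ring over the centralizer of slot i. Arguments about
  arbitrary operators thereby reduce to matrix units.\<close>

lemma co_expand: "Z = (\<Sum>a\<in>UNIV. \<Sum>b\<in>UNIV. co i a b Z * E i a b)"
proof -
  have "(\<Sum>a\<in>UNIV. \<Sum>b\<in>UNIV. co i a b Z * E i a b)
      = (\<Sum>a\<in>UNIV. \<Sum>b\<in>UNIV. E i a a * Z * E i b b)"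
    by (simp add: E_co_E)
  also have "\<dots> = (\<Sum>a\<in>UNIV. E i a a) * Z * (\<Sum>b\<in>UNIV. E i b b)"
    by (subst sum_distrib_right) (rule sum_product[symmetric])
  finally show ?thesis by (simp add: E_sum)
qed

lemma co_mult: "co i a b (X * Y) = (\<Sum>c\<in>UNIV. co i a c X * co i c b Y)"
proof -
  have "co i a b (X * Y) = (\<Sum>c\<in>UNIV. \<Sum>d\<in>UNIV. co i a b (co i c d X * (E i c d * Y)))"
    by (subst co_expand[of X i])
      (simp add: sum_distrib_right sum_distrib_left co_sum mult.assoc)
  also have "\<dots> = (\<Sum>c\<in>UNIV. \<Sum>d\<in>UNIV. if a = c then co i c d X * co i d b Y else 0)"
  proof (intro sum.cong refl)
    fix c d
    have "co i a b (E i c d * Y) = (if a = c then co i d b Y else 0)"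
      by (auto simp: co_def mult.assoc[symmetric] E_mult)
    then show "co i a b (co i c d X * (E i c d * Y))
        = (if a = c then co i c d X * co i d b Y else 0)"
      by (simp add: co_away_left away_co_same)
  qed
  also have "\<dots> = (\<Sum>c\<in>UNIV. if a = c then \<Sum>d\<in>UNIV. co i c d X * co i d b Y else 0)"
    by (intro sum.cong refl) auto
  finally show ?thesis by simp
qed

lemma co_co_comm: "i \<noteq> j \<Longrightarrow> co i a b (co j c d Z) = co j c d (co i a b Z)"
proof -
  assume ij: "i \<noteq> j"
  have "E i s a * (E j t c * Z * E j d t) * E i b s = E j t c * (E i s a * Z * E i b s) * E j d t"
    for s t
  proof -
    have "E i s a * (E j t c * Z * E j d t) * E i b s
        = (E i s a * E j t c) * Z * (E j d t * E i b s)"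
      by (simp only: mult.assoc)
    also have "\<dots> = (E j t c * E i s a) * Z * (E i b s * E j d t)"
      by (simp only: E_comm[OF ij, of s a t c] E_comm[OF ij, of b s d t])
    finally show ?thesis by (simp only: mult.assoc)
  qed
  then show ?thesis
    unfolding co_def sum_distrib_left sum_distrib_right by (subst sum.swap) simp
qed

section \<open>Partial traces weighted by a numerical matrix\<close>

definition ptr :: "('v \<Rightarrow> 'v \<Rightarrow> complex) \<Rightarrow> nat \<Rightarrow> 'r \<Rightarrow> 'r" where
  "ptr c i Z = (\<Sum>a\<in>UNIV. \<Sum>b\<in>UNIV. sc (c b a) * co i a b Z)"

lemma ptr_add: "ptr c i (X + Y) = ptr c i X + ptr c i Y"
  by (simp add: ptr_def co_add distrib_left sum.distrib)

lemma ptr_0 [simp]: "ptr c i 0 = 0"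
  by (simp add: ptr_def)

lemma ptr_diff: "ptr c i (X - Y) = ptr c i X - ptr c i Y"
  by (simp add: ptr_def co_diff right_diff_distrib sum_subtractf)

lemma ptr_sum: "ptr c i (sum f A) = (\<Sum>x\<in>A. ptr c i (f x))"
  by (induction A rule: infinite_finite_induct) (simp_all add: ptr_add)

lemma ptr_away_left: "away i X \<Longrightarrow> ptr c i (X * Y) = X * ptr c i Y"
  by (simp add: ptr_def co_away_left sum_distrib_left sc_left)

lemma ptr_away_right: "away i Y \<Longrightarrow> ptr c i (X * Y) = ptr c i X * Y"
  by (simp add: ptr_def co_away_right sum_distrib_right mult.assoc)

lemma ptr_sc: "ptr c i (sc x * Y) = sc x * ptr c i Y"
  by (simp add: ptr_away_left)

lemma ptr_E: "ptr c i (E i a b) = sc (c b a)"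
proof -
  have "ptr c i (E i a b) = (\<Sum>x\<in>UNIV. if x = a then (\<Sum>y\<in>UNIV. if y = b then sc (c y x) else 0) else 0)"
    unfolding ptr_def co_E
    by (intro sum.cong refl) (simp add: if_distrib[of "(*) _"] cong: if_cong)
  then show ?thesis by simp
qed

lemma away_ptr_same: "away i (ptr c i Z)"
  unfolding ptr_def by (intro away_sum away_mult away_sc away_co_same)

lemma away_ptr: "away j Z \<Longrightarrow> away j (ptr c i Z)"
  unfolding ptr_def by (intro away_sum away_mult away_sc away_co)

lemma ptr_co_comm: "i \<noteq> j \<Longrightarrow> ptr c i (co j x y Z) = co j x y (ptr c i Z)"
  by (simp add: ptr_def co_sum co_sc co_co_comm)

lemma ptr_1: "ptr c i 1 = sc (\<Sum>a\<in>UNIV. c a a)"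
proof -
  have "ptr c i 1 = (\<Sum>a\<in>UNIV. ptr c i (E i a a))"
    by (simp add: ptr_sum[symmetric] E_sum)
  then show ?thesis by (simp add: ptr_E sc_sum)
qed

text \<open>The slots i, ..., i + k - 1 are contracted with the last one innermost, as in the nested
  traces that define the R-trace; in each slot the weight enters as Tr(c Z).\<close>

primrec ptrs :: "('v \<Rightarrow> 'v \<Rightarrow> complex) \<Rightarrow> nat \<Rightarrow> nat \<Rightarrow> 'r \<Rightarrow> 'r" where
  "ptrs c i 0 Z = Z"
| "ptrs c i (Suc k) Z = ptr c i (ptrs c (Suc i) k Z)"

lemma ptrs_add: "ptrs c i k (X + Y) = ptrs c i k X + ptrs c i k Y"
  by (induction k arbitrary: i) (simp_all add: ptr_add)

lemma ptrs_0 [simp]: "ptrs c i k 0 = 0"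
  by (induction k arbitrary: i) simp_all

lemma ptrs_sum: "ptrs c i k (sum f A) = (\<Sum>x\<in>A. ptrs c i k (f x))"
  by (induction A rule: infinite_finite_induct) (simp_all add: ptrs_add)

lemma ptrs_away_left:
  "(\<And>j. i \<le> j \<Longrightarrow> j < i + k \<Longrightarrow> away j X) \<Longrightarrow> ptrs c i k (X * Y) = X * ptrs c i k Y"
  by (induction k arbitrary: i) (simp_all add: ptr_away_left)

lemma ptrs_away_right:
  "(\<And>j. i \<le> j \<Longrightarrow> j < i + k \<Longrightarrow> away j Y) \<Longrightarrow> ptrs c i k (X * Y) = ptrs c i k X * Y"
  by (induction k arbitrary: i) (simp_all add: ptr_away_right)

lemma ptrs_append: "ptrs c i (k + l) Z = ptrs c i k (ptrs c (i + k) l Z)"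
  by (induction k arbitrary: i) simp_all

lemma away_ptrs: "away j Z \<Longrightarrow> away j (ptrs c i k Z)"
  by (induction k arbitrary: i) (simp_all add: away_ptr)

lemma away_ptrs_same: "i \<le> j \<Longrightarrow> j < i + k \<Longrightarrow> away j (ptrs c i k Z)"
proof (induction k arbitrary: i)
  case (Suc k)
  then show ?case
    by (cases "i = j") (auto simp: away_ptr_same intro: away_ptr)
qed simp

lemma ptrs_Suc_right: "ptrs c i (Suc k) Z = ptrs c i k (ptr c (i + k) Z)"
  using ptrs_append[of c i k 1 Z] by simp

section \<open>Numerical matrices on two slots\<close>

definition tens :: "'v endo2 \<Rightarrow> nat \<Rightarrow> nat \<Rightarrow> 'r" where
  "tens A i j = (\<Sum>p\<in>UNIV. \<Sum>s\<in>UNIV.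
     sc (A $ p $ s) * (E i (fst p) (fst s) * E j (snd p) (snd s)))"

lemma tens_diff: "tens (A - B) i j = tens A i j - tens B i j"
  by (simp add: tens_def sc_diff left_diff_distrib sum_subtractf)

lemma tens_mat: "i \<noteq> j \<Longrightarrow> tens (mat x) i j = sc x"
proof -
  assume "i \<noteq> j"
  have "tens (mat x) i j = (\<Sum>p\<in>UNIV. sc x * (E i (fst p) (fst p) * E j (snd p) (snd p)))"
    unfolding tens_def
  proof (intro sum.cong refl)
    fix p :: "'v \<times> 'v"
    have "(\<Sum>s\<in>UNIV. sc (mat x $ p $ s) * (E i (fst p) (fst s) * E j (snd p) (snd s)))
      = (\<Sum>s\<in>UNIV. if s = p then sc x * (E i (fst p) (fst s) * E j (snd p) (snd s)) else 0)"
      by (intro sum.cong refl) (auto simp: mat_def)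
    then show "(\<Sum>s\<in>UNIV. sc (mat x $ p $ s) * (E i (fst p) (fst s) * E j (snd p) (snd s)))
      = sc x * (E i (fst p) (fst p) * E j (snd p) (snd p))" by simp
  qed
  also have "\<dots> = sc x * (\<Sum>a\<in>UNIV. \<Sum>b\<in>UNIV. E i a a * E j b b)"
    by (simp only: sum_distrib_left sum_UNIV_prod fst_conv snd_conv)
  also have "\<dots> = sc x"
    by (simp add: sum_distrib_left[symmetric] sum_distrib_right[symmetric] E_sum)
  finally show ?thesis .
qed

lemma tens_mult:
  assumes "i \<noteq> j"
  shows "tens A i j * tens B i j = tens (A ** B) i j"
proof -
  define U where "U p s = E i (fst p) (fst s) * E j (snd p) (snd s)" for p s :: "'v \<times> 'v"
  have U: "U p s * U p' s' = (if s = p' then U p s' else 0)" for p s p' s'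
  proof -
    have "U p s * U p' s' = (E i (fst p) (fst s) * E i (fst p') (fst s'))
        * (E j (snd p) (snd s) * E j (snd p') (snd s'))"
      unfolding U_def by (simp only: mult.assoc awayD'[OF away_E[OF assms[symmetric]]])
    then show ?thesis
      by (auto simp: E_mult U_def prod_eq_iff)
  qed
  have "tens A i j * tens B i j
      = (\<Sum>p\<in>UNIV. \<Sum>p'\<in>UNIV. \<Sum>s\<in>UNIV. \<Sum>s'\<in>UNIV.
          (sc (A $ p $ s) * U p s) * (sc (B $ p' $ s') * U p' s'))"
    unfolding tens_def U_def[symmetric] by (simp only: sum_product)
  also have "\<dots> = (\<Sum>p\<in>UNIV. \<Sum>s\<in>UNIV. \<Sum>p'\<in>UNIV. \<Sum>s'\<in>UNIV.
          (sc (A $ p $ s) * U p s) * (sc (B $ p' $ s') * U p' s'))"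
    by (rule sum.cong[OF refl], rule sum.swap)
  also have "\<dots> = (\<Sum>p\<in>UNIV. \<Sum>s\<in>UNIV. \<Sum>p'\<in>UNIV. if s = p' then
      (\<Sum>s'\<in>UNIV. sc (A $ p $ s * B $ p' $ s') * U p s') else 0)"
  proof (intro sum.cong refl)
    fix p s p' :: "'v \<times> 'v"
    have "(sc (A $ p $ s) * U p s) * (sc (B $ p' $ s') * U p' s')
        = (if s = p' then sc (A $ p $ s * B $ p' $ s') * U p s' else 0)" for s'
      by (simp add: mult.assoc sc_left[of "U p s"] sc_mult U)
    then show "(\<Sum>s'\<in>UNIV. (sc (A $ p $ s) * U p s) * (sc (B $ p' $ s') * U p' s'))
        = (if s = p' then \<Sum>s'\<in>UNIV. sc (A $ p $ s * B $ p' $ s') * U p s' else 0)"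
      by simp
  qed
  also have "\<dots> = (\<Sum>p\<in>UNIV. \<Sum>s\<in>UNIV. \<Sum>s'\<in>UNIV. sc (A $ p $ s * B $ s $ s') * U p s')"
    by simp
  also have "\<dots> = (\<Sum>p\<in>UNIV. \<Sum>s'\<in>UNIV. \<Sum>s\<in>UNIV. sc (A $ p $ s * B $ s $ s') * U p s')"
    by (rule sum.cong[OF refl], rule sum.swap)
  also have "\<dots> = tens (A ** B) i j"
    by (simp add: tens_def U_def matrix_matrix_mult_def sc_sum sum_distrib_right)
  finally show ?thesis .
qed

lemma away_tens: "k \<noteq> i \<Longrightarrow> k \<noteq> j \<Longrightarrow> away k (tens A i j)"
  unfolding tens_def by (intro away_sum away_mult away_sc away_E) auto

lemma tens_commute:
  assumes "away i Z" "away j Z"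
  shows "Z * tens A i j = tens A i j * Z"
proof -
  have "Z * (E i a b * E j c d) = E i a b * E j c d * Z" for a b c d
  proof -
    have "Z * (E i a b * E j c d) = E i a b * (Z * E j c d)"
      using assms(1) by (simp add: awayD')
    then show ?thesis using assms(2) by (simp add: awayD mult.assoc)
  qed
  then show ?thesis
    unfolding tens_def sum_distrib_left sum_distrib_right
    by (intro sum.cong refl) (simp add: sc_left mult.assoc)
qed

lemma co_tens_snd:
  assumes "i \<noteq> j"
  shows "co j b d (tens A i j) = (\<Sum>a\<in>UNIV. \<Sum>c\<in>UNIV. sc (A $ (a, b) $ (c, d)) * E i a c)"
proof -
  have "co j b d (tens A i j) = (\<Sum>p\<in>UNIV. \<Sum>s\<in>UNIV.
      if snd p = b \<and> snd s = d then sc (A $ p $ s) * E i (fst p) (fst s) else 0)"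
    unfolding tens_def co_sum
    by (intro sum.cong refl) (use assms in \<open>auto simp: co_sc co_away_left away_E co_E\<close>)
  also have "\<dots> = (\<Sum>a\<in>UNIV. \<Sum>b'\<in>UNIV. \<Sum>c\<in>UNIV. \<Sum>d'\<in>UNIV.
      if b' = b \<and> d' = d then sc (A $ (a, b') $ (c, d')) * E i a c else 0)"
    by (simp only: sum_UNIV_prod fst_conv snd_conv)
  also have "\<dots> = (\<Sum>a\<in>UNIV. \<Sum>b'\<in>UNIV. if b' = b then \<Sum>c\<in>UNIV. \<Sum>d'\<in>UNIV.
      if d' = d then sc (A $ (a, b') $ (c, d')) * E i a c else 0 else 0)"
    by (intro sum.cong refl) auto
  finally show ?thesis by simp
qed

lemma tens_expand_snd:
  assumes "i \<noteq> j"
  shows "tens A i j = (\<Sum>b\<in>UNIV. \<Sum>d\<in>UNIV. \<Sum>a\<in>UNIV. \<Sum>c\<in>UNIV.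
     sc (A $ (a, b) $ (c, d)) * (E i a c * E j b d))"
proof -
  have "tens A i j = (\<Sum>b\<in>UNIV. \<Sum>d\<in>UNIV. co j b d (tens A i j) * E j b d)"
    by (rule co_expand)
  then show ?thesis
    by (simp only: co_tens_snd[OF assms] sum_distrib_right mult.assoc)
qed

end


section \<open>Matrices on tensor powers as slot operators\<close>

lemma tensor_index_0: "tensor_index 0 = {[]}"
  by (auto simp: tensor_index_def)

lemma finite_tensor_index: "finite (tensor_index k :: 'v::finite list set)"
  using finite_lists_length_eq[of "UNIV :: 'v set" k] by (simp add: tensor_index_def)

lemma sum_tensor_index_Suc:
  "(\<Sum>u\<in>tensor_index (Suc k). f u) = (\<Sum>a\<in>UNIV. \<Sum>u\<in>tensor_index k. f (a # (u :: 'v::finite list)))"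
proof -
  have "(\<Sum>a\<in>UNIV. \<Sum>u\<in>tensor_index k. f (a # u))
      = (\<Sum>p\<in>UNIV \<times> tensor_index k. f (fst p # snd p))"
    by (simp add: sum.cartesian_product case_prod_unfold)
  also have "\<dots> = (\<Sum>u\<in>tensor_index (Suc k). f u)"
    by (rule sum.reindex_bij_witness[where i = "\<lambda>u. (hd u, tl u)" and j = "\<lambda>p. fst p # snd p"])
      (auto simp: tensor_index_def length_Suc_conv)
  finally show ?thesis by simp
qed

lemma at1_Cons_Suc:
  "length u = length v \<Longrightarrow> at1 (Suc (Suc i)) X (a # u) (b # v) = (if a = b then at1 (Suc i) X u v else 0)"
  by (auto simp: at1_def less_Suc_eq_0_disj)

lemma at1_Cons_0:
  "length u = length v \<Longrightarrow> at1 (Suc 0) X (a # u) (b # v) = (if u = v then X a b else 0)"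
  by (auto simp: at1_def less_Suc_eq_0_disj list_eq_iff_nth_eq)

lemma at2_Cons_Suc:
  "length u = length v \<Longrightarrow> at2 (Suc (Suc i)) A (a # u) (b # v) = (if a = b then at2 (Suc i) A u v else 0)"
  by (auto simp: at2_def less_Suc_eq_0_disj)

lemma at2_Cons_0:
  "length u = length v \<Longrightarrow>
    at2 (Suc 0) A (a # c # u) (b # d # v) = (if u = v then A $ (a, c) $ (b, d) else 0)"
  by (auto simp: at2_def All_less_Suc2 list_eq_iff_nth_eq)

lemma tmat_prod_Nil: "tmat_prod k [] = tmat_one"
  by (simp add: tmat_prod_def)

lemma tmat_prod_Cons: "tmat_prod k (A # As) = tmat_mult k A (tmat_prod k As)"
  by (simp add: tmat_prod_def)

lemma tmat_prod_at1_shift: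
  assumes "length u = k" "length v = k"
  shows "tmat_prod (Suc k) (map (\<lambda>i. at1 (Suc (Suc i)) X) is) (a # u) (b # (v :: 'v::finite list))
     = (if a = b then tmat_prod k (map (\<lambda>i. at1 (Suc i) X) is) u v else 0)"
  using assms
proof (induction "is" arbitrary: a u)
  case Nil
  then show ?case by (simp add: tmat_prod_Nil tmat_one_def)
next
  case (Cons i "is")
  have "tmat_prod (Suc k) (map (\<lambda>i. at1 (Suc (Suc i)) X) (i # is)) (a # u) (b # v)
     = (\<Sum>c\<in>UNIV. \<Sum>w\<in>tensor_index k. (if a = c then at1 (Suc i) X u w else 0)
          * (if c = b then tmat_prod k (map (\<lambda>i. at1 (Suc i) X) is) w v else 0))"
    unfolding list.map tmat_prod_Cons tmat_mult_def sum_tensor_index_Suc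
    by (intro sum.cong refl) (use Cons in \<open>auto simp: at1_Cons_Suc tensor_index_def\<close>)
  also have "\<dots> = (\<Sum>c\<in>UNIV. if a = c then \<Sum>w\<in>tensor_index k. at1 (Suc i) X u w
          * (if c = b then tmat_prod k (map (\<lambda>i. at1 (Suc i) X) is) w v else 0) else 0)"
    by (intro sum.cong refl) auto
  finally show ?case
    by (auto simp: tmat_prod_Cons tmat_mult_def)
qed

text \<open>The factors sit in different slots, so every sum over intermediate indices collapses.
  This turns the weight C_1 ... C_n of \<open>R_trace\<close> into one factor C per slot, the form
  needed for iterated partial traces.\<close>

lemma tmat_prod_at1:
  assumes "length u = k" "length v = k"
  shows "tmat_prod k (map (\<lambda>i. at1 i X) [1..<Suc k]) u v
    = prod_list (map2 X u (v :: 'v::finite list) :: 'a::comm_ring_1 list)"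
  using assms
proof (induction k arbitrary: u v)
  case 0
  then show ?case by (simp add: tmat_prod_Nil tmat_one_def)
next
  case (Suc k)
  then obtain a u' b v' where uv: "u = a # u'" "v = b # v'" "length u' = k" "length v' = k"
    by (auto simp: length_Suc_conv)
  have upt: "[1..<Suc (Suc k)] = Suc 0 # map Suc [1..<Suc k]"
    by (simp add: map_Suc_upt upt_conv_Cons del: upt_Suc)
  have map_Suc: "[1..<Suc k] = map Suc [0..<k]"
    by (simp add: map_Suc_upt)
  have "tmat_prod (Suc k) (map (\<lambda>i. at1 i X) [1..<Suc (Suc k)]) u v
    = (\<Sum>c\<in>UNIV. \<Sum>w\<in>tensor_index k. (if u' = w then X a c else 0)
        * (if c = b then tmat_prod k (map (\<lambda>i. at1 i X) [1..<Suc k]) w v' else 0))"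
    unfolding upt list.map tmat_prod_Cons tmat_mult_def sum_tensor_index_Suc uv map_Suc
      map_map comp_def
    by (intro sum.cong refl)
      (use uv in \<open>auto simp: at1_Cons_0 tensor_index_def tmat_prod_at1_shift simp del: upt_Suc\<close>)
  also have "\<dots> = (\<Sum>c\<in>UNIV. if c = b then
      \<Sum>w\<in>tensor_index k. (if u' = w then X a c * tmat_prod k (map (\<lambda>i. at1 i X) [1..<Suc k]) w v' else 0) else 0)"
    by (intro sum.cong refl) (auto intro!: sum.cong simp del: upt_Suc)
  also have "\<dots> = X a b * tmat_prod k (map (\<lambda>i. at1 i X) [1..<Suc k]) u' v'"
    using uv(3) by (simp add: sum.delta'[OF finite_tensor_index] del: upt_Suc)
      (simp add: tensor_index_def)
  also have "\<dots> = prod_list (map2 X u v)"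
    using Suc.IH[OF uv(3,4)] uv(1,2) by (simp del: upt_Suc)
  finally show ?case .
qed

context tensor_slots
begin

text \<open>Entries of a matrix enter the slot ring through such a homomorphism. Commuting with
  every matrix unit is what allows an entry to be written on either side of its unit.\<close>

definition coeff_hom :: "('a::ring_1 \<Rightarrow> 'r) \<Rightarrow> bool" where
  "coeff_hom h \<longleftrightarrow> (\<forall>x y. h (x + y) = h x + h y) \<and> (\<forall>x y. h (x * y) = h x * h y) \<and> h 1 = 1
     \<and> (\<forall>i x. away i (h x))"

lemma coeff_hom_sc: "coeff_hom sc"
  by (simp add: coeff_hom_def sc_add sc_mult)

lemma coeff_hom_0: "coeff_hom h \<Longrightarrow> h 0 = 0"
  unfolding coeff_hom_def by (metis add_cancel_left_left)

lemma coeff_hom_sum: "coeff_hom h \<Longrightarrow> h (sum f A) = (\<Sum>x\<in>A. h (f x))"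
  by (induction A rule: infinite_finite_induct) (auto simp: coeff_hom_0, simp add: coeff_hom_def)

text \<open>The operator on slots i, ..., i + k - 1 whose matrix is X, built by peeling off the
  first index of each list. Only entries at lists of length k are read.\<close>

primrec opr :: "('a::ring_1 \<Rightarrow> 'r) \<Rightarrow> nat \<Rightarrow> nat \<Rightarrow> ('v, 'a) tmat \<Rightarrow> 'r" where
  "opr h i 0 X = h (X [] [])"
| "opr h i (Suc k) X = (\<Sum>a\<in>UNIV. \<Sum>b\<in>UNIV. E i a b * opr h (Suc i) k (\<lambda>u v. X (a # u) (b # v)))"

lemma opr_cong:
  "(\<And>u v. length u = k \<Longrightarrow> length v = k \<Longrightarrow> X u v = Y u v) \<Longrightarrow> opr h i k X = opr h i k Y"
proof (induction k arbitrary: i X Y)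
  case (Suc k)
  have "opr h (Suc i) k (\<lambda>u v. X (a # u) (b # v)) = opr h (Suc i) k (\<lambda>u v. Y (a # u) (b # v))"
    for a b by (rule Suc.IH) (simp add: Suc.prems)
  then show ?case by simp
qed simp

lemma away_opr: "coeff_hom h \<Longrightarrow> j < i \<Longrightarrow> away j (opr h i k X)"
proof (induction k arbitrary: i X)
  case (Suc k)
  then show ?case
    by (auto intro!: away_sum away_mult away_E)
qed (simp add: coeff_hom_def)

lemma opr_add:
  assumes "coeff_hom h"
  shows "opr h i k (\<lambda>u v. X u v + Y u v) = opr h i k X + opr h i k Y"
proof (induction k arbitrary: i X Y)
  case 0
  then show ?case using assms by (simp add: coeff_hom_def)
qed (simp add: distrib_left sum.distrib)

lemma opr_diff:
  assumes "coeff_hom h"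
  shows "opr h i k (\<lambda>u v. X u v - Y u v) = opr h i k X - opr h i k Y"
  using opr_add[OF assms, of i k "\<lambda>u v. X u v - Y u v" Y] by simp

lemma opr_0: "coeff_hom h \<Longrightarrow> opr h i k (\<lambda>u v. 0) = 0"
  using opr_diff[of h i k "\<lambda>u v. 0" "\<lambda>u v. 0"] by simp

lemma opr_sum:
  "coeff_hom h \<Longrightarrow> opr h i k (\<lambda>u v. \<Sum>x\<in>A. f x u v) = (\<Sum>x\<in>A. opr h i k (f x))"
  by (induction A rule: infinite_finite_induct) (simp_all add: opr_0 opr_add)

lemma opr_diag:
  assumes "coeff_hom h"
  shows "opr h i k (\<lambda>u v. if u = v then x else 0) = h x"
proof (induction k arbitrary: i)
  case (Suc k)
  have "opr h (Suc i) k (\<lambda>u v. if a = b \<and> u = v then x else 0) = (if a = b then h x else 0)"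
    for a b :: 'v using Suc.IH[of "Suc i"] opr_0[OF assms] by simp
  then show ?case
    by (simp add: if_distrib[of "(*) _"] sum_distrib_right[symmetric] E_sum cong: if_cong)
qed simp

lemma opr_one: "coeff_hom h \<Longrightarrow> opr h i k tmat_one = 1"
  using opr_diag[of h i k 1] by (simp add: tmat_one_def[abs_def] coeff_hom_def)

lemma opr_mult:
  assumes "coeff_hom h"
  shows "opr h i k (tmat_mult k X Y) = opr h i k X * opr h i k Y"
proof (induction k arbitrary: i X Y)
  case 0
  then show ?case using assms by (simp add: tmat_mult_def tensor_index_0 coeff_hom_def)
next
  case (Suc k)
  let ?X = "\<lambda>a b. opr h (Suc i) k (\<lambda>u v. X (a # u) (b # v))"
  let ?Y = "\<lambda>a b. opr h (Suc i) k (\<lambda>u v. Y (a # u) (b # v))"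
  have 1: "opr h (Suc i) k (\<lambda>u v. tmat_mult (Suc k) X Y (a # u) (b # v)) = (\<Sum>c\<in>UNIV. ?X a c * ?Y c b)"
    for a b
  proof -
    have "(\<lambda>u v. tmat_mult (Suc k) X Y (a # u) (b # v))
       = (\<lambda>u v. \<Sum>c\<in>UNIV. tmat_mult k (\<lambda>u v. X (a # u) (c # v)) (\<lambda>u v. Y (c # u) (b # v)) u v)"
      by (simp add: tmat_mult_def sum_tensor_index_Suc)
    then show ?thesis by (simp add: opr_sum[OF assms] Suc.IH)
  qed
  \<comment> \<open>The inner operator of X lives in the slots after i, so the unit of slot i
    belonging to Y can be moved left past it.\<close>
  have 2: "(E i a c * ?X a c) * (E i d b * ?Y d b) = (if c = d then E i a b * (?X a c * ?Y c b) else 0)"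
    for a b c d
    using awayD'[OF away_opr[OF assms lessI], of i d b k "\<lambda>u v. X (a # u) (c # v)", symmetric]
    by (simp add: mult.assoc E_mult')
  have "opr h i (Suc k) X * opr h i (Suc k) Y
      = (\<Sum>a\<in>UNIV. \<Sum>d\<in>UNIV. \<Sum>c\<in>UNIV. \<Sum>b\<in>UNIV. (E i a c * ?X a c) * (E i d b * ?Y d b))"
    by (simp only: opr.simps sum_product)
  also have "\<dots> = (\<Sum>a\<in>UNIV. \<Sum>c\<in>UNIV. \<Sum>d\<in>UNIV. if c = d then \<Sum>b\<in>UNIV. E i a b * (?X a c * ?Y c b) else 0)"
    unfolding 2 by (rule sum.cong[OF refl], subst sum.swap) (auto intro!: sum.cong)
  also have "\<dots> = (\<Sum>a\<in>UNIV. \<Sum>c\<in>UNIV. \<Sum>b\<in>UNIV. E i a b * (?X a c * ?Y c b))"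
    by simp
  also have "\<dots> = (\<Sum>a\<in>UNIV. \<Sum>b\<in>UNIV. \<Sum>c\<in>UNIV. E i a b * (?X a c * ?Y c b))"
    by (rule sum.cong[OF refl], rule sum.swap)
  also have "\<dots> = opr h i (Suc k) (tmat_mult (Suc k) X Y)"
    by (simp only: opr.simps 1 sum_distrib_left)
  finally show ?case by simp
qed

lemma opr_prod:
  "coeff_hom h \<Longrightarrow> opr h i k (tmat_prod k Xs) = prod_list (map (opr h i k) Xs)"
  by (induction Xs) (simp_all add: tmat_prod_Nil tmat_prod_Cons opr_one opr_mult)

lemma opr_lift: "(\<And>x. h (const x) = sc x) \<Longrightarrow> opr h i k (lift A) = opr sc i k A"
proof (induction k arbitrary: i A)
  case (Suc k)
  have "opr h (Suc i) k (\<lambda>u v. lift A (a # u) (b # v)) = opr sc (Suc i) k (\<lambda>u v. A (a # u) (b # v))"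
    for a b
    using Suc.IH[OF Suc.prems, of "Suc i" "\<lambda>u v. A (a # u) (b # v)"] by (simp add: lift_def[abs_def])
  then show ?case by simp
qed (simp add: lift_def)

lemma opr_scale: "opr sc i k (\<lambda>u v. x * A u v) = sc x * opr sc i k A"
proof (induction k arbitrary: i A)
  case (Suc k)
  then show ?case by (simp add: sum_distrib_left sc_left[of "E _ _ _"])
qed (simp add: sc_mult)

lemma opr_at1:
  assumes "coeff_hom h"
  shows "opr h i (Suc k) (at1 1 X) = (\<Sum>a\<in>UNIV. \<Sum>b\<in>UNIV. E i a b * h (X a b))"
proof -
  have "opr h (Suc i) k (\<lambda>u v. at1 1 X (a # u) (b # v)) = h (X a b)" for a b
    by (subst opr_diag[OF assms, symmetric, of _ "Suc i" k], rule opr_cong) (simp add: at1_Cons_0)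
  then show ?thesis by simp
qed

text \<open>The number k of further slots does not appear in the result: the same element of the
  ring represents R_i on every tensor power. Factors are counted from 1 and slots from 0, whence
  \<open>Suc j\<close> against \<open>j\<close>.\<close>

lemma opr_at2: "opr sc i (Suc (Suc (j + k))) (at2 (Suc j) A) = tens A (i + j) (Suc (i + j))"
proof (induction j arbitrary: i)
  case 0
  have 1: "opr sc (Suc (Suc i)) k (\<lambda>u v. at2 (Suc 0) A (a # c # u) (b # d # v)) = sc (A $ (a, c) $ (b, d))"
    for a b c d
    by (subst opr_diag[OF coeff_hom_sc, symmetric, of _ "Suc (Suc i)" k], rule opr_cong)
      (simp add: at2_Cons_0)
  have "opr sc i (Suc (Suc (0 + k))) (at2 (Suc 0) A)
    = (\<Sum>a\<in>UNIV. \<Sum>b\<in>UNIV. \<Sum>c\<in>UNIV. \<Sum>d\<in>UNIV. sc (A $ (a, c) $ (b, d)) * (E i a b * E (Suc i) c d))"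
  proof -
    have "E i a b * (E (Suc i) c d * sc x) = sc x * (E i a b * E (Suc i) c d)" for a b c d x
      by (simp only: mult.assoc[symmetric] sc_comm[of "E i a b * E (Suc i) c d"])
    then show ?thesis
      by (simp only: add_0 opr.simps(2) 1 sum_distrib_left)
  qed
  also have "\<dots> = (\<Sum>a\<in>UNIV. \<Sum>c\<in>UNIV. \<Sum>b\<in>UNIV. \<Sum>d\<in>UNIV. sc (A $ (a, c) $ (b, d)) * (E i a b * E (Suc i) c d))"
    by (rule sum.cong[OF refl], rule sum.swap)
  also have "\<dots> = tens A i (Suc i)"
    by (simp only: tens_def sum_UNIV_prod fst_conv snd_conv)
  finally show ?case by simp
next
  case (Suc j)
  have "opr sc (Suc i) (Suc (Suc (j + k))) (\<lambda>u v. at2 (Suc (Suc j)) A (a # u) (b # v))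
    = (if a = b then tens A (Suc i + j) (Suc (Suc i + j)) else 0)" for a b
  proof -
    have "opr sc (Suc i) (Suc (Suc (j + k))) (\<lambda>u v. at2 (Suc (Suc j)) A (a # u) (b # v))
       = opr sc (Suc i) (Suc (Suc (j + k))) (\<lambda>u v. if a = b then at2 (Suc j) A u v else 0)"
      by (rule opr_cong) (simp add: at2_Cons_Suc)
    then show ?thesis
      using Suc.IH[of "Suc i"] opr_0[OF coeff_hom_sc, of "Suc i" "Suc (Suc (j + k))"]
      by (auto simp del: opr.simps)
  qed
  then show ?case
    unfolding add_Suc opr.simps(2)[of _ _ "Suc (Suc (j + k))"]
    by (simp add: if_distrib[of "(*) _"] sum_distrib_right[symmetric] E_sum
        del: opr.simps cong: if_cong)
qed

lemma opr_at2':
  assumes "Suc j < k"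
  shows "opr sc 0 k (at2 (Suc j) A) = tens A j (Suc j)"
proof -
  obtain l where "k = Suc (Suc (j + l))"
    using less_imp_Suc_add[OF assms] by auto
  then show ?thesis using opr_at2[of 0 j l A] by (simp only: add_0)
qed

lemma ptrs_opr:
  assumes "coeff_hom h"
  shows "ptrs c i k (opr h i k X)
    = (\<Sum>u\<in>tensor_index k. \<Sum>w\<in>tensor_index k. sc (prod_list (map2 c u w)) * h (X w u))"
proof (induction k arbitrary: i X)
  case 0
  then show ?case by (simp add: tensor_index_0)
next
  case (Suc k)
  let ?Y = "\<lambda>a b. ptrs c (Suc i) k (opr h (Suc i) k (\<lambda>u v. X (a # u) (b # v)))"
  have "ptr c i (E i a b * ?Y a b) = sc (c b a) * ?Y a b" for a b
    by (simp add: ptr_away_right[OF away_ptrs[OF away_opr[OF assms]]] ptr_E)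
  then have "ptrs c i (Suc k) (opr h i (Suc k) X) = (\<Sum>a\<in>UNIV. \<Sum>b\<in>UNIV. sc (c b a) * ?Y a b)"
    by (simp add: ptrs_sum ptr_sum ptrs_away_left away_E)
  also have "\<dots> = (\<Sum>a\<in>UNIV. \<Sum>b\<in>UNIV. \<Sum>u\<in>tensor_index k. \<Sum>w\<in>tensor_index k.
       sc (prod_list (map2 c (b # u) (a # w))) * h (X (a # w) (b # u)))"
    by (simp add: Suc.IH sum_distrib_left sc_mult mult.assoc)
  also have "\<dots> = (\<Sum>b\<in>UNIV. \<Sum>a\<in>UNIV. \<Sum>u\<in>tensor_index k. \<Sum>w\<in>tensor_index k.
       sc (prod_list (map2 c (b # u) (a # w))) * h (X (a # w) (b # u)))"
    by (rule sum.swap)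
  also have "\<dots> = (\<Sum>b\<in>UNIV. \<Sum>u\<in>tensor_index k. \<Sum>a\<in>UNIV. \<Sum>w\<in>tensor_index k.
       sc (prod_list (map2 c (b # u) (a # w))) * h (X (a # w) (b # u)))"
    by (rule sum.cong[OF refl], rule sum.swap)
  finally show ?case by (simp only: sum_tensor_index_Suc)
qed

text \<open>The bridge by which everything proved about iterated partial traces reaches
  \<open>ch\<close> and \<open>casimir\<close>.\<close>

lemma R_trace_ptrs:
  fixes h :: "'a falg \<Rightarrow> 'r"
  assumes h: "coeff_hom h" and const: "\<And>x. h (const x) = sc x"
  shows "h (R_trace R k X) = ptrs (C_matrix R) 0 k (opr h 0 k X)"
proof -
  have "h (R_trace R k X) = (\<Sum>u\<in>tensor_index k. \<Sum>w\<in>tensor_index k.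
      h (lift (tmat_prod k (map (\<lambda>i. at1 i (C_matrix R)) [1..<Suc k])) u w * X w u))"
    by (simp add: R_trace_def tmat_mult_def coeff_hom_sum[OF h] del: upt_Suc)
  also have "\<dots> = (\<Sum>u\<in>tensor_index k. \<Sum>w\<in>tensor_index k.
      sc (prod_list (map2 (C_matrix R) u w)) * h (X w u))"
  proof (intro sum.cong refl)
    fix u w :: "'v list" assume "u \<in> tensor_index k" "w \<in> tensor_index k"
    then have "tmat_prod k (map (\<lambda>i. at1 i (C_matrix R)) [1..<Suc k]) u w
        = prod_list (map2 (C_matrix R) u w)"
      by (intro tmat_prod_at1) (auto simp: tensor_index_def)
    then show "h (lift (tmat_prod k (map (\<lambda>i. at1 i (C_matrix R)) [1..<Suc k])) u w * X w u)
        = sc (prod_list (map2 (C_matrix R) u w)) * h (X w u)"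
      using h const by (simp add: lift_def coeff_hom_def del: upt_Suc)
  qed
  finally show ?thesis by (simp add: ptrs_opr[OF h])
qed

section \<open>Overlined and underlined copies as elements of the slot ring\<close>

primrec over :: "'v endo2 \<Rightarrow> 'r \<Rightarrow> nat \<Rightarrow> 'r" where
  "over R X 0 = X"
| "over R X (Suc i) = tens R i (Suc i) * over R X i * tens (matrix_inv R) i (Suc i)"

primrec under :: "'v endo2 \<Rightarrow> 'r \<Rightarrow> nat \<Rightarrow> 'r" where
  "under R X 0 = X"
| "under R X (Suc i) = tens (matrix_inv R) i (Suc i) * under R X i * tens R i (Suc i)"

definition gmat :: "('v \<Rightarrow> 'v \<Rightarrow> 'r) \<Rightarrow> 'r" where
  "gmat x = (\<Sum>a\<in>UNIV. \<Sum>b\<in>UNIV. E 0 a b * x a b)"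

lemma opr_overlined:
  assumes h: "coeff_hom h" and const: "\<And>x. h (const x) = sc x" and "i < k"
  shows "opr h 0 k (overlined R k X i) = over R (gmat (\<lambda>a b. h (X a b))) i"
  using assms(3)
proof (induction i)
  case 0
  then show ?case using opr_at1[OF h, of 0 "k - 1" X] by (simp add: gmat_def)
next
  case (Suc i)
  then show ?case
    by (simp add: opr_prod[OF h] opr_lift[of h, OF const] opr_at2' mult.assoc)
qed

lemma opr_underlined:
  assumes h: "coeff_hom h" and const: "\<And>x. h (const x) = sc x" and "i < k"
  shows "opr h 0 k (underlined R k X i) = under R (gmat (\<lambda>a b. h (X a b))) i"
  using assms(3)
proof (induction i)
  case 0
  then show ?case using opr_at1[OF h, of 0 "k - 1" X] by (simp add: gmat_def)
next
  case (Suc i)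
  then show ?case
    by (simp add: opr_prod[OF h] opr_lift[of h, OF const] opr_at2' mult.assoc)
qed

lemma opr_overlined_prod:
  assumes h: "coeff_hom h" and const: "\<And>x. h (const x) = sc x"
  shows "opr h 0 k (overlined_prod R k X)
    = prod_list (map (over R (gmat (\<lambda>a b. h (X a b)))) [0..<k])"
proof -
  have "map (opr h 0 k) (map (overlined R k X) [0..<k])
      = map (over R (gmat (\<lambda>a b. h (X a b)))) [0..<k]"
    unfolding map_map by (rule map_cong) (simp_all add: opr_overlined[OF h const])
  then show ?thesis
    by (simp only: overlined_prod_def opr_prod[OF h])
qed

lemma opr_underlined_prod:
  assumes h: "coeff_hom h" and const: "\<And>x. h (const x) = sc x"
  shows "opr h 0 k (underlined_prod R k X)
    = prod_list (map (under R (gmat (\<lambda>a b. h (X a b)))) (rev [0..<k]))"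
proof -
  have "map (opr h 0 k) (map (underlined R k X) (rev [0..<k]))
      = map (under R (gmat (\<lambda>a b. h (X a b)))) (rev [0..<k])"
    unfolding map_map by (rule map_cong) (simp_all add: opr_underlined[OF h const])
  then show ?thesis
    by (simp only: underlined_prod_def opr_prod[OF h])
qed

end


section \<open>The R-trace\<close>

lemma tmat_mult_at1_at2:
  fixes A B :: "'v::finite endo2"
  shows "tmat_mult 3 (at2 1 A) (at2 2 B) [i, a, j] [k, a', l]
    = (\<Sum>m\<in>UNIV. A $ (i, a) $ (k, m) * B $ (m, j) $ (a', l))"
proof -
  have "tmat_mult 3 (at2 1 A) (at2 2 B) [i, a, j] [k, a', l]
      = (\<Sum>x\<in>UNIV. \<Sum>m\<in>UNIV. \<Sum>y\<in>UNIV. at2 1 A [i, a, j] [x, m, y] * at2 2 B [x, m, y] [k, a', l])"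
    by (simp add: tmat_mult_def numeral_3_eq_3 sum_tensor_index_Suc tensor_index_0)
  also have "\<dots> = (\<Sum>x\<in>UNIV. \<Sum>m\<in>UNIV. \<Sum>y\<in>UNIV. if x = k then
      (if y = j then A $ (i, a) $ (k, m) * B $ (m, j) $ (a', l) else 0) else 0)"
    by (intro sum.cong refl) (auto simp: at2_def All_less_Suc2 numeral_2_eq_2 nth_Cons')
  also have "\<dots> = (\<Sum>x\<in>UNIV. if x = k then
      \<Sum>m\<in>UNIV. A $ (i, a) $ (k, m) * B $ (m, j) $ (a', l) else 0)"
    by (intro sum.cong refl) simp
  finally show ?thesis by simp
qed

lemma is_skew_inverse_iff:
  "is_skew_inverse R \<Psi> \<longleftrightarrow> (\<forall>i j k l.
     (\<Sum>a\<in>UNIV. \<Sum>m\<in>UNIV. R $ (i, a) $ (k, m) * \<Psi> $ (m, j) $ (a, l))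
       = (if i = l \<and> j = k then 1 else 0) \<and>
     (\<Sum>a\<in>UNIV. \<Sum>m\<in>UNIV. \<Psi> $ (i, a) $ (k, m) * R $ (m, j) $ (a, l))
       = (if i = l \<and> j = k then 1 else 0))"
  unfolding is_skew_inverse_def tmat_mult_at1_at2 ..

lemma sum_swap_2_1:
  "(\<Sum>a\<in>A. \<Sum>b\<in>B. \<Sum>c\<in>C. f a b c) = (\<Sum>c\<in>C. \<Sum>a\<in>A. \<Sum>b\<in>B. f a b c)"
proof -
  have "(\<Sum>a\<in>A. \<Sum>b\<in>B. \<Sum>c\<in>C. f a b c) = (\<Sum>a\<in>A. \<Sum>c\<in>C. \<Sum>b\<in>B. f a b c)"
    by (rule sum.cong[OF refl], rule sum.swap)
  also have "\<dots> = (\<Sum>c\<in>C. \<Sum>a\<in>A. \<Sum>b\<in>B. f a b c)"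
    by (rule sum.swap)
  finally show ?thesis .
qed

lemma sum_swap_2_2:
  "(\<Sum>a\<in>A. \<Sum>b\<in>B. \<Sum>c\<in>C. \<Sum>d\<in>D. f a b c d) = (\<Sum>c\<in>C. \<Sum>d\<in>D. \<Sum>a\<in>A. \<Sum>b\<in>B. f a b c d)"
  unfolding sum_swap_2_1[of "\<lambda>a b c. \<Sum>d\<in>D. f a b c d"]
  by (rule sum.cong[OF refl], rule sum_swap_2_1)

lemma sum_delta2:
  "(\<Sum>a\<in>UNIV. \<Sum>b\<in>UNIV. (if a = x \<and> y = b then 1 else 0) * f a b) = (f x y :: complex)"
  "(\<Sum>a\<in>UNIV. \<Sum>b\<in>UNIV. f a b * (if a = x \<and> y = b then 1 else 0)) = (f x y :: complex)"
  for x y :: "'v::finite"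
proof -
  have "(\<Sum>a\<in>UNIV. \<Sum>b\<in>UNIV. (if a = x \<and> y = b then 1 else 0) * f a b)
      = (\<Sum>a\<in>UNIV. if a = x then \<Sum>b\<in>UNIV. if y = b then f a b else 0 else 0)"
    by (intro sum.cong refl) (simp add: mult_delta_left)
  then show 1: "(\<Sum>a\<in>UNIV. \<Sum>b\<in>UNIV. (if a = x \<and> y = b then 1 else 0) * f a b) = f x y"
    by (simp add: mult_delta_left)
  then show "(\<Sum>a\<in>UNIV. \<Sum>b\<in>UNIV. f a b * (if a = x \<and> y = b then 1 else 0)) = f x y"
    by (simp add: mult.commute)
qed

text \<open>As for left and right inverses in a monoid: the contraction \<open>f\<close> of \<Psi>,
  R and \<Phi> leaves \<Phi> when the first pair collapses and \<Psi> when the second does. This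
  gives \<open>skew_inverse\<close>, a definite description, its meaning.\<close>

lemma skew_inverse_unique:
  fixes R :: "'v::finite endo2"
  assumes "is_skew_inverse R \<Psi>" "is_skew_inverse R \<Phi>"
  shows "\<Psi> = \<Phi>"
proof -
  have "\<Psi> $ (i, j) $ (k, l) = \<Phi> $ (i, j) $ (k, l)" for i j k l
  proof -
    define f where "f a m b n = \<Psi> $ (i, a) $ (k, m) * R $ (m, b) $ (a, n) * \<Phi> $ (n, j) $ (b, l)"
      for a m b n
    have 1: "(\<Sum>a\<in>UNIV. \<Sum>m\<in>UNIV. f a m b n) = (if i = n \<and> b = k then 1 else 0) * \<Phi> $ (n, j) $ (b, l)" for b n
      using assms(1) by (simp add: f_def is_skew_inverse_iff sum_distrib_right[symmetric])
    have 2: "(\<Sum>b\<in>UNIV. \<Sum>n\<in>UNIV. f a m b n) = \<Psi> $ (i, a) $ (k, m) * (if m = l \<and> j = a then 1 else 0)" for a m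
      using assms(2) by (simp add: f_def is_skew_inverse_iff sum_distrib_left[symmetric] mult.assoc)
    have "(\<Sum>b\<in>UNIV. \<Sum>n\<in>UNIV. \<Sum>a\<in>UNIV. \<Sum>m\<in>UNIV. f a m b n)
        = (\<Sum>b\<in>UNIV. \<Sum>n\<in>UNIV. (if b = k \<and> i = n then 1 else 0) * \<Phi> $ (n, j) $ (b, l))"
      by (simp only: 1 conj_commute)
    moreover have "(\<Sum>a\<in>UNIV. \<Sum>m\<in>UNIV. \<Sum>b\<in>UNIV. \<Sum>n\<in>UNIV. f a m b n)
        = (\<Sum>m\<in>UNIV. \<Sum>a\<in>UNIV. \<Psi> $ (i, a) $ (k, m) * (if m = l \<and> j = a then 1 else 0))"
      by (simp only: 2) (rule sum.swap)
    moreover have "(\<Sum>b\<in>UNIV. \<Sum>n\<in>UNIV. \<Sum>a\<in>UNIV. \<Sum>m\<in>UNIV. f a m b n)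
        = (\<Sum>a\<in>UNIV. \<Sum>m\<in>UNIV. \<Sum>b\<in>UNIV. \<Sum>n\<in>UNIV. f a m b n)"
      by (rule sum_swap_2_2)
    ultimately show ?thesis
      by (simp only: sum_delta2)
  qed
  then show ?thesis
    by (simp add: vec_eq_iff)
qed

lemma is_skew_inverse_skew_inverse:
  "skew_invertible R \<Longrightarrow> is_skew_inverse R (skew_inverse R)"
  unfolding skew_invertible_def skew_inverse_def
  by (rule theI') (blast intro: skew_inverse_unique)

lemma mat_mult_left: "mat x ** A = (\<chi> i j. x * A $ i $ j)"
  for A :: "complex^'n::finite^'n"
  by (simp add: matrix_matrix_mult_def mat_def vec_eq_iff if_distrib[of "\<lambda>x. x * _"] cong: if_cong)

lemma mat_mult_right: "A ** mat x = (\<chi> i j. x * A $ i $ j)"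
  for A :: "complex^'n::finite^'n"
  by (simp add: matrix_matrix_mult_def mat_def vec_eq_iff if_distrib[of "\<lambda>x. _ * x"] cong: if_cong)

lemma hecke_square:
  assumes "hecke_symmetry q R"
  shows "R ** R = mat 1 + (\<chi> i j. (q - inverse q) * R $ i $ j)"
proof -
  have "(mat q - R) ** (mat (inverse q) + R) = mat q ** mat (inverse q) + mat q ** R - R ** mat (inverse q) - R ** R"
    by (simp add: matrix_matrix_mult_def vec_eq_iff algebra_simps sum.distrib sum_subtractf)
  moreover have "mat q ** mat (inverse q) = (mat 1 :: complex^('a \<times> 'a)^('a \<times> 'a))"
    unfolding mat_mult_left using assms by (simp add: hecke_symmetry_def vec_eq_iff mat_def)
  ultimately show ?thesis
    using assms by (simp add: hecke_symmetry_def mat_mult_left mat_mult_right vec_eq_iff algebra_simps)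
qed

text \<open>\<open>matrix_inv\<close> is a choice operator, so its value has to be pinned down; the
  quadratic relation supplies an explicit two-sided inverse.\<close>

lemma hecke_inverse:
  assumes "hecke_symmetry q R"
  shows "R ** (R - mat (q - inverse q)) = mat 1" "(R - mat (q - inverse q)) ** R = mat 1"
    and "matrix_inv R = R - mat (q - inverse q)"
proof -
  have "R ** (R - mat (q - inverse q)) = R ** R - R ** mat (q - inverse q)"
       "(R - mat (q - inverse q)) ** R = R ** R - mat (q - inverse q) ** R"
    by (simp_all add: matrix_matrix_mult_def vec_eq_iff algebra_simps sum_subtractf)
  then show 1: "R ** (R - mat (q - inverse q)) = mat 1" "(R - mat (q - inverse q)) ** R = mat 1"
    by (simp_all add: hecke_square[OF assms] mat_mult_left mat_mult_right)
  show "matrix_inv R = R - mat (q - inverse q)"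
  proof -
    have inv: "R ** matrix_inv R = mat 1 \<and> matrix_inv R ** R = mat 1"
      unfolding matrix_inv_def by (rule someI) (use 1 in blast)
    have "matrix_inv R = matrix_inv R ** (R ** (R - mat (q - inverse q)))"
      by (simp only: 1 matrix_mul_rid)
    also have "\<dots> = R - mat (q - inverse q)"
      by (simp only: matrix_mul_assoc inv matrix_mul_lid)
    finally show ?thesis .
  qed
qed

section \<open>Braid and Hecke relations for the slot operators\<close>

locale hecke_slots = tensor_slots sc E
  for sc :: "complex \<Rightarrow> 'r::ring_1" and E :: "nat \<Rightarrow> 'v::finite \<Rightarrow> 'v \<Rightarrow> 'r" +
  fixes q :: complex and R :: "'v endo2"
  assumes hecke: "hecke_symmetry q R" and skew: "skew_invertible R"
begin

definition r where "r i = tens R i (Suc i)"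
definition rb where "rb i = tens (matrix_inv R) i (Suc i)"
definition lam where "lam = q - inverse q"

abbreviation "\<Psi> \<equiv> skew_inverse R"
abbreviation "C \<equiv> C_matrix R"

lemma skew_right:
  "(\<Sum>a\<in>UNIV. \<Sum>m\<in>UNIV. R $ (i, a) $ (k, m) * \<Psi> $ (m, j) $ (a, l)) = (if i = l \<and> j = k then 1 else 0)"
  and skew_left:
  "(\<Sum>a\<in>UNIV. \<Sum>m\<in>UNIV. \<Psi> $ (i, a) $ (k, m) * R $ (m, j) $ (a, l)) = (if i = l \<and> j = k then 1 else 0)"
  using is_skew_inverse_skew_inverse[OF skew] by (simp_all add: is_skew_inverse_iff)

lemma rb_eq: "rb i = r i - sc lam"
  by (simp add: rb_def r_def lam_def hecke_inverse(3)[OF hecke] tens_diff tens_mat)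

lemma r_rb [simp]: "r i * rb i = 1" and rb_r [simp]: "rb i * r i = 1"
  using hecke_inverse[OF hecke] by (simp_all add: rb_def r_def tens_mult tens_mat)

lemma r_rb' [simp]: "r i * (rb i * Z) = Z" and rb_r' [simp]: "rb i * (r i * Z) = Z"
  by (simp_all add: mult.assoc[symmetric])

lemma r_r: "r i * r i = 1 + sc lam * r i"
proof -
  have "r i * r i - sc lam * r i = 1"
    using r_rb[of i] unfolding rb_eq right_diff_distrib sc_comm[of "r i"] .
  then show ?thesis by (simp only: diff_eq_eq)
qed

lemma rb_rb: "rb i * rb i = 1 - sc lam * rb i"
proof -
  have "rb i * rb i = rb i * (r i - sc lam)"
    by (simp only: rb_eq[symmetric])
  then show ?thesis by (simp only: right_diff_distrib rb_r sc_comm[of "rb i"])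
qed

lemma away_r: "k \<noteq> i \<Longrightarrow> k \<noteq> Suc i \<Longrightarrow> away k (r i)"
  and away_rb: "k \<noteq> i \<Longrightarrow> k \<noteq> Suc i \<Longrightarrow> away k (rb i)"
  by (simp_all add: r_def rb_def away_tens)

lemma r_away_comm: "away i Z \<Longrightarrow> away (Suc i) Z \<Longrightarrow> r i * Z = Z * r i"
  and rb_away_comm: "away i Z \<Longrightarrow> away (Suc i) Z \<Longrightarrow> rb i * Z = Z * rb i"
  by (simp_all add: r_def rb_def tens_commute)

lemma braid: "r i * (r (Suc i) * r i) = r (Suc i) * (r i * r (Suc i))"
proof -
  let ?f = "opr sc i 3"
  have at: "?f (at2 (Suc 0) R) = r i" "?f (at2 2 R) = r (Suc i)"
    using opr_at2[of i 0 1 R] opr_at2[of i 1 0 R]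
    by (simp_all add: r_def numeral_3_eq_3 numeral_2_eq_2 del: opr.simps)
  have "?f (tmat_prod 3 [at2 1 R, at2 2 R, at2 1 R]) = ?f (tmat_prod 3 [at2 2 R, at2 1 R, at2 2 R])"
    using hecke by (intro opr_cong) (simp add: hecke_symmetry_def braid_relation_def tensor_index_def)
  then show ?thesis
    by (simp add: opr_prod[OF coeff_hom_sc] at del: opr.simps)
qed

lemma braid': "r i * (r (Suc i) * (r i * Z)) = r (Suc i) * (r i * (r (Suc i) * Z))"
  using arg_cong[OF braid, of "\<lambda>x. x * Z" i] by (simp add: mult.assoc)

lemma r_cancel: "r i * X = r i * Y \<longleftrightarrow> X = Y"
  by (metis rb_r')

lemma braid_rb: "rb i * (rb (Suc i) * rb i) = rb (Suc i) * (rb i * rb (Suc i))"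
proof -
  have "r i * (r (Suc i) * (r i * (rb i * (rb (Suc i) * rb i))))
      = r i * (r (Suc i) * (r i * (rb (Suc i) * (rb i * rb (Suc i)))))"
    by (simp add: braid'[of i "rb (Suc i) * (rb i * rb (Suc i))"])
  then show ?thesis by (simp only: r_cancel)
qed

lemma braid_rb': "rb i * (rb (Suc i) * (rb i * Z)) = rb (Suc i) * (rb i * (rb (Suc i) * Z))"
  using arg_cong[OF braid_rb, of "\<lambda>x. x * Z" i] by (simp add: mult.assoc)

text \<open>A braid relation with inverses on part of the factors. Such mixed forms are needed
  because overlined and underlined copies are conjugates, with R on one side and R^-1 on the
  other.\<close>

lemma r_rb_rb: "r (Suc i) * (rb i * rb (Suc i)) = rb i * (rb (Suc i) * r i)"
proof -
  have "r i * (r (Suc i) * (rb i * rb (Suc i))) = rb (Suc i) * r i"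
  proof -
    have "r (Suc i) * (r i * (r (Suc i) * (rb i * rb (Suc i)))) = r i"
      by (simp add: braid'[symmetric])
    then have "rb (Suc i) * (r (Suc i) * (r i * (r (Suc i) * (rb i * rb (Suc i))))) = rb (Suc i) * r i"
      by simp
    then show ?thesis by (simp only: rb_r')
  qed
  then have "rb i * (r i * (r (Suc i) * (rb i * rb (Suc i)))) = rb i * (rb (Suc i) * r i)"
    by simp
  then show ?thesis by (simp only: rb_r')
qed

lemma r_r_rb: "r i * (r (Suc i) * rb i) = rb (Suc i) * (r i * r (Suc i))"
proof -
  have "r (Suc i) * (r i * (r (Suc i) * rb i)) = r i * r (Suc i)"
    by (simp add: braid'[symmetric])
  then have "rb (Suc i) * (r (Suc i) * (r i * (r (Suc i) * rb i))) = rb (Suc i) * (r i * r (Suc i))"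
    by simp
  then show ?thesis by simp
qed

lemma r_far: "Suc i < j \<Longrightarrow> r i * r j = r j * r i"
  by (rule r_away_comm) (auto intro: away_r)

text \<open>C is a partial trace of \<Psi>, so the defining identity of the skew inverse, summed
  over a common index in its last slot, leaves the identity matrix.\<close>

lemma ptr_r: "ptr C (Suc i) (r i) = 1"
proof -
  have 1: "(\<Sum>b\<in>UNIV. \<Sum>d\<in>UNIV. C d b * R $ (a, b) $ (c, d)) = (if a = c then 1 else 0)" for a c
  proof -
    have "(\<Sum>b\<in>UNIV. \<Sum>d\<in>UNIV. C d b * R $ (a, b) $ (c, d))
        = (\<Sum>b\<in>UNIV. \<Sum>d\<in>UNIV. \<Sum>k\<in>UNIV. R $ (a, b) $ (c, d) * \<Psi> $ (d, k) $ (b, k))"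
      by (simp add: C_matrix_def sum_distrib_left mult.commute)
    also have "\<dots> = (\<Sum>b\<in>UNIV. \<Sum>k\<in>UNIV. \<Sum>d\<in>UNIV. R $ (a, b) $ (c, d) * \<Psi> $ (d, k) $ (b, k))"
      by (rule sum.cong[OF refl], rule sum.swap)
    also have "\<dots> = (\<Sum>k\<in>UNIV. \<Sum>b\<in>UNIV. \<Sum>d\<in>UNIV. R $ (a, b) $ (c, d) * \<Psi> $ (d, k) $ (b, k))"
      by (rule sum.swap)
    also have "\<dots> = (\<Sum>k\<in>UNIV. if k = a then if k = c then 1 else 0 else 0)"
      unfolding skew_right by (intro sum.cong refl) auto
    finally show ?thesis by simp
  qed
  have "ptr C (Suc i) (r i) = (\<Sum>b\<in>UNIV. \<Sum>d\<in>UNIV. \<Sum>a\<in>UNIV. \<Sum>c\<in>UNIV.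
      sc (C d b * R $ (a, b) $ (c, d)) * E i a c)"
    unfolding ptr_def r_def by (simp add: co_tens_snd sum_distrib_left sc_mult mult.assoc)
  also have "\<dots> = (\<Sum>a\<in>UNIV. \<Sum>c\<in>UNIV. \<Sum>b\<in>UNIV. \<Sum>d\<in>UNIV.
      sc (C d b * R $ (a, b) $ (c, d)) * E i a c)"
    by (rule sum_swap_2_2)
  also have "\<dots> = (\<Sum>a\<in>UNIV. \<Sum>c\<in>UNIV. sc (\<Sum>b\<in>UNIV. \<Sum>d\<in>UNIV. C d b * R $ (a, b) $ (c, d)) * E i a c)"
    by (simp only: sc_sum sum_distrib_right)
  also have "\<dots> = (\<Sum>a\<in>UNIV. \<Sum>c\<in>UNIV. if a = c then E i a c else 0)"
    unfolding 1 by (intro sum.cong refl) auto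
  finally show ?thesis by (simp add: E_sum)
qed

text \<open>Contraction of slot i with the skew inverse. It turns R into a matrix unit of the next
  slot (\<open>kap_r\<close>) and the identity into an entry of C (\<open>kap_1\<close>), so an
  identity containing one R becomes an identity for an arbitrary matrix in its place.\<close>

definition kap :: "'v \<Rightarrow> 'v \<Rightarrow> nat \<Rightarrow> 'r \<Rightarrow> 'r" where
  "kap x y i Z = (\<Sum>a\<in>UNIV. \<Sum>m\<in>UNIV. sc (\<Psi> $ (x, a) $ (y, m)) * co i m a Z)"

lemma co_tens_fst:
  assumes "i \<noteq> j"
  shows "co i a c (tens A i j) = (\<Sum>b\<in>UNIV. \<Sum>d\<in>UNIV. sc (A $ (a, b) $ (c, d)) * E j b d)"
proof -
  have "co i a c (tens A i j) = (\<Sum>b\<in>UNIV. \<Sum>d\<in>UNIV. \<Sum>a'\<in>UNIV. \<Sum>c'\<in>UNIV.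
      if a' = a then if c' = c then sc (A $ (a', b) $ (c', d)) * E j b d else 0 else 0)"
    unfolding tens_expand_snd[OF assms] co_sum
    by (intro sum.cong refl) (use assms in \<open>auto simp: co_sc co_away_right away_E co_E\<close>)
  also have "\<dots> = (\<Sum>b\<in>UNIV. \<Sum>d\<in>UNIV. \<Sum>a'\<in>UNIV. if a' = a then
      \<Sum>c'\<in>UNIV. if c' = c then sc (A $ (a', b) $ (c', d)) * E j b d else 0 else 0)"
    by (intro sum.cong refl) auto
  finally show ?thesis by simp
qed

lemma kap_r: "kap x y i (r i) = E (Suc i) y x"
proof -
  have "kap x y i (r i) = (\<Sum>a\<in>UNIV. \<Sum>m\<in>UNIV. \<Sum>b\<in>UNIV. \<Sum>d\<in>UNIV.
     sc (\<Psi> $ (x, a) $ (y, m) * R $ (m, b) $ (a, d)) * E (Suc i) b d)"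
    unfolding kap_def r_def by (simp add: co_tens_fst sum_distrib_left sc_mult mult.assoc)
  also have "\<dots> = (\<Sum>b\<in>UNIV. \<Sum>d\<in>UNIV. \<Sum>a\<in>UNIV. \<Sum>m\<in>UNIV.
     sc (\<Psi> $ (x, a) $ (y, m) * R $ (m, b) $ (a, d)) * E (Suc i) b d)"
    by (rule sum_swap_2_2)
  also have "\<dots> = (\<Sum>b\<in>UNIV. \<Sum>d\<in>UNIV. sc (if x = d \<and> b = y then 1 else 0) * E (Suc i) b d)"
    by (simp only: sc_sum[symmetric] sum_distrib_right[symmetric] skew_left)
  also have "\<dots> = (\<Sum>b\<in>UNIV. if b = y then \<Sum>d\<in>UNIV. if x = d then E (Suc i) b d else 0 else 0)"
    by (intro sum.cong refl) (simp add: if_distrib[of sc] mult_delta_left cong: if_cong)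
  finally show ?thesis by simp
qed

lemma kap_1: "kap x y i 1 = sc (C x y)"
  by (simp add: kap_def co_1 C_matrix_def sc_sum if_distrib[of "(*) _"] cong: if_cong)

lemma kap_mult: "away i X \<Longrightarrow> away i Y \<Longrightarrow> kap x y i (X * Z * Y) = X * kap x y i Z * Y"
  by (simp add: kap_def co_away_left co_away_right sum_distrib_left sum_distrib_right sc_left[of X]
      mult.assoc)

lemma ptr_kap: "i \<noteq> j \<Longrightarrow> ptr c j (kap x y i Z) = kap x y i (ptr c j Z)"
  by (simp add: kap_def ptr_sum ptr_sc ptr_co_comm)

lemma ptr_tens_E_tens:
  assumes "i \<noteq> j"
  shows "ptr C j (tens A i j * E i x y * tens B i j) = (\<Sum>a\<in>UNIV. \<Sum>c\<in>UNIV.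
    sc (\<Sum>b\<in>UNIV. \<Sum>d\<in>UNIV. \<Sum>m\<in>UNIV. C d b * A $ (a, b) $ (x, m) * B $ (y, m) $ (c, d)) * E i a c)"
proof -
  have 1: "co j b m (tens A i j) * E i x y * co j m d (tens B i j)
      = (\<Sum>a\<in>UNIV. \<Sum>c\<in>UNIV. sc (A $ (a, b) $ (x, m) * B $ (y, m) $ (c, d)) * E i a c)" for b m d
  proof -
    have "co j b m (tens A i j) * E i x y = (\<Sum>a\<in>UNIV. sc (A $ (a, b) $ (x, m)) * E i a y)"
      using assms by (simp add: co_tens_snd sum_distrib_right mult.assoc E_mult
          if_distrib[of "(*) _"] cong: if_cong)
    moreover have "E i a y * co j m d (tens B i j) = (\<Sum>c\<in>UNIV. sc (B $ (y, m) $ (c, d)) * E i a c)" for a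
    proof -
      have "E i a y * co j m d (tens B i j)
        = (\<Sum>a'\<in>UNIV. if y = a' then \<Sum>c\<in>UNIV. sc (B $ (y, m) $ (c, d)) * E i a c else 0)"
        unfolding co_tens_snd[OF assms] sum_distrib_left
        by (intro sum.cong refl) (auto simp: sc_left[of "E _ _ _"] E_mult)
      then show ?thesis by simp
    qed
    ultimately show ?thesis
      by (simp add: sum_distrib_right mult.assoc sum_distrib_left sc_mult)
  qed
  have "ptr C j (tens A i j * E i x y * tens B i j) = (\<Sum>b\<in>UNIV. \<Sum>d\<in>UNIV. \<Sum>m\<in>UNIV.
      sc (C d b) * (co j b m (tens A i j) * E i x y * co j m d (tens B i j)))"
    using assms by (simp add: ptr_def co_mult[of j _ _ _ "tens B i j"] co_away_right away_E sum_distrib_left)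
  also have "\<dots> = (\<Sum>b\<in>UNIV. \<Sum>d\<in>UNIV. \<Sum>m\<in>UNIV. \<Sum>a\<in>UNIV. \<Sum>c\<in>UNIV.
      sc (C d b * A $ (a, b) $ (x, m) * B $ (y, m) $ (c, d)) * E i a c)"
    unfolding 1 by (simp add: sum_distrib_left sc_mult mult.assoc)
  also have "\<dots> = (\<Sum>a\<in>UNIV. \<Sum>c\<in>UNIV. \<Sum>b\<in>UNIV. \<Sum>d\<in>UNIV. \<Sum>m\<in>UNIV.
      sc (C d b * A $ (a, b) $ (x, m) * B $ (y, m) $ (c, d)) * E i a c)"
  proof -
    define g where "g b d m a c = sc (C d b * A $ (a, b) $ (x, m) * B $ (y, m) $ (c, d)) * E i a c" for b d m a c
    have "(\<Sum>b\<in>UNIV. \<Sum>d\<in>UNIV. \<Sum>m\<in>UNIV. \<Sum>a\<in>UNIV. \<Sum>c\<in>UNIV. g b d m a c)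
      = (\<Sum>b\<in>UNIV. \<Sum>a\<in>UNIV. \<Sum>c\<in>UNIV. \<Sum>d\<in>UNIV. \<Sum>m\<in>UNIV. g b d m a c)"
      by (rule sum.cong[OF refl], rule sum_swap_2_2)
    also have "\<dots> = (\<Sum>a\<in>UNIV. \<Sum>c\<in>UNIV. \<Sum>b\<in>UNIV. \<Sum>d\<in>UNIV. \<Sum>m\<in>UNIV. g b d m a c)"
      by (rule sum_swap_2_1[symmetric])
    finally show ?thesis by (simp only: g_def)
  qed
  finally show ?thesis by (simp only: sc_sum sum_distrib_right)
qed

lemma sc_eq_iff: "sc x = sc y \<longleftrightarrow> x = y"
  using sc_inj by (auto dest: injD)

text \<open>Coefficients of matrix units can be compared because \<open>co\<close> extracts them and
  \<open>sc\<close> is injective; the result is an identity between complex numbers.\<close>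

lemma ptr_tens_E_tens_coords:
  assumes "i \<noteq> j" "ptr C j (tens A i j * E i x y * tens B i j) = sc z"
  shows "(\<Sum>b\<in>UNIV. \<Sum>d\<in>UNIV. \<Sum>m\<in>UNIV. C d b * A $ (a, b) $ (x, m) * B $ (y, m) $ (c, d))
    = (if a = c then z else 0)"
proof -
  let ?f = "\<lambda>a c. \<Sum>b\<in>UNIV. \<Sum>d\<in>UNIV. \<Sum>m\<in>UNIV. C d b * A $ (a, b) $ (x, m) * B $ (y, m) $ (c, d)"
  have "co i a c (\<Sum>a\<in>UNIV. \<Sum>c\<in>UNIV. sc (?f a c) * E i a c)
    = (\<Sum>a'\<in>UNIV. if a' = a then \<Sum>c'\<in>UNIV. if c' = c then sc (?f a' c') else 0 else 0)"
    unfolding co_sum co_sc co_E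
    by (intro sum.cong refl) (auto simp: mult_delta_right intro: sum.cong)
  then have "co i a c (\<Sum>a\<in>UNIV. \<Sum>c\<in>UNIV. sc (?f a c) * E i a c) = sc (?f a c)" by simp
  moreover have "co i a c (sc z) = sc (if a = c then z else 0)"
    using co_sc[of i a c z 1] by (simp add: co_1)
  ultimately have "sc (?f a c) = sc (if a = c then z else 0)"
    using assms ptr_tens_E_tens[OF assms(1), of A x y B] by simp
  then show ?thesis by (simp only: sc_eq_iff)
qed

text \<open>The braid relation rewrites \<open>r (Suc i) * r i * rb (Suc i)\<close> as
  \<open>rb i * r (Suc i) * r i\<close>, whose trace over the last slot is 1 by
  \<open>ptr_r\<close>. Contracting slot i with \<open>kap\<close> then replaces the inner
  \<open>r i\<close> by a matrix unit. The second identity arises in the same way with the inverses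
  exchanged.\<close>

lemma ptr_conj_E_Suc:
  "ptr C (Suc (Suc i)) (r (Suc i) * E (Suc i) x y * rb (Suc i)) = sc (C y x)"
  "ptr C (Suc (Suc i)) (rb (Suc i) * E (Suc i) x y * r (Suc i)) = sc (C y x)"
proof -
  have aw: "away (Suc (Suc i)) (r i)" "away (Suc (Suc i)) (rb i)" "away i (r (Suc i))" "away i (rb (Suc i))"
    by (auto intro: away_r away_rb)
  have "r (Suc i) * r i * rb (Suc i) = rb i * r (Suc i) * r i"
  proof -
    have "rb i * (r i * (r (Suc i) * (r i * rb (Suc i)))) = rb i * (r (Suc i) * (r i * (r (Suc i) * rb (Suc i))))"
      by (simp only: braid')
    then show ?thesis by (simp add: mult.assoc)
  qed
  then have "ptr C (Suc (Suc i)) (r (Suc i) * r i * rb (Suc i)) = 1"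
    using aw by (simp add: ptr_away_left ptr_away_right ptr_r)
  then have "ptr C (Suc (Suc i)) (kap y x i (r (Suc i) * r i * rb (Suc i))) = sc (C y x)"
    by (simp add: ptr_kap kap_1)
  then show "ptr C (Suc (Suc i)) (r (Suc i) * E (Suc i) x y * rb (Suc i)) = sc (C y x)"
    using aw by (simp add: kap_mult kap_r)
  have "rb (Suc i) * r i * r (Suc i) = r i * r (Suc i) * rb i"
    by (simp add: mult.assoc r_r_rb)
  then have "ptr C (Suc (Suc i)) (rb (Suc i) * r i * r (Suc i)) = 1"
    using aw by (simp add: ptr_away_left ptr_away_right ptr_r)
  then have "ptr C (Suc (Suc i)) (kap y x i (rb (Suc i) * r i * r (Suc i))) = sc (C y x)"
    by (simp add: ptr_kap kap_1)
  then show "ptr C (Suc (Suc i)) (rb (Suc i) * E (Suc i) x y * r (Suc i)) = sc (C y x)"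
    using aw by (simp add: kap_mult kap_r)
qed

text \<open>The trace identity just proved uses up a slot in front of the pair. Its coordinate form
  is purely numerical and therefore holds for every pair of slots, including the first.\<close>

lemma conj_coords:
  "(\<Sum>b\<in>UNIV. \<Sum>d\<in>UNIV. \<Sum>m\<in>UNIV. C d b * R $ (a, b) $ (x, m) * matrix_inv R $ (y, m) $ (c, d))
    = (if a = c then C y x else 0)"
  "(\<Sum>b\<in>UNIV. \<Sum>d\<in>UNIV. \<Sum>m\<in>UNIV. C d b * matrix_inv R $ (a, b) $ (x, m) * R $ (y, m) $ (c, d))
    = (if a = c then C y x else 0)"
  using ptr_conj_E_Suc[of 0 x y] unfolding r_def rb_def
  by (simp_all only: ptr_tens_E_tens_coords[OF n_not_Suc_n])

lemma ptr_conj: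
  assumes "away (Suc i) Z"
  shows "ptr C (Suc i) (r i * Z * rb i) = ptr C i Z" "ptr C (Suc i) (rb i * Z * r i) = ptr C i Z"
proof -
  have E: "ptr C (Suc i) (r i * E i x y * rb i) = sc (C y x)"
    "ptr C (Suc i) (rb i * E i x y * r i) = sc (C y x)" for x y
  proof -
    have "(\<Sum>a\<in>UNIV. \<Sum>c\<in>UNIV. sc (if a = c then C y x else 0) * E i a c)
        = (\<Sum>a\<in>UNIV. \<Sum>c\<in>UNIV. if a = c then sc (C y x) * E i a c else 0)"
      by (intro sum.cong refl) auto
    then show "ptr C (Suc i) (r i * E i x y * rb i) = sc (C y x)"
      "ptr C (Suc i) (rb i * E i x y * r i) = sc (C y x)"
      unfolding r_def rb_def
      by (simp_all add: ptr_tens_E_tens conj_coords sum_distrib_left[symmetric] E_sum)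
  qed
  have aw: "away i (co i a b Z)" "away (Suc i) (co i a b Z)" for a b
    using assms by (simp_all add: away_co_same away_co)
  \<comment> \<open>With respect to slot i the coefficients of Z touch neither slot of R, so they
    can be pulled out and only matrix units remain inside the conjugation.\<close>
  have Z: "X * Z * Y = (\<Sum>a\<in>UNIV. \<Sum>b\<in>UNIV. co i a b Z * (X * E i a b * Y))"
    if "\<And>a b. X * co i a b Z = co i a b Z * X" for X Y
  proof -
    have "X * Z * Y = (\<Sum>a\<in>UNIV. \<Sum>b\<in>UNIV. (X * co i a b Z) * E i a b * Y)"
      by (subst co_expand[of Z i]) (simp add: sum_distrib_left sum_distrib_right mult.assoc)
    then show ?thesis by (simp add: that mult.assoc)
  qed
  have "ptr C (Suc i) (r i * Z * rb i) = (\<Sum>a\<in>UNIV. \<Sum>b\<in>UNIV. co i a b Z * sc (C b a))"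
    using aw by (simp add: Z r_away_comm ptr_sum ptr_away_left E)
  then show "ptr C (Suc i) (r i * Z * rb i) = ptr C i Z"
    by (simp only: ptr_def sc_comm)
  have "ptr C (Suc i) (rb i * Z * r i) = (\<Sum>a\<in>UNIV. \<Sum>b\<in>UNIV. co i a b Z * sc (C b a))"
    using aw by (simp add: Z rb_away_comm ptr_sum ptr_away_left E)
  then show "ptr C (Suc i) (rb i * Z * r i) = ptr C i Z"
    by (simp only: ptr_def sc_comm)
qed

text \<open>Contracting the coordinates of \<open>ptr_conj\<close> with the skew inverse gives
  \<open>R\<^sup>-\<^sup>1 C\<^sub>2 = C\<^sub>1 \<Psi>\<^sub>2\<^sub>1\<close> and \<open>C\<^sub>2 R\<^sup>-\<^sup>1 = \<Psi>\<^sub>2\<^sub>1 C\<^sub>1\<close>, hence \<open>C\<^sub>1 C\<^sub>2\<close> commutes with \<open>R\<close>.\<close>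

lemma matrix_inv_C:
  "(\<Sum>d\<in>UNIV. matrix_inv R $ (y, i) $ (c, d) * C d k) = (\<Sum>x\<in>UNIV. C y x * \<Psi> $ (i, x) $ (k, c))"
proof -
  define f where "f a x b m = \<Psi> $ (i, x) $ (k, a) * R $ (a, b) $ (x, m)
      * (\<Sum>d\<in>UNIV. matrix_inv R $ (y, m) $ (c, d) * C d b)" for a x b m
  have "(\<Sum>b\<in>UNIV. \<Sum>m\<in>UNIV. f a x b m) = \<Psi> $ (i, x) $ (k, a) * (if a = c then C y x else 0)" for a x
  proof -
    have "(\<Sum>b\<in>UNIV. \<Sum>m\<in>UNIV. f a x b m) = \<Psi> $ (i, x) $ (k, a) *
      (\<Sum>b\<in>UNIV. \<Sum>m\<in>UNIV. \<Sum>d\<in>UNIV. C d b * R $ (a, b) $ (x, m) * matrix_inv R $ (y, m) $ (c, d))"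
      unfolding f_def sum_distrib_left by (intro sum.cong refl) (simp add: ac_simps)
    also have "\<dots> = \<Psi> $ (i, x) $ (k, a) *
      (\<Sum>b\<in>UNIV. \<Sum>d\<in>UNIV. \<Sum>m\<in>UNIV. C d b * R $ (a, b) $ (x, m) * matrix_inv R $ (y, m) $ (c, d))"
      by (rule arg_cong[where f = "(*) _"], rule sum.cong[OF refl], rule sum.swap)
    finally show ?thesis by (simp only: conj_coords)
  qed
  then have "(\<Sum>x\<in>UNIV. \<Sum>a\<in>UNIV. \<Sum>b\<in>UNIV. \<Sum>m\<in>UNIV. f a x b m)
    = (\<Sum>x\<in>UNIV. C y x * \<Psi> $ (i, x) $ (k, c))"
    by (simp add: mult_delta_right mult.commute[of _ "C _ _"])
  moreover have "(\<Sum>b\<in>UNIV. \<Sum>m\<in>UNIV. \<Sum>x\<in>UNIV. \<Sum>a\<in>UNIV. f a x b m)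
    = (\<Sum>b\<in>UNIV. \<Sum>m\<in>UNIV. (if b = k \<and> i = m then 1 else 0) * (\<Sum>d\<in>UNIV. matrix_inv R $ (y, m) $ (c, d) * C d b))"
    unfolding f_def by (simp only: sum_distrib_right[symmetric] skew_left conj_commute)
  moreover have "(\<Sum>x\<in>UNIV. \<Sum>a\<in>UNIV. \<Sum>b\<in>UNIV. \<Sum>m\<in>UNIV. f a x b m)
    = (\<Sum>b\<in>UNIV. \<Sum>m\<in>UNIV. \<Sum>x\<in>UNIV. \<Sum>a\<in>UNIV. f a x b m)"
    by (rule sum_swap_2_2)
  ultimately show ?thesis by (simp only: sum_delta2)
qed

lemma C_matrix_inv:
  "(\<Sum>b\<in>UNIV. C i b * matrix_inv R $ (a, b) $ (x, k)) = (\<Sum>y\<in>UNIV. \<Psi> $ (i, a) $ (k, y) * C y x)"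
proof -
  define f where "f c y d m = \<Psi> $ (i, c) $ (k, y) * R $ (y, m) $ (c, d)
      * (\<Sum>b\<in>UNIV. C d b * matrix_inv R $ (a, b) $ (x, m))" for c y d m
  have "(\<Sum>m\<in>UNIV. \<Sum>d\<in>UNIV. f c y d m) = \<Psi> $ (i, c) $ (k, y) * (if a = c then C y x else 0)" for c y
  proof -
    have "(\<Sum>m\<in>UNIV. \<Sum>d\<in>UNIV. f c y d m) = \<Psi> $ (i, c) $ (k, y) *
      (\<Sum>m\<in>UNIV. \<Sum>d\<in>UNIV. \<Sum>b\<in>UNIV. C d b * matrix_inv R $ (a, b) $ (x, m) * R $ (y, m) $ (c, d))"
      unfolding f_def sum_distrib_left by (intro sum.cong refl) (simp add: ac_simps)
    also have "\<dots> = \<Psi> $ (i, c) $ (k, y) *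
      (\<Sum>b\<in>UNIV. \<Sum>d\<in>UNIV. \<Sum>m\<in>UNIV. C d b * matrix_inv R $ (a, b) $ (x, m) * R $ (y, m) $ (c, d))"
      by (rule arg_cong[where f = "(*) _"], rule trans[OF sum_swap_2_1], rule sum.cong[OF refl],
        rule sum.swap)
    finally show ?thesis by (simp only: conj_coords)
  qed
  then have "(\<Sum>c\<in>UNIV. \<Sum>y\<in>UNIV. \<Sum>m\<in>UNIV. \<Sum>d\<in>UNIV. f c y d m)
    = (\<Sum>c\<in>UNIV. \<Sum>y\<in>UNIV. \<Psi> $ (i, c) $ (k, y) * (if a = c then C y x else 0))"
    by simp
  also have "\<dots> = (\<Sum>y\<in>UNIV. \<Sum>c\<in>UNIV. \<Psi> $ (i, c) $ (k, y) * (if a = c then C y x else 0))"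
    by (rule sum.swap)
  also have "\<dots> = (\<Sum>y\<in>UNIV. \<Psi> $ (i, a) $ (k, y) * C y x)"
    by (simp add: if_distrib[of "(*) _"] cong: if_cong)
  finally have "(\<Sum>c\<in>UNIV. \<Sum>y\<in>UNIV. \<Sum>m\<in>UNIV. \<Sum>d\<in>UNIV. f c y d m)
    = (\<Sum>y\<in>UNIV. \<Psi> $ (i, a) $ (k, y) * C y x)" .
  moreover have "(\<Sum>m\<in>UNIV. \<Sum>d\<in>UNIV. \<Sum>c\<in>UNIV. \<Sum>y\<in>UNIV. f c y d m)
    = (\<Sum>m\<in>UNIV. \<Sum>d\<in>UNIV. (if m = k \<and> i = d then 1 else 0) * (\<Sum>b\<in>UNIV. C d b * matrix_inv R $ (a, b) $ (x, m)))"
    unfolding f_def by (simp only: sum_distrib_right[symmetric] skew_left conj_commute)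
  moreover have "(\<Sum>c\<in>UNIV. \<Sum>y\<in>UNIV. \<Sum>m\<in>UNIV. \<Sum>d\<in>UNIV. f c y d m)
    = (\<Sum>m\<in>UNIV. \<Sum>d\<in>UNIV. \<Sum>c\<in>UNIV. \<Sum>y\<in>UNIV. f c y d m)"
    by (rule sum_swap_2_2)
  ultimately show ?thesis by (simp only: sum_delta2)
qed

lemma C_C_matrix_inv:
  "(\<Sum>p\<in>UNIV. C (fst t) (fst p) * C (snd t) (snd p) * matrix_inv R $ p $ s)
    = (\<Sum>p\<in>UNIV. matrix_inv R $ t $ p * (C (fst p) (fst s) * C (snd p) (snd s)))"
proof -
  obtain y i where t: "t = (y, i)" by fastforce
  obtain x k where s: "s = (x, k)" by fastforce
  have "(\<Sum>p\<in>UNIV. C (fst t) (fst p) * C (snd t) (snd p) * matrix_inv R $ p $ s)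
    = (\<Sum>a\<in>UNIV. C y a * (\<Sum>b\<in>UNIV. C i b * matrix_inv R $ (a, b) $ (x, k)))"
    by (simp add: t s sum_UNIV_prod sum_distrib_left mult.assoc)
  also have "\<dots> = (\<Sum>a\<in>UNIV. \<Sum>c\<in>UNIV. C y a * \<Psi> $ (i, a) $ (k, c) * C c x)"
    by (simp only: C_matrix_inv sum_distrib_left mult.assoc)
  also have "\<dots> = (\<Sum>c\<in>UNIV. (\<Sum>a\<in>UNIV. C y a * \<Psi> $ (i, a) $ (k, c)) * C c x)"
    by (subst sum.swap) (simp only: sum_distrib_right)
  also have "\<dots> = (\<Sum>c\<in>UNIV. \<Sum>d\<in>UNIV. matrix_inv R $ (y, i) $ (c, d) * C d k * C c x)"
    by (simp only: matrix_inv_C[symmetric] sum_distrib_right)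
  finally show ?thesis
    by (simp add: t s sum_UNIV_prod ac_simps)
qed

lemma ptr_E_left: "ptr c i (E i a b * Z) = (\<Sum>s\<in>UNIV. sc (c s a) * co i b s Z)"
proof -
  have "ptr c i (E i a b * Z) = (\<Sum>x\<in>UNIV. if x = a then \<Sum>s\<in>UNIV. sc (c s x) * co i b s Z else 0)"
    unfolding ptr_def co_mult co_E
    by (intro sum.cong refl) (auto simp: if_distrib[of "\<lambda>x. x * _"] cong: if_cong)
  then show ?thesis by simp
qed

lemma ptr_E_right: "ptr c i (Z * E i a b) = (\<Sum>s\<in>UNIV. sc (c b s) * co i s a Z)"
proof -
  have "ptr c i (Z * E i a b) = (\<Sum>x\<in>UNIV. \<Sum>y\<in>UNIV. if y = b then sc (c y x) * co i x a Z else 0)"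
    unfolding ptr_def co_mult co_E
    by (intro sum.cong refl) (auto simp: if_distrib[of "(*) _"] cong: if_cong)
  then show ?thesis by simp
qed

text \<open>Cyclicity in two slots amounts to C_1 C_2 commuting with R. That is available for R^-1
  in \<open>C_C_matrix_inv\<close>, and R differs from R^-1 by a scalar, for which cyclicity is
  trivial.\<close>

lemma ptr_ptr_cyclic:
  shows "ptr C i (ptr C (Suc i) (r i * Z)) = ptr C i (ptr C (Suc i) (Z * r i))"
proof -
  let ?S = "matrix_inv R" and ?j = "Suc i"
  let ?U = "\<lambda>p s. E i (fst p) (fst s) * E ?j (snd p) (snd s)"
  define CC where "CC t p = C (fst t) (fst p) * C (snd t) (snd p)" for t p
  define z where "z s t = co i (fst s) (fst t) (co ?j (snd s) (snd t) Z)" for s t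
  have U1: "ptr C i (ptr C ?j (?U p s * Z)) = (\<Sum>t\<in>UNIV. sc (CC t p) * z s t)" for p s
  proof -
    have "ptr C i (ptr C ?j (?U p s * Z))
       = ptr C i (E i (fst p) (fst s) * ptr C ?j (E ?j (snd p) (snd s) * Z))"
      by (simp only: mult.assoc ptr_away_left[OF away_E[OF n_not_Suc_n[symmetric]]])
    also have "\<dots> = (\<Sum>t\<in>UNIV. sc (CC t p) * z s t)"
      unfolding ptr_E_left
      by (simp add: co_sum co_sc CC_def z_def sum_UNIV_prod sc_mult sum_distrib_left mult.assoc)
    finally show ?thesis .
  qed
  have U2: "ptr C i (ptr C ?j (Z * ?U p s)) = (\<Sum>t\<in>UNIV. sc (CC s t) * z t p)" for p s
  proof -
    have "Z * ?U p s = (Z * E ?j (snd p) (snd s)) * E i (fst p) (fst s)"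
      by (simp only: mult.assoc E_comm[of i ?j, OF n_not_Suc_n])
    then have "ptr C i (ptr C ?j (Z * ?U p s))
       = ptr C i (ptr C ?j (Z * E ?j (snd p) (snd s)) * E i (fst p) (fst s))"
      by (simp only: ptr_away_right[OF away_E[OF n_not_Suc_n[symmetric]]])
    also have "\<dots> = (\<Sum>t\<in>UNIV. sc (CC s t) * z t p)"
      unfolding ptr_E_right
      by (simp add: co_sum co_sc CC_def z_def sum_UNIV_prod sc_mult sum_distrib_left mult.assoc)
    finally show ?thesis .
  qed
  have "ptr C i (ptr C ?j (rb i * Z))
      = (\<Sum>p\<in>UNIV. \<Sum>s\<in>UNIV. \<Sum>t\<in>UNIV. sc (CC t p * ?S $ p $ s) * z s t)"
    unfolding rb_def tens_def
    by (simp add: sum_distrib_right ptr_sum ptr_sc mult.assoc U1[unfolded mult.assoc] sum_distrib_left sc_mult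
        sc_left[of "sc (CC _ _)"])
  also have "\<dots> = (\<Sum>p\<in>UNIV. \<Sum>t\<in>UNIV. \<Sum>s\<in>UNIV. sc (CC t p * ?S $ p $ s) * z s t)"
    by (rule sum.cong[OF refl], rule sum.swap)
  also have "\<dots> = (\<Sum>t\<in>UNIV. \<Sum>p\<in>UNIV. \<Sum>s\<in>UNIV. sc (CC t p * ?S $ p $ s) * z s t)"
    by (rule sum.swap)
  also have "\<dots> = (\<Sum>t\<in>UNIV. \<Sum>s\<in>UNIV. \<Sum>p\<in>UNIV. sc (CC t p * ?S $ p $ s) * z s t)"
    by (rule sum.cong[OF refl], rule sum.swap)
  also have "\<dots> = (\<Sum>t\<in>UNIV. \<Sum>s\<in>UNIV. \<Sum>p\<in>UNIV. sc (?S $ t $ p * CC p s) * z s t)"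
    by (simp only: sum_distrib_right[symmetric] sc_sum[symmetric] CC_def C_C_matrix_inv)
  also have "\<dots> = (\<Sum>t\<in>UNIV. \<Sum>p\<in>UNIV. \<Sum>s\<in>UNIV. sc (?S $ t $ p * CC p s) * z s t)"
    by (rule sum.cong[OF refl], rule sum.swap)
  also have "\<dots> = ptr C i (ptr C ?j (Z * rb i))"
    unfolding rb_def tens_def
    by (simp add: sum_distrib_left ptr_sum sc_left[of Z] ptr_sc U2 sc_mult mult.assoc)
  finally have "ptr C i (ptr C ?j (rb i * Z)) = ptr C i (ptr C ?j (Z * rb i))" .
  then show ?thesis
    by (simp add: rb_eq left_diff_distrib right_diff_distrib ptr_diff sc_comm)
qed

end


section \<open>The Hecke algebra inside the slot ring\<close>

lemma intertwine_mult:
  fixes A B D X Y :: "'a::semigroup_mult"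
  assumes "A * X = X' * B" "B * Y = Y' * D"
  shows "A * (X * Y) = X' * Y' * D"
proof -
  have "A * (X * Y) = (X' * B) * Y" by (simp only: mult.assoc[symmetric] assms(1))
  also have "\<dots> = X' * (Y' * D)" by (simp only: mult.assoc assms(2))
  finally show ?thesis by (simp only: mult.assoc)
qed

context hecke_slots
begin

text \<open>The image of a Hecke algebra on the half-open range of slots n, ..., k - 1; thus
  \<open>H 0 n\<close> is the image of H_n(q), with generators \<open>r 0\<close>, ...,
  \<open>r (n - 2)\<close>.\<close>

inductive_set H :: "nat \<Rightarrow> nat \<Rightarrow> 'r set" for n k where
  H_sc: "sc c \<in> H n k"
| H_r: "n \<le> i \<Longrightarrow> Suc i < k \<Longrightarrow> r i \<in> H n k"
| H_add: "X \<in> H n k \<Longrightarrow> Y \<in> H n k \<Longrightarrow> X + Y \<in> H n k"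
| H_mult: "X \<in> H n k \<Longrightarrow> Y \<in> H n k \<Longrightarrow> X * Y \<in> H n k"

lemma H_1: "1 \<in> H n k"
  using H_sc[of 1 n k] by simp

lemma H_rb: "n \<le> i \<Longrightarrow> Suc i < k \<Longrightarrow> rb i \<in> H n k"
  using H_add[OF H_r[of n i k] H_sc[of "- lam"]] by (simp add: rb_eq sc_minus)

lemma H_mono: "X \<in> H n k \<Longrightarrow> n' \<le> n \<Longrightarrow> k \<le> k' \<Longrightarrow> X \<in> H n' k'"
  by (induction rule: H.induct) (auto intro: H.intros)

lemma H_away: "X \<in> H n k \<Longrightarrow> j < n \<or> k \<le> j \<Longrightarrow> away j X"
  by (induction rule: H.induct) (auto intro: away_add away_mult away_r)

lemma H_comm_away: "X \<in> H n k \<Longrightarrow> (\<And>j. n \<le> j \<Longrightarrow> j < k \<Longrightarrow> away j Z) \<Longrightarrow> X * Z = Z * X"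
proof (induction rule: H.induct)
  case (H_r i)
  then show ?case by (intro r_away_comm) auto
next
  case (H_mult X Y)
  then show ?case using intertwine_mult[of Z X X Z Y Y Z] by simp
qed (simp_all add: sc_comm distrib_left distrib_right)

lemma H_scalar: "X \<in> H n k \<Longrightarrow> k \<le> Suc n \<Longrightarrow> \<exists>c. X = sc c"
  by (induction rule: H.induct) (auto simp: sc_add[symmetric] sc_mult[symmetric])

text \<open>The span of the words in \<open>r 0\<close>, ..., \<open>r k\<close> that contain the
  last generator at most once; it turns out to be the whole algebra on slots 0, ..., k + 1.\<close>

inductive_set G :: "nat \<Rightarrow> 'r set" for k where
  G_H: "X \<in> H 0 (Suc k) \<Longrightarrow> X \<in> G k"
| G_r: "X \<in> H 0 (Suc k) \<Longrightarrow> Y \<in> H 0 (Suc k) \<Longrightarrow> X * r k * Y \<in> G k"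
| G_add: "X \<in> G k \<Longrightarrow> Y \<in> G k \<Longrightarrow> X + Y \<in> G k"

lemma G_left: "Z \<in> H 0 (Suc k) \<Longrightarrow> X \<in> G k \<Longrightarrow> Z * X \<in> G k"
proof (rotate_tac 1, induction rule: G.induct)
  case (G_r X Y)
  then have "(Z * X) * r k * Y \<in> G k"
    by (intro G.G_r H_mult)
  then show ?case by (simp add: mult.assoc)
qed (auto simp: distrib_left intro: G.intros H_mult)

text \<open>It suffices that the span is stable under left multiplication by the last generator.
  Between two occurrences of that generator there stands an element of the smaller algebra, which by
  induction contains its own last generator at most once; the Hecke or the braid relation then
  removes one occurrence.\<close>

lemma H_subset_G: "X \<in> H 0 (Suc (Suc k)) \<Longrightarrow> X \<in> G k"
proof (induction k arbitrary: X)
  case (0 X)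
  have r0: "r 0 \<in> G 0"
    using G_r[OF H_1[of 0 "Suc 0"] H_1[of 0 "Suc 0"]] by simp
  have G0: "Y \<in> G 0 \<Longrightarrow> r 0 * Y \<in> G 0" for Y
  proof (induction rule: G.induct)
    case (G_H X)
    then show ?case using G_r[OF H_1[of 0 "Suc 0"] G_H] by simp
  next
    case (G_r X Y)
    \<comment> \<open>On a single slot the algebra consists of scalars, so the Hecke relation alone
      suffices when k = 0.\<close>
    obtain c where "X = sc c" using H_scalar[OF G_r(1)] by auto
    then have "r 0 * (X * r 0 * Y) = sc c * (r 0 * r 0) * Y"
      by (simp only: mult.assoc sc_left[of "r 0"])
    also have "\<dots> = sc c * Y + sc (c * lam) * r 0 * Y"
      by (simp add: r_r distrib_left distrib_right sc_mult mult.assoc)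
    finally have eq: "r 0 * (X * r 0 * Y) = sc c * Y + sc (c * lam) * r 0 * Y" .
    show ?case
      unfolding eq by (intro G.G_add G.G_r G.G_H H_mult H_sc G_r(2))
  qed (auto simp: distrib_left intro: G.G_add)
  have "Y \<in> G 0 \<Longrightarrow> X * Y \<in> G 0" for Y
    using 0
  proof (induction arbitrary: Y rule: H.induct)
    case (H_sc c)
    then show ?case by (intro G_left H.H_sc)
  next
    case (H_r i)
    then show ?case using G0 by simp
  next
    case (H_add X X')
    then show ?case by (auto simp: distrib_right intro: G.G_add)
  next
    case (H_mult X X')
    then show ?case by (simp add: mult.assoc)
  qed
  from this[OF G_H[OF H_1]] show ?case by simp
next
  case (Suc k X)
  let ?k = "Suc k"
  have Gr: "r ?k * (Z * r ?k * Y) \<in> G ?k" if Z: "Z \<in> H 0 (Suc ?k)" and Y: "Y \<in> H 0 (Suc ?k)" for Z Y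
    using Suc.IH[OF Z] Y
  proof (induction arbitrary: Y rule: G.induct)
    case (G_H Z)
    have "r ?k * Z = Z * r ?k"
      by (intro r_away_comm H_away[OF G_H(1)]) auto
    then have "r ?k * (Z * r ?k * Y) = Z * (r ?k * r ?k) * Y"
      by (simp add: mult.assoc[symmetric])
    also have "\<dots> = Z * Y + sc lam * (Z * r ?k * Y)"
      by (simp add: r_r distrib_left distrib_right mult.assoc sc_left[of Z])
    finally have eq: "r ?k * (Z * r ?k * Y) = Z * Y + sc lam * (Z * r ?k * Y)" .
    have Z: "Z \<in> H 0 (Suc ?k)" using G_H(1) by (rule H_mono) auto
    show ?case unfolding eq
      by (intro G_add G_left H_sc G_r G.G_H H_mult Z G_H(2))
  next
    \<comment> \<open>A and B act in slots 0, ..., k and commute with \<open>r ?k\<close>. The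
      factors that meet are then \<open>r ?k\<close>, \<open>r k\<close>, \<open>r ?k\<close>, and
      the braid relation leaves \<open>r ?k\<close> only once.\<close>
    case (G_r A B)
    have comm: "r ?k * A = A * r ?k" "B * r ?k = r ?k * B"
      using r_away_comm[OF H_away[OF G_r(1)] H_away[OF G_r(1)], of ?k]
        r_away_comm[OF H_away[OF G_r(2)] H_away[OF G_r(2)], of ?k] by simp_all
    have "r ?k * (A * r k * B * r ?k * Y) = (r ?k * A) * r k * (B * r ?k) * Y"
      by (simp only: mult.assoc)
    also have "\<dots> = A * (r ?k * (r k * (r ?k * (B * Y))))"
      by (simp only: comm mult.assoc)
    also have "\<dots> = (A * r k) * r ?k * (r k * (B * Y))"
      by (simp add: braid'[symmetric] mult.assoc)
    finally have eq: "r ?k * (A * r k * B * r ?k * Y) = (A * r k) * r ?k * (r k * (B * Y))" .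
    have AB: "A \<in> H 0 (Suc ?k)" "B \<in> H 0 (Suc ?k)"
      using G_r(1,2) by (auto intro: H_mono)
    show ?case unfolding eq
      by (intro G.G_r H_mult H_r AB G_r(3)) auto
  next
    case (G_add A B)
    then show ?case by (auto simp: distrib_left distrib_right intro: G.G_add)
  qed
  have G1: "Y \<in> G ?k \<Longrightarrow> r ?k * Y \<in> G ?k" for Y
  proof (induction rule: G.induct)
    case (G_H X)
    then show ?case using G_r[OF H_1 G_H] by simp
  next
    case (G_r X Y)
    then show ?case by (rule Gr)
  qed (auto simp: distrib_left intro: G.G_add)
  have "Y \<in> G ?k \<Longrightarrow> X * Y \<in> G ?k" for Y
    using Suc.prems
  proof (induction arbitrary: Y rule: H.induct)
    case (H_sc c)
    then show ?case by (intro G_left H.H_sc)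
  next
    case (H_r i)
    show ?case
    proof (cases "i = ?k")
      case False
      then show ?thesis using H_r by (intro G_left H.H_r) auto
    qed (use G1 H_r in auto)
  next
    case (H_add X X')
    then show ?case by (auto simp: distrib_right intro: G.G_add)
  next
    case (H_mult X X')
    then show ?case by (simp add: mult.assoc)
  qed
  from this[OF G_H[OF H_1]] show ?case by simp
qed

text \<open>\<open>ptr_r\<close> deletes the single occurrence of the last generator; a word without
  it is multiplied by the trace of C. So contracting the last slot is a conditional expectation onto
  the smaller algebra.\<close>

lemma ptr_G: "X \<in> G k \<Longrightarrow> ptr C (Suc k) X \<in> H 0 (Suc k)"
proof (induction rule: G.induct)
  case (G_H X)
  then have "ptr C (Suc k) (X * 1) = X * ptr C (Suc k) 1"
    by (intro ptr_away_left H_away[of X 0 "Suc k"]) auto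
  then show ?case
    using G_H by (auto simp: ptr_1 intro: H_mult H_sc)
next
  case (G_r X Y)
  then have "ptr C (Suc k) (X * r k * Y) = X * ptr C (Suc k) (r k) * Y"
    by (simp add: ptr_away_left ptr_away_right H_away)
  then show ?case
    using G_r by (auto simp: ptr_r intro: H_mult)
next
  case (G_add X Y)
  then show ?case by (auto simp: ptr_add intro: H_add)
qed

lemma ptr_H: "X \<in> H 0 (Suc k) \<Longrightarrow> ptr C k X \<in> H 0 k"
proof (cases k)
  case 0
  assume "X \<in> H 0 (Suc k)"
  then obtain c where "X = sc c" using H_scalar[of X 0 "Suc k"] 0 by auto
  then show ?thesis using ptr_sc[of C k c 1] by (auto simp: ptr_1 sc_mult[symmetric] intro: H_sc)
next
  case (Suc l)
  assume "X \<in> H 0 (Suc k)"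
  then show ?thesis using Suc by (auto intro: ptr_G H_subset_G)
qed

lemma ptrs_H: "X \<in> H 0 (n + k) \<Longrightarrow> ptrs C n k X \<in> H 0 n"
proof (induction k arbitrary: X)
  case (Suc k)
  then show ?case by (simp only: ptrs_Suc_right) (simp add: ptr_H)
qed simp

text \<open>For a generator \<open>r i\<close> the slots beyond i + 1 are contracted first, which
  leaves cyclicity in two slots; a product is rotated one factor at a time. Z is arbitrary and may
  have noncommuting entries.\<close>

lemma ptrs_cyclic: "X \<in> H 0 k \<Longrightarrow> ptrs C 0 k (X * Z) = ptrs C 0 k (Z * X)"
proof (induction arbitrary: Z rule: H.induct)
  case (H_r i)
  define l where "l = k - Suc (Suc i)"
  have k: "k = i + Suc (Suc l)" using H_r by (simp add: l_def)
  have "ptrs C (Suc (Suc i)) l (r i * Z) = r i * ptrs C (Suc (Suc i)) l Z"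
       "ptrs C (Suc (Suc i)) l (Z * r i) = ptrs C (Suc (Suc i)) l Z * r i"
    by (auto intro!: ptrs_away_left ptrs_away_right away_r)
  then show ?case
    unfolding k ptrs_append by (simp add: ptr_ptr_cyclic)
next
  case (H_mult X Y)
  have "ptrs C 0 k (X * Y * Z) = ptrs C 0 k (Y * Z * X)"
    using H_mult.IH(1)[of "Y * Z"] by (simp add: mult.assoc)
  also have "\<dots> = ptrs C 0 k (Z * X * Y)"
    using H_mult.IH(2)[of "Z * X"] by (simp add: mult.assoc)
  finally show ?case by (simp add: mult.assoc)
qed (simp_all add: sc_comm distrib_left distrib_right ptrs_add)

section \<open>Shifting slots\<close>

text \<open>The braid \<open>r n * ... * r (n + m - 1)\<close>. Conjugation by it moves numerical
  matrices and overlined copies from slots n, ..., n + m - 1 one slot up (\<open>V_r\<close>,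
  \<open>V_over\<close>).\<close>

primrec V :: "nat \<Rightarrow> nat \<Rightarrow> 'r" where
  "V n 0 = 1"
| "V n (Suc m) = V n m * r (n + m)"

primrec Vi :: "nat \<Rightarrow> nat \<Rightarrow> 'r" where
  "Vi n 0 = 1"
| "Vi n (Suc m) = rb (n + m) * Vi n m"

lemma V_Vi [simp]: "V n m * Vi n m = 1"
  by (induction m) (simp_all add: mult.assoc)

lemma Vi_V [simp]: "Vi n m * V n m = 1"
proof (induction m)
  case (Suc m)
  have "Vi n (Suc m) * V n (Suc m) = rb (n + m) * (Vi n m * V n m) * r (n + m)"
    by (simp add: mult.assoc)
  then show ?case using Suc by simp
qed simp

lemma V_Vi' [simp]: "V n m * (Vi n m * Z) = Z" and Vi_V' [simp]: "Vi n m * (V n m * Z) = Z"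
  by (simp_all add: mult.assoc[symmetric])

lemma V_H: "n + m < k \<Longrightarrow> V n m \<in> H n k" and Vi_H: "n + m < k \<Longrightarrow> Vi n m \<in> H n k"
  by (induction m) (simp_all add: H_1 H_mult H_r H_rb)

lemma V_append: "V 0 n * V n m = V 0 (n + m)"
  by (induction m) (simp_all add: mult.assoc[symmetric])

lemma V_r: "n \<le> i \<Longrightarrow> Suc i < n + m \<Longrightarrow> V n m * r i = r (Suc i) * V n m"
proof (induction m)
  case (Suc m)
  show ?case
  proof (cases "Suc i < n + m")
    case True
    then have "V n (Suc m) * r i = V n m * r i * r (n + m)"
      using r_far[of i "n + m"] by (simp add: mult.assoc)
    then show ?thesis using Suc True by (simp add: mult.assoc)
  next
    case False
    with Suc.prems obtain l where l: "m = Suc l"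
      by (cases m) auto
    with False Suc.prems have i: "i = n + l" by simp
    note l = l i
    have "V n l * r (Suc i) = r (Suc i) * V n l"
      using V_H[of n l "Suc i"] l by (intro H_comm_away) (auto intro!: away_r)
    then have "V n l * (r (Suc i) * (r i * r (Suc i))) = r (Suc i) * (V n l * (r i * r (Suc i)))"
      by (simp only: mult.assoc[symmetric])
    then show ?thesis
      using l by (simp add: mult.assoc braid)
  qed
qed simp

lemma V_shift: "X \<in> H n (n + m) \<Longrightarrow> \<exists>X'\<in>H (Suc n) (Suc n + m). V n m * X = X' * V n m"
proof (induction rule: H.induct)
  case (H_sc c)
  then show ?case by (intro bexI[of _ "sc c"] H.H_sc) (simp add: sc_comm)
next
  case (H_r i)
  then show ?case by (intro bexI[of _ "r (Suc i)"] H.H_r) (auto simp: V_r)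
next
  case (H_add X Y)
  then obtain X' Y' where "X' \<in> H (Suc n) (Suc n + m)" "V n m * X = X' * V n m"
    "Y' \<in> H (Suc n) (Suc n + m)" "V n m * Y = Y' * V n m" by blast
  then show ?case by (intro bexI[of _ "X' + Y'"] H.H_add) (simp_all add: distrib_left distrib_right)
next
  case (H_mult X Y)
  then obtain X' Y' where *: "X' \<in> H (Suc n) (Suc n + m)" "V n m * X = X' * V n m"
    "Y' \<in> H (Suc n) (Suc n + m)" "V n m * Y = Y' * V n m" by blast
  have "V n m * (X * Y) = X' * Y' * V n m"
    by (rule intertwine_mult[OF *(2,4)])
  then show ?case using * by (intro bexI[of _ "X' * Y'"] H.H_mult)
qed

text \<open>The innermost factors \<open>r (i + m)\<close> and \<open>rb (i + m)\<close> form the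
  conjugation of \<open>ptr_conj\<close>. Once the last slot is contracted, the same situation
  remains with one slot less.\<close>

lemma ptrs_V:
  "(\<And>j. i + m \<le> j \<Longrightarrow> away j Z) \<Longrightarrow> ptrs C (Suc i) m (V i m * Z * Vi i m) = ptrs C i m Z"
proof (induction m arbitrary: Z)
  case (Suc m)
  have aw: "away (Suc (i + m)) (V i m)" "away (Suc (i + m)) (Vi i m)"
    using V_H[of i m "Suc (i + m)"] Vi_H[of i m "Suc (i + m)"] by (auto intro: H_away)
  have "V i (Suc m) * Z * Vi i (Suc m) = V i m * (r (i + m) * Z * rb (i + m)) * Vi i m"
    by (simp add: mult.assoc)
  then have "ptr C (Suc (i + m)) (V i (Suc m) * Z * Vi i (Suc m))
      = V i m * ptr C (Suc (i + m)) (r (i + m) * Z * rb (i + m)) * Vi i m"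
    using aw by (simp only: ptr_away_left ptr_away_right)
  also have "\<dots> = V i m * ptr C (i + m) Z * Vi i m"
    using Suc.prems by (simp add: ptr_conj)
  finally have "ptrs C (Suc i) (Suc m) (V i (Suc m) * Z * Vi i (Suc m))
      = ptrs C (Suc i) m (V i m * ptr C (i + m) Z * Vi i m)"
    by (simp only: ptrs_Suc_right add_Suc)
  also have "\<dots> = ptrs C i m (ptr C (i + m) Z)"
  proof (rule Suc.IH)
    fix j assume "i + m \<le> j"
    then show "away j (ptr C (i + m) Z)"
      by (cases "j = i + m") (simp_all add: away_ptr_same away_ptr Suc.prems)
  qed
  finally show ?case by (simp only: ptrs_Suc_right)
qed simp

lemma over_Suc: "over R X (Suc i) = r i * over R X i * rb i"
  and under_Suc: "under R X (Suc i) = rb i * under R X i * r i"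
  by (simp_all add: r_def rb_def)

declare over.simps(2) [simp del] under.simps(2) [simp del]

context
  fixes X assumes X: "\<And>j. 0 < j \<Longrightarrow> away j X"
begin

lemma away_over: "i < j \<Longrightarrow> away j (over R X i)"
  by (induction i) (auto simp: over_Suc X intro!: away_mult away_r away_rb)

lemma away_under: "i < j \<Longrightarrow> away j (under R X i)"
  by (induction i) (auto simp: under_Suc X intro!: away_mult away_r away_rb)

lemma over_r: "Suc i < j \<Longrightarrow> r i * over R X j = over R X j * r i"
proof (induction j)
  case (Suc j)
  show ?case
  proof (cases "Suc i < j")
    case True
    then have "r i * r j = r j * r i" "r i * rb j = rb j * r i"
      by (auto intro!: r_away_comm away_r away_rb)
    then have "r i * over R X (Suc j) = r j * (r i * over R X j) * rb j"
      by (simp add: over_Suc mult.assoc[symmetric])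
    also have "\<dots> = r j * over R X j * (r i * rb j)"
      using Suc True by (simp add: mult.assoc)
    also have "\<dots> = over R X (Suc j) * r i"
      using \<open>r i * rb j = rb j * r i\<close> by (simp add: over_Suc mult.assoc)
    finally show ?thesis .
  next
    case False
    \<comment> \<open>Here the last two conjugations are by \<open>r i\<close> and
      \<open>r (Suc i)\<close>; the braid relation turns \<open>r i\<close> on the left into
      \<open>r (Suc i)\<close>, which passes the inner copy and is turned back on the right.\<close>
    then have j: "j = Suc i" using Suc.prems by simp
    have "r (Suc i) * over R X i = over R X i * r (Suc i)"
      by (intro r_away_comm away_over) auto
    then have *: "r (Suc i) * (over R X i * Z) = over R X i * (r (Suc i) * Z)" for Z
      by (simp add: mult.assoc[symmetric])
    show ?thesis unfolding j over_Suc mult.assoc braid' * r_rb_rb ..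
  qed
qed simp

lemma under_rb: "rb i * under R X (Suc (Suc i)) = under R X (Suc (Suc i)) * rb i"
proof -
  have "rb (Suc i) * under R X i = under R X i * rb (Suc i)"
    by (intro rb_away_comm away_under) auto
  then have *: "rb (Suc i) * (under R X i * Z) = under R X i * (rb (Suc i) * Z)" for Z
    by (simp add: mult.assoc[symmetric])
  have "rb (Suc i) * (r i * r (Suc i)) = r i * (r (Suc i) * rb i)"
    by (simp add: r_r_rb)
  then show ?thesis
    unfolding under_Suc mult.assoc braid_rb' * by (simp add: mult.assoc)
qed

lemma H_over: "Y \<in> H n k \<Longrightarrow> k \<le> j \<Longrightarrow> Y * over R X j = over R X j * Y"
proof (induction rule: H.induct)
  case (H_r i)
  then show ?case by (intro over_r) auto
next
  case (H_mult Y Z)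
  then show ?case using intertwine_mult[of "over R X j" Y Y "over R X j" Z Z "over R X j"] by simp
qed (simp_all add: sc_comm distrib_left distrib_right)

definition Pi :: "nat \<Rightarrow> nat \<Rightarrow> 'r" where
  "Pi i m = prod_list (map (over R X) [i..<i + m])"

lemma Pi_0 [simp]: "Pi i 0 = 1"
  by (simp add: Pi_def)

lemma Pi_Suc: "Pi i (Suc m) = over R X i * Pi (Suc i) m"
  by (simp add: Pi_def upt_conv_Cons del: upt_Suc)

lemma away_Pi: "i + m \<le> j \<Longrightarrow> away j (Pi i m)"
  by (induction m arbitrary: i) (auto simp: Pi_Suc intro!: away_mult away_over)

lemma H_Pi: "Y \<in> H n i \<Longrightarrow> Y * Pi i m = Pi i m * Y"
proof (induction m arbitrary: i)
  case (Suc m)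
  have "Y * over R X i = over R X i * Y" using Suc.prems by (rule H_over) simp
  moreover have "Y * Pi (Suc i) m = Pi (Suc i) m * Y"
    by (rule Suc.IH, rule H_mono[OF Suc.prems]) auto
  ultimately show ?case unfolding Pi_Suc by (rule intertwine_mult)
qed simp

text \<open>The factor \<open>r j\<close> of the braid raises copy j to copy j + 1 by the definition
  of overlined copies. Later factors act in slots beyond j, and earlier ones commute with copy j +
  1.\<close>

lemma V_over: "n \<le> j \<Longrightarrow> j < n + m \<Longrightarrow> V n m * over R X j = over R X (Suc j) * V n m"
proof (induction m)
  case (Suc m)
  show ?case
  proof (cases "j < n + m")
    case True
    then have "r (n + m) * over R X j = over R X j * r (n + m)"
      by (intro r_away_comm away_over) auto
    then have "V n (Suc m) * over R X j = V n m * over R X j * r (n + m)"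
      by (simp add: mult.assoc)
    then show ?thesis using Suc True by (simp add: mult.assoc)
  next
    case False
    then have j: "j = n + m" using Suc.prems by simp
    have "V n m * over R X (Suc j) = over R X (Suc j) * V n m"
      using V_H[of n m "Suc j"] j by (intro H_over) auto
    moreover have "r j * over R X j = over R X (Suc j) * r j"
      by (simp add: over_Suc mult.assoc)
    ultimately show ?thesis using j by (simp add: mult.assoc) (simp add: mult.assoc[symmetric])
  qed
qed simp

lemma V_Pi: "n \<le> i \<Longrightarrow> i + l \<le> n + m \<Longrightarrow> V n m * Pi i l = Pi (Suc i) l * V n m"
proof (induction l arbitrary: i)
  case (Suc l)
  then have "V n m * over R X i = over R X (Suc i) * V n m" "V n m * Pi (Suc i) l = Pi (Suc (Suc i)) l * V n m"
    by (auto intro!: V_over)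
  then show ?case unfolding Pi_Suc by (rule intertwine_mult)
qed simp

text \<open>Each conjugation by \<open>V n m\<close> shifts \<open>z'\<close> and the product of
  copies by one slot and preserves the trace by \<open>ptrs_V\<close>. \<open>W\<close> and
  \<open>W'\<close> accumulate these conjugations so that the product can later be brought back to
  the first m slots.\<close>

lemma shift_character:
  assumes z: "z \<in> H 0 m"
  shows "\<exists>z'\<in>H n (n + m). \<exists>W\<in>H 0 (n + m). \<exists>W'\<in>H 0 (n + m). W * W' = 1 \<and> W' * W = 1 \<and>
    ptrs C n m (z' * Pi n m) = ptrs C 0 m (z * Pi 0 m) \<and> Pi n m = W * Pi 0 m * W'"
proof (induction n)
  case 0
  show ?case
    by (intro bexI[of _ z] bexI[of _ 1] conjI) (simp_all add: z H_1)
next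
  case (Suc n)
  then obtain z' W W' where *: "z' \<in> H n (n + m)" "W \<in> H 0 (n + m)" "W' \<in> H 0 (n + m)"
    "W * W' = 1" "W' * W = 1" "ptrs C n m (z' * Pi n m) = ptrs C 0 m (z * Pi 0 m)"
    "Pi n m = W * Pi 0 m * W'" by blast
  obtain z'' where z'': "z'' \<in> H (Suc n) (Suc n + m)" "V n m * z' = z'' * V n m"
    using V_shift[OF *(1)] by blast
  have VP: "V n m * Pi n m = Pi (Suc n) m * V n m"
    by (rule V_Pi) auto
  have W: "V n m * W \<in> H 0 (Suc n + m)" "W' * Vi n m \<in> H 0 (Suc n + m)"
    using *(2,3) V_H[of n m "Suc n + m"] Vi_H[of n m "Suc n + m"] by (auto intro!: H_mult elim: H_mono)
  have "V n m * W * (W' * Vi n m) = V n m * (W * W') * Vi n m"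
    "W' * Vi n m * (V n m * W) = W' * (Vi n m * V n m) * W"
    by (simp_all only: mult.assoc)
  then have inv: "V n m * W * (W' * Vi n m) = 1" "W' * Vi n m * (V n m * W) = 1"
    using *(4,5) by simp_all
  have "z'' * Pi (Suc n) m = z'' * (Pi (Suc n) m * V n m) * Vi n m"
    by (simp add: mult.assoc)
  also have "\<dots> = V n m * (z' * Pi n m) * Vi n m"
    by (simp only: VP[symmetric] z''(2)[symmetric] mult.assoc[symmetric])
  finally have "ptrs C (Suc n) m (z'' * Pi (Suc n) m) = ptrs C n m (z' * Pi n m)"
    using ptrs_V[of n m "z' * Pi n m"] by (auto intro!: away_mult H_away[OF *(1)] away_Pi)
  moreover have "Pi (Suc n) m = V n m * W * Pi 0 m * (W' * Vi n m)"
  proof -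
    have "Pi (Suc n) m = (Pi (Suc n) m * V n m) * Vi n m" by (simp add: mult.assoc)
    then show ?thesis by (simp only: VP[symmetric] *(7) mult.assoc)
  qed
  ultimately show ?case
    using z''(1) W inv *(6) by (intro bexI[of _ z''] bexI[of _ "V n m * W"] bexI[of _ "W' * Vi n m"] conjI) simp_all
qed

end

end


section \<open>Casimir operators acting on characters\<close>

text \<open>\<open>N\<close> stands for the operators that preserve the ideal of relations of \<open>M(R)\<close>, \<open>SJ\<close> for those
  that map everything into it and \<open>VJ\<close> for those that map the vacuum into it.\<close>

locale casimir_slots = hecke_slots sc E q R
  for sc :: "complex \<Rightarrow> 'r::ring_1" and E :: "nat \<Rightarrow> 'v::finite \<Rightarrow> 'v \<Rightarrow> 'r"
    and q :: complex and R :: "'v endo2" +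
  fixes M K :: 'r and N SJ VJ :: "'r set"
  assumes away_M: "0 < j \<Longrightarrow> away j M" and away_K: "0 < j \<Longrightarrow> away j K"
    and N_M: "M \<in> N" and N_K: "K \<in> N" and N_sc: "sc c \<in> N" and N_E: "E i a b \<in> N"
    and N_add: "X \<in> N \<Longrightarrow> Y \<in> N \<Longrightarrow> X + Y \<in> N" and N_mult: "X \<in> N \<Longrightarrow> Y \<in> N \<Longrightarrow> X * Y \<in> N"
    and SJ_left: "X \<in> N \<Longrightarrow> Y \<in> SJ \<Longrightarrow> X * Y \<in> SJ" and SJ_right: "X \<in> N \<Longrightarrow> Y \<in> SJ \<Longrightarrow> Y * X \<in> SJ"
    and SJ_add: "X \<in> SJ \<Longrightarrow> Y \<in> SJ \<Longrightarrow> X + Y \<in> SJ"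
    and SJ_VJ: "SJ \<subseteq> VJ"
    and VJ_0: "0 \<in> VJ" and VJ_add: "X \<in> VJ \<Longrightarrow> Y \<in> VJ \<Longrightarrow> X + Y \<in> VJ"
    and VJ_left: "X \<in> N \<Longrightarrow> Y \<in> VJ \<Longrightarrow> X * Y \<in> VJ" and VJ_E: "X \<in> VJ \<Longrightarrow> X * E i a b \<in> VJ"
    and K_M: "K * r 0 * M - rb 0 * M * r 0 * K * rb 0 \<in> SJ"
    and K_vac: "K - 1 \<in> VJ"
begin

lemma N_0: "0 \<in> N" and N_1: "1 \<in> N"
  using N_sc[of 0] N_sc[of 1] by simp_all

lemma N_sum: "(\<And>x. x \<in> A \<Longrightarrow> f x \<in> N) \<Longrightarrow> sum f A \<in> N"
  by (induction A rule: infinite_finite_induct) (auto intro: N_0 N_add)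

lemma N_tens: "tens A i j \<in> N"
  unfolding tens_def by (intro N_sum N_mult N_sc N_E)

lemma N_r: "r i \<in> N" and N_rb: "rb i \<in> N"
  by (simp_all add: r_def rb_def N_tens)

lemma N_H: "X \<in> H n k \<Longrightarrow> X \<in> N"
  by (induction rule: H.induct) (auto intro: N_sc N_r N_add N_mult)

lemma N_over: "X \<in> N \<Longrightarrow> over R X i \<in> N" and N_under: "X \<in> N \<Longrightarrow> under R X i \<in> N"
  by (induction i) (auto simp: over_Suc under_Suc intro!: N_mult N_r N_rb)

abbreviation "Mo \<equiv> over R M"
abbreviation "Mu \<equiv> under R M"
abbreviation "Ku \<equiv> under R K"
abbreviation "PM \<equiv> Pi M"

lemmas N_intros = N_mult N_r N_rb N_over N_under N_M N_K N_1

definition KK :: "nat \<Rightarrow> 'r" where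
  "KK n = prod_list (map Ku (rev [0..<n]))"

lemma KK_0 [simp]: "KK 0 = 1" and KK_Suc: "KK (Suc n) = Ku n * KK n"
  by (simp_all add: KK_def)

lemma N_KK: "KK n \<in> N"
  by (induction n) (auto simp: KK_Suc intro!: N_intros)

lemma N_PM: "PM i m \<in> N"
  by (induction m arbitrary: i) (auto simp: Pi_0[OF away_M] Pi_Suc[OF away_M] intro!: N_intros)

lemma away_KK: "n \<le> j \<Longrightarrow> away j (KK n)"
  by (induction n) (auto simp: KK_Suc intro!: away_mult away_under away_K)

definition sj :: "'r \<Rightarrow> 'r \<Rightarrow> bool" where "sj X Y \<longleftrightarrow> X - Y \<in> SJ"
definition vj :: "'r \<Rightarrow> 'r \<Rightarrow> bool" where "vj X Y \<longleftrightarrow> X - Y \<in> VJ"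

lemma sj_trans: "sj X Y \<Longrightarrow> sj Y Z \<Longrightarrow> sj X Z"
  using SJ_add[of "X - Y" "Y - Z"] by (simp add: sj_def)

lemma vj_trans: "vj X Y \<Longrightarrow> vj Y Z \<Longrightarrow> vj X Z"
  using VJ_add[of "X - Y" "Y - Z"] by (simp add: vj_def)

lemma vj_refl: "vj X X"
  by (simp add: vj_def VJ_0)

lemma sj_vj: "sj X Y \<Longrightarrow> vj X Y"
  using SJ_VJ by (auto simp: sj_def vj_def)

lemma sj_mult: "A \<in> N \<Longrightarrow> B \<in> N \<Longrightarrow> sj X Y \<Longrightarrow> sj (A * X * B) (A * Y * B)"
  using SJ_right[of B "A * (X - Y)"] SJ_left[of A "X - Y"]
  by (simp add: sj_def left_diff_distrib right_diff_distrib)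

lemma vj_left: "A \<in> N \<Longrightarrow> vj X Y \<Longrightarrow> vj (A * X) (A * Y)"
  using VJ_left[of A "X - Y"] by (simp add: vj_def right_diff_distrib)

lemma VJ_sum: "(\<And>x. x \<in> A \<Longrightarrow> f x \<in> VJ) \<Longrightarrow> sum f A \<in> VJ"
  by (induction A rule: infinite_finite_induct) (auto intro: VJ_0 VJ_add)

lemma VJ_sc: "X \<in> VJ \<Longrightarrow> sc c * X \<in> VJ"
  by (intro VJ_left N_sc)

lemma VJ_r: "X \<in> VJ \<Longrightarrow> X * r i \<in> VJ"
proof -
  assume X: "X \<in> VJ"
  have "X * (sc c * (E i a b * E j a' b')) = (sc c * X) * E i a b * E j a' b'" for c i j a b a' b'
    by (simp only: sc_left[of X] mult.assoc)
  then show ?thesis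
    unfolding r_def tens_def sum_distrib_left by (intro VJ_sum) (simp only: VJ_sc VJ_E X)
qed

text \<open>Numerical matrices do not lead out of the vacuum, so they may be multiplied from the
  right. This is the only right multiplication available for congruences on the vacuum.\<close>

lemma VJ_H: "Y \<in> H n k \<Longrightarrow> X \<in> VJ \<Longrightarrow> X * Y \<in> VJ"
  by (induction arbitrary: X rule: H.induct)
    (auto simp: sc_comm distrib_left mult.assoc[symmetric] intro: VJ_sc VJ_r VJ_add)

lemma vj_right: "B \<in> H n k \<Longrightarrow> vj X Y \<Longrightarrow> vj (X * B) (Y * B)"
  using VJ_H[of B n k "X - Y"] by (simp add: vj_def left_diff_distrib)

lemma VJ_ptr: "X \<in> VJ \<Longrightarrow> ptr c i X \<in> VJ"
  unfolding ptr_def co_def by (intro VJ_sum VJ_sc VJ_E VJ_left N_E)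

lemma VJ_ptrs: "X \<in> VJ \<Longrightarrow> ptrs c i k X \<in> VJ"
  by (induction k arbitrary: i) (auto intro: VJ_ptr)

lemma ptrs_diff: "ptrs c i k (X - Y) = ptrs c i k X - ptrs c i k Y"
  using ptrs_add[of c i k "X - Y" Y] by simp

lemma vj_ptrs: "vj X Y \<Longrightarrow> vj (ptrs c i k X) (ptrs c i k Y)"
  using VJ_ptrs[of "X - Y"] by (simp add: vj_def ptrs_diff)

text \<open>The base case is the exchange relation \<open>K_M\<close>. Multiplication by
  \<open>rb i * rb (Suc i)\<close> on the left and \<open>r (Suc i) * r i\<close> on the right
  raises all indices by one, which \<open>SJ\<close> tolerates because it is two-sided.\<close>

lemma Ku_Mu: "sj (Ku i * r i * Mu i) (Mu (Suc i) * Ku i * rb i)"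
proof (induction i)
  case 0
  then show ?case using K_M by (simp add: sj_def under_Suc)
next
  case (Suc i)
  let ?j = "Suc i"
  have Kr: "r ?j * Ku i = Ku i * r ?j" "rb ?j * Ku i = Ku i * rb ?j" "r ?j * Mu i = Mu i * r ?j"
    by (auto intro!: r_away_comm rb_away_comm away_under away_M away_K)
  have rbr: "r i * (rb i * Z) = Z" for Z by simp
  have "Ku ?j * r ?j * Mu ?j = rb i * Ku i * (r i * (r ?j * rb i)) * Mu i * r i"
    by (simp only: under_Suc mult.assoc)
  also have "\<dots> = rb i * (Ku i * rb ?j) * r i * (r ?j * Mu i) * r i"
    by (simp only: r_r_rb mult.assoc)
  also have "\<dots> = (rb i * rb ?j) * (Ku i * r i * Mu i) * (r ?j * r i)"
    by (simp only: Kr(2)[symmetric] Kr(3) mult.assoc)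
  finally have 1: "Ku ?j * r ?j * Mu ?j = (rb i * rb ?j) * (Ku i * r i * Mu i) * (r ?j * r i)" .
  have 2: "(rb i * rb ?j) * (Mu ?j * Ku i * rb i) * (r ?j * r i) = Mu (Suc ?j) * Ku ?j * rb ?j"
  proof -
    have "r ?j * r i = r i * (r ?j * (r i * rb ?j))"
      using braid'[of i "rb ?j"] by simp
    then have "rb i * (r ?j * r i) = r ?j * (r i * rb ?j)"
      by (simp only: rb_r')
    then have "(rb i * rb ?j) * (Mu ?j * Ku i * rb i) * (r ?j * r i)
        = rb i * rb ?j * Mu ?j * (Ku i * r ?j) * r i * rb ?j"
      by (simp only: mult.assoc)
    also have "\<dots> = (rb i * Mu (Suc ?j)) * Ku i * r i * rb ?j"
      by (simp only: Kr(1)[symmetric] under_Suc[of _ ?j] mult.assoc)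
    also have "\<dots> = Mu (Suc ?j) * (rb i * Ku i * r i) * rb ?j"
      by (simp only: under_rb[OF away_M] mult.assoc)
    finally show ?thesis by (simp only: under_Suc[of _ i])
  qed
  show ?case
    using sj_mult[OF _ _ Suc.IH, of "rb i * rb ?j" "r ?j * r i"] unfolding 1 2
    by (auto intro: N_intros)
qed

text \<open>Products that write the n-th copy of M as a single conjugation: \<open>U n\<close> is
  \<open>r (n - 1) * ... * r 0\<close> with inverse \<open>Ui n\<close>, and gives the overlined
  copy; \<open>Ub n\<close> is \<open>rb (n - 1) * ... * rb 0\<close> with inverse
  \<open>V 0 n\<close>, and gives the underlined one.\<close>

primrec U :: "nat \<Rightarrow> 'r" where
  "U 0 = 1"
| "U (Suc n) = r n * U n"

primrec Ub :: "nat \<Rightarrow> 'r" where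
  "Ub 0 = 1"
| "Ub (Suc n) = rb n * Ub n"

primrec Ui :: "nat \<Rightarrow> 'r" where
  "Ui 0 = 1"
| "Ui (Suc n) = Ui n * rb n"

lemma U_Ui: "Ui n * U n = 1"
proof (induction n)
  case (Suc n)
  have "Ui (Suc n) * U (Suc n) = Ui n * (rb n * r n) * U n" by (simp only: U.simps Ui.simps mult.assoc)
  then show ?case using Suc by simp
qed simp

lemma Ub_V: "Ub n * V 0 n = 1" "V 0 n * Ub n = 1"
proof (induction n)
  case (Suc n)
  have "V 0 (Suc n) * Ub (Suc n) = V 0 n * (r n * rb n) * Ub n" by (simp only: Ub.simps V.simps mult.assoc add_0)
  then show "V 0 (Suc n) * Ub (Suc n) = 1" using Suc by simp
  have "Ub (Suc n) * V 0 (Suc n) = rb n * (Ub n * V 0 n) * r n" by (simp only: Ub.simps V.simps mult.assoc add_0)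
  then show "Ub (Suc n) * V 0 (Suc n) = 1" using Suc by simp
qed simp_all

lemma Mo_U: "Mo n = U n * M * Ui n"
  by (induction n) (simp_all add: over_Suc mult.assoc)

lemma Mu_Ub: "Mu n = Ub n * M * V 0 n"
  by (induction n) (simp_all add: under_Suc mult.assoc)

lemma Ub_Ui_H: "Ub n * Ui n \<in> H 0 (Suc n)"
proof (rule H_mult)
  have "n < k \<Longrightarrow> Ub n \<in> H 0 k" for k by (induction n) (simp_all add: H_1 H_mult H_rb)
  then show "Ub n \<in> H 0 (Suc n)" by simp
  have "n < k \<Longrightarrow> Ui n \<in> H 0 k" for k by (induction n) (simp_all add: H_1 H_mult H_rb)
  then show "Ui n \<in> H 0 (Suc n)" by simp
qed

lemma N_Ub: "Ub n \<in> N" and N_Ui: "Ui n \<in> N"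
  by (induction n) (auto intro: N_intros)

text \<open>\<open>KK n\<close> does not touch slots n and n + 1, so \<open>r n\<close> passes
  through it. The induction hypothesis then moves M out of \<open>KK n\<close>, and
  \<open>Ku_Mu\<close> moves it past the remaining factor \<open>Ku n\<close>.\<close>

lemma KK_U: "sj (KK n * U n * M) (Mu n * KK n * Ub n)"
proof (induction n)
  case 0
  have "0 \<in> SJ" using SJ_left[OF N_0 K_M] by simp
  then show ?case by (simp add: sj_def)
next
  case (Suc n)
  have r: "r n * KK n = KK n * r n" "rb n * KK n = KK n * rb n"
    by (auto intro!: r_away_comm rb_away_comm away_KK)
  have "KK (Suc n) * U (Suc n) * M = Ku n * (KK n * r n) * U n * M"
    by (simp only: KK_Suc U.simps mult.assoc)
  then have 1: "KK (Suc n) * U (Suc n) * M = Ku n * r n * (KK n * U n * M) * 1"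
    by (simp only: r[symmetric] mult.assoc mult_1_right)
  have "Mu (Suc n) * KK (Suc n) * Ub (Suc n) = Mu (Suc n) * Ku n * (KK n * rb n) * Ub n"
    by (simp only: KK_Suc Ub.simps mult.assoc)
  then have 2: "Mu (Suc n) * KK (Suc n) * Ub (Suc n) = 1 * (Mu (Suc n) * Ku n * rb n) * (KK n * Ub n)"
    by (simp only: r[symmetric] mult.assoc mult_1_left)
  have 3: "sj (Ku n * r n * (KK n * U n * M) * 1) (Ku n * r n * (Mu n * KK n * Ub n) * 1)"
    by (intro sj_mult Suc.IH N_intros)
  have 4: "Ku n * r n * (Mu n * KK n * Ub n) * 1 = 1 * (Ku n * r n * Mu n) * (KK n * Ub n)"
    by (simp add: mult.assoc)
  have 5: "sj (1 * (Ku n * r n * Mu n) * (KK n * Ub n)) (1 * (Mu (Suc n) * Ku n * rb n) * (KK n * Ub n))"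
    by (intro sj_mult Ku_Mu N_intros N_KK N_Ub)
  show ?case
    unfolding 1 2 by (rule sj_trans[OF 3[unfolded 4] 5])
qed

text \<open>Underlined copies are conjugates of K by numerical matrices, so each of them also acts
  on the vacuum as the identity.\<close>

lemma KK_vac: "vj (KK n) 1"
proof (induction n)
  case (Suc n)
  have "vj (Ku n) 1"
  proof (induction n)
    case 0
    show ?case using K_vac by (simp add: vj_def)
  next
    case (Suc n)
    then have "vj (rb n * Ku n * r n) (rb n * 1 * r n)"
      by (intro vj_right[OF H_r[of 0 n "Suc (Suc n)"]] vj_left N_rb) auto
    then show ?case by (simp add: under_Suc)
  qed
  moreover have "vj (Ku n * KK n) (Ku n * 1)"
    by (intro vj_left N_intros Suc.IH)
  ultimately show ?case by (simp add: KK_Suc) (rule vj_trans)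
qed (simp add: vj_refl)

text \<open>After \<open>KK_U\<close> has moved the first factor \<open>Mo n\<close> to the left as
  \<open>Mu n\<close>, the operator \<open>KK n\<close> meets a product shifted by one slot.
  Conjugation by \<open>V n m\<close>, which commutes with \<open>KK n\<close>, brings that product
  back to the induction hypothesis. The new coefficient is \<open>?V * A * ?W * ?a\<close>.\<close>

lemma KK_PM: "\<exists>A\<in>H 0 (n + m). vj (KK n * PM n m) (A * PM n m)"
proof (induction m)
  case 0
  then show ?case using KK_vac by (auto simp: Pi_0[OF away_M] intro: H_1)
next
  case (Suc m)
  then obtain A where A: "A \<in> H 0 (n + m)" "vj (KK n * PM n m) (A * PM n m)" by blast
  let ?V = "V n m" and ?W = "Vi n m" and ?a = "Ub n * Ui n" and ?P = "PM (Suc n) m"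
  have aP: "?a * ?P = ?P * ?a"
    by (rule H_Pi[OF away_M Ub_Ui_H])
  have VP: "?V * PM n m = ?P * ?V"
    by (rule V_Pi[OF away_M]) auto
  have P: "?P = ?V * PM n m * ?W"
    by (simp add: VP mult.assoc)
  have KV: "?V * KK n = KK n * ?V"
    using V_H[of n m "Suc (n + m)"] by (rule H_comm_away) (auto intro: away_KK)
  obtain A' where A': "A' \<in> H (Suc 0) (Suc 0 + (n + m))" "V 0 (n + m) * A = A' * V 0 (n + m)"
    using V_shift[of A 0 "n + m"] A(1) by auto
  have MA: "A' * M = M * A'"
    by (rule H_comm_away[OF A'(1)]) (simp add: away_M)
  have "KK n * PM n (Suc m) = 1 * (KK n * U n * M) * (Ui n * ?P)"
    by (simp add: Pi_Suc[OF away_M] Mo_U mult.assoc)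
  moreover have "sj (1 * (KK n * U n * M) * (Ui n * ?P)) (1 * (Mu n * KK n * Ub n) * (Ui n * ?P))"
    by (intro sj_mult KK_U N_intros N_Ui N_PM)
  ultimately have 1: "vj (KK n * PM n (Suc m)) (1 * (Mu n * KK n * Ub n) * (Ui n * ?P))"
    by (auto intro: sj_vj)
  have "1 * (Mu n * KK n * Ub n) * (Ui n * ?P) = Mu n * KK n * (?a * ?P)"
    by (simp add: mult.assoc)
  also have "\<dots> = Mu n * KK n * (?V * PM n m * ?W * ?a)"
    by (subst aP) (subst P, rule refl)
  also have "\<dots> = Mu n * (KK n * ?V) * PM n m * ?W * ?a"
    by (simp only: mult.assoc)
  also have "\<dots> = Mu n * ?V * (KK n * PM n m) * (?W * ?a)"
    by (simp only: KV[symmetric] mult.assoc)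
  finally have 2: "1 * (Mu n * KK n * Ub n) * (Ui n * ?P) = Mu n * ?V * (KK n * PM n m) * (?W * ?a)" .
  have Wa: "?W * ?a \<in> H 0 (Suc (n + m))"
    by (rule H_mult[OF H_mono[OF Vi_H[of n m "Suc (n + m)"]] H_mono[OF Ub_Ui_H]]) auto
  have V_N: "?V \<in> N" using V_H[of n m "Suc (n + m)"] by (intro N_H) auto
  have 3: "vj (Mu n * ?V * (KK n * PM n m) * (?W * ?a)) (Mu n * ?V * (A * PM n m) * (?W * ?a))"
    by (intro vj_right[OF Wa] vj_left A(2) N_intros V_N)
  \<comment> \<open>Both factors are conjugates by the same braid \<open>V 0 n\<close>:
    \<open>Mu n\<close> of M in slot 0, and \<open>?V * A * ?W\<close> of \<open>A'\<close>, the
    shift of A to the slots from 1 on. These two commute.\<close>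
  have MG: "Mu n * (?V * A * ?W) = (?V * A * ?W) * Mu n"
  proof -
    have S: "V 0 n * ?V = V 0 (n + m)" by (rule V_append)
    have S': "?V = Ub n * V 0 (n + m)"
      by (simp only: S[symmetric] mult.assoc[symmetric] Ub_V mult_1_left)
    have VAW: "?V * A * ?W = Ub n * A' * V 0 n"
    proof -
      have "?V * A * ?W = Ub n * (V 0 (n + m) * A) * ?W" by (simp only: S' mult.assoc)
      also have "\<dots> = Ub n * A' * (V 0 n * ?V * ?W)" by (simp only: A'(2) S mult.assoc)
      finally show ?thesis by (simp add: mult.assoc)
    qed
    have "Mu n * (?V * A * ?W) = Ub n * M * (V 0 n * Ub n) * A' * V 0 n"
      by (subst VAW) (simp only: Mu_Ub mult.assoc)
    also have "\<dots> = Ub n * (M * A') * V 0 n"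
      by (simp only: Ub_V mult_1_right mult.assoc)
    also have "\<dots> = Ub n * A' * (V 0 n * Ub n) * M * V 0 n"
      by (simp only: MA[symmetric] Ub_V mult_1_right mult.assoc mult_1_left)
    also have "\<dots> = (?V * A * ?W) * Mu n"
      by (subst VAW) (simp only: Mu_Ub mult.assoc)
    finally show ?thesis .
  qed
  \<comment> \<open>The element \<open>?a\<close> is the quotient of the two conjugating products;
    it turns the underlined copy back into the overlined one, so that the product of overlined
    copies is complete again.\<close>
  have Ma: "Mu n * ?a = ?a * Mo n"
  proof -
    have "Mu n * ?a = Ub n * M * (V 0 n * Ub n) * Ui n" by (simp only: Mu_Ub mult.assoc)
    also have "\<dots> = Ub n * (Ui n * U n) * M * Ui n" by (simp only: Ub_V U_Ui mult_1_right)
    finally show ?thesis by (simp only: Mo_U mult.assoc)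
  qed
  have "Mu n * ?V * (A * PM n m) * (?W * ?a) = Mu n * ?V * A * (?W * ?V) * PM n m * ?W * ?a"
    by (simp add: mult.assoc)
  also have "\<dots> = (Mu n * (?V * A * ?W)) * (?P * ?a)"
    by (simp only: P mult.assoc)
  also have "\<dots> = ((?V * A * ?W) * Mu n) * (?a * ?P)"
    by (simp only: MG aP[symmetric])
  also have "\<dots> = ?V * A * ?W * (Mu n * ?a) * ?P"
    by (simp only: mult.assoc)
  also have "\<dots> = (?V * A * ?W * ?a) * PM n (Suc m)"
    by (simp only: Ma Pi_Suc[OF away_M] mult.assoc)
  finally have 4: "Mu n * ?V * (A * PM n m) * (?W * ?a) = (?V * A * ?W * ?a) * PM n (Suc m)" .
  have "?V * A * (?W * ?a) \<in> H 0 (n + Suc m)"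
    by (rule H_mult[OF H_mult[OF H_mono[OF V_H[of n m "Suc (n + m)"]] H_mono[OF A(1)]] H_mono[OF Wa]]) auto
  then have "?V * A * ?W * ?a \<in> H 0 (n + Suc m)" by (simp only: mult.assoc)
  moreover have "vj (KK n * PM n (Suc m)) ((?V * A * ?W * ?a) * PM n (Suc m))"
    using vj_trans[OF 1[unfolded 2] 3[unfolded 4]] .
  ultimately show ?case by blast
qed

text \<open>On the vacuum \<open>KK n\<close> is the identity, and the full R-trace of a numerical
  element lies in the algebra on no slots, hence is a scalar.\<close>

lemma casimir_1:
  assumes "Q \<in> H 0 n"
  shows "\<exists>c. vj (ptrs C 0 n (Q * KK n)) (sc c)"
proof -
  have "ptrs C 0 n Q \<in> H 0 0"
    by (rule ptrs_H) (simp add: assms)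
  then obtain c where "ptrs C 0 n Q = sc c"
    using H_scalar by blast
  moreover have "vj (ptrs C 0 n (Q * KK n)) (ptrs C 0 n (Q * 1))"
    by (intro vj_ptrs vj_left N_H[OF assms] KK_vac)
  ultimately show ?thesis by auto
qed

lemma casimir_character:
  assumes Q: "Q \<in> H 0 n" and z: "z \<in> H 0 m"
  shows "\<exists>y\<in>H 0 m. vj (ptrs C 0 n (Q * KK n) * ptrs C 0 m (z * PM 0 m)) (ptrs C 0 m (y * PM 0 m))"
proof -
  obtain z' W W' where *: "z' \<in> H n (n + m)" "W \<in> H 0 (n + m)" "W' \<in> H 0 (n + m)"
    "W * W' = 1" "W' * W = 1" "ptrs C n m (z' * PM n m) = ptrs C 0 m (z * PM 0 m)"
    "PM n m = W * PM 0 m * W'"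
    using shift_character[OF away_M z, of n] by blast
  obtain A where A: "A \<in> H 0 (n + m)" "vj (KK n * PM n m) (A * PM n m)"
    using KK_PM[of n m] by blast
  define Y where "Y = ptrs C 0 m (z * PM 0 m)"
  have Y: "away j Y" for j
  proof (cases "j < m")
    case True
    then show ?thesis unfolding Y_def by (intro away_ptrs_same) auto
  next
    case False
    then show ?thesis
      unfolding Y_def by (intro away_ptrs away_mult H_away[OF z] away_Pi away_M) auto
  qed
  \<comment> \<open>\<open>z'\<close> acts in slots n, ..., n + m - 1 and \<open>KK n\<close> in the
    slots below n. The character was shifted by n slots in order to obtain this separation.\<close>
  have Kz: "z' * KK n = KK n * z'"
    by (rule H_comm_away[OF *(1)]) (simp add: away_KK)
  have "ptrs C 0 n (Q * KK n) * Y = ptrs C 0 n ((Q * KK n) * Y)"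
    by (simp add: ptrs_away_right Y)
  also have "\<dots> = ptrs C 0 n ((Q * KK n) * ptrs C n m (z' * PM n m))"
    by (simp only: Y_def *(6))
  also have "\<dots> = ptrs C 0 n (ptrs C n m ((Q * KK n) * (z' * PM n m)))"
    using Q by (subst ptrs_away_left[where X = "Q * KK n"]) (auto intro!: away_mult away_KK H_away[OF Q])
  also have "\<dots> = ptrs C 0 (n + m) ((Q * z') * (KK n * PM n m))"
  proof -
    have "(Q * KK n) * (z' * PM n m) = Q * (KK n * z') * PM n m" by (simp only: mult.assoc)
    then show ?thesis by (simp only: Kz[symmetric] ptrs_append add_0 mult.assoc)
  qed
  finally have 1: "ptrs C 0 n (Q * KK n) * Y = ptrs C 0 (n + m) ((Q * z') * (KK n * PM n m))" .
  have 2: "vj (ptrs C 0 (n + m) ((Q * z') * (KK n * PM n m))) (ptrs C 0 (n + m) ((Q * z') * (A * PM n m)))"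
    by (intro vj_ptrs vj_left A(2) N_mult N_H[OF Q] N_H[OF *(1)])
  \<comment> \<open>\<open>W\<close> returns the product of copies of M to the first m slots, and
    cyclicity moves \<open>W'\<close> to the front. The last n slots then carry numerical matrices
    only and can be contracted inside the Hecke algebra.\<close>
  define B where "B = W' * (Q * z' * A * W)"
  have QzA: "Q * z' * A * W \<in> H 0 (n + m)"
    using Q *(1,2) A(1) by (intro H_mult) (auto elim: H_mono)
  then have B: "B \<in> H 0 (m + n)"
    unfolding B_def using *(3) by (simp add: H_mult add.commute)
  have "ptrs C 0 (n + m) ((Q * z') * (A * PM n m)) = ptrs C 0 (n + m) ((Q * z' * A * W * PM 0 m) * W')"
    by (simp only: *(7) mult.assoc)
  also have "\<dots> = ptrs C 0 (n + m) (W' * (Q * z' * A * W * PM 0 m))"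
    by (rule ptrs_cyclic[OF *(3), symmetric])
  also have "\<dots> = ptrs C 0 (m + n) (B * PM 0 m)"
    by (simp only: B_def mult.assoc add.commute)
  also have "\<dots> = ptrs C 0 m (ptrs C m n B * PM 0 m)"
    by (simp add: ptrs_append ptrs_away_right away_Pi[OF away_M])
  finally have 3: "ptrs C 0 (n + m) ((Q * z') * (A * PM n m)) = ptrs C 0 m (ptrs C m n B * PM 0 m)" .
  have "ptrs C m n B \<in> H 0 m"
    by (rule ptrs_H[OF B])
  then show ?thesis
    using 2 unfolding 1[unfolded Y_def] 3 by blast
qed

end


section \<open>Consequences of the permutation relations\<close>

context hecke_slots
begin

text \<open>Closed under the operations that extract matrix entries and contract them with numerical
  tensors. Operators into an ideal, operators that annihilate an element and operators with
  reorderable values all form such sets.\<close>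

definition slot_closed :: "'r set \<Rightarrow> bool" where
  "slot_closed L \<longleftrightarrow> 0 \<in> L \<and> (\<forall>X\<in>L. \<forall>Y\<in>L. X + Y \<in> L) \<and>
     (\<forall>X\<in>L. (\<forall>c. sc c * X \<in> L) \<and> (\<forall>i a b. E i a b * X \<in> L \<and> X * E i a b \<in> L))"

lemma slot_closed_sum: "slot_closed L \<Longrightarrow> (\<And>x. x \<in> A \<Longrightarrow> f x \<in> L) \<Longrightarrow> sum f A \<in> L"
  by (induction A rule: infinite_finite_induct) (auto simp: slot_closed_def)

lemma slot_closed_co: "slot_closed L \<Longrightarrow> X \<in> L \<Longrightarrow> co i a b X \<in> L"
  unfolding co_def by (rule slot_closed_sum) (auto simp: slot_closed_def)

text \<open>The counterpart of \<open>kap_r\<close> on the other side: \<Psi> contracts the second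
  slot of R and leaves a matrix unit of the first.\<close>

lemma skew_contract_r:
  "(\<Sum>b\<in>UNIV. \<Sum>d\<in>UNIV. sc (\<Psi> $ (d, x) $ (b, y)) * co (Suc i) b d (r i)) = E i y x"
proof -
  have "(\<Sum>b\<in>UNIV. \<Sum>d\<in>UNIV. sc (\<Psi> $ (d, x) $ (b, y)) * co (Suc i) b d (r i))
    = (\<Sum>b\<in>UNIV. \<Sum>d\<in>UNIV. \<Sum>a\<in>UNIV. \<Sum>c\<in>UNIV.
        sc (R $ (a, b) $ (c, d) * \<Psi> $ (d, x) $ (b, y)) * E i a c)"
    unfolding r_def by (simp add: co_tens_snd sum_distrib_left mult.commute[of "R $ _ $ _"] sc_mult mult.assoc)
  also have "\<dots> = (\<Sum>a\<in>UNIV. \<Sum>c\<in>UNIV. \<Sum>b\<in>UNIV. \<Sum>d\<in>UNIV.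
        sc (R $ (a, b) $ (c, d) * \<Psi> $ (d, x) $ (b, y)) * E i a c)"
    by (rule sum_swap_2_2)
  also have "\<dots> = (\<Sum>a\<in>UNIV. \<Sum>c\<in>UNIV. sc (if a = y \<and> x = c then 1 else 0) * E i a c)"
    by (simp only: sc_sum[symmetric] sum_distrib_right[symmetric] skew_right)
  also have "\<dots> = (\<Sum>a\<in>UNIV. if a = y then \<Sum>c\<in>UNIV. if x = c then E i a c else 0 else 0)"
    by (intro sum.cong refl) (simp add: if_distrib[of sc] mult_delta_left cong: if_cong)
  finally show ?thesis by simp
qed

text \<open>The skew inverse removes a factor \<open>R\<close> standing between two operators.\<close>

lemma co_mult_mem:
  assumes L: "slot_closed L" and mem: "\<And>b d. X * co (Suc i) b d (r i) * Y \<in> L"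
  shows "co i a c X * Y \<in> L"
proof -
  have XEY: "X * E i y x * Y \<in> L" for x y
  proof -
    have "X * E i y x * Y = (\<Sum>b\<in>UNIV. \<Sum>d\<in>UNIV. sc (\<Psi> $ (d, x) $ (b, y)) * (X * co (Suc i) b d (r i) * Y))"
      by (simp add: skew_contract_r[symmetric] sum_distrib_left sum_distrib_right sc_left[of X] mult.assoc)
    also have "\<dots> \<in> L"
      by (intro slot_closed_sum[OF L]) (use L mem in \<open>simp add: slot_closed_def\<close>)
    finally show ?thesis .
  qed
  have "co i a c X * Y = (\<Sum>s\<in>UNIV. co i a c X * E i s s * Y)"
    by (simp add: sum_distrib_left[symmetric] sum_distrib_right[symmetric] E_sum)
  also have "\<dots> = (\<Sum>s\<in>UNIV. E i s a * (X * E i c s * Y))"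
    by (simp add: E_co_E[symmetric] mult.assoc)
  also have "\<dots> \<in> L"
    by (intro slot_closed_sum[OF L]) (use L XEY in \<open>simp add: slot_closed_def\<close>)
  finally show ?thesis .
qed

lemma co_mult_mem':
  assumes "slot_closed L" "away (Suc i) X" "away (Suc i) Y" "X * r i * Y \<in> L"
  shows "co i a c X * Y \<in> L"
proof (rule co_mult_mem[OF assms(1)])
  fix b d
  have "co (Suc i) b d (X * r i * Y) = X * co (Suc i) b d (r i) * Y"
    using assms(2,3) by (simp add: co_away_left co_away_right)
  then show "X * co (Suc i) b d (r i) * Y \<in> L"
    using slot_closed_co[OF assms(1,4), of "Suc i" b d] by simp
qed

end

locale weyl_slots = hecke_slots sc E q R
  for sc :: "complex \<Rightarrow> 'r::ring_1" and E :: "nat \<Rightarrow> 'v::finite \<Rightarrow> 'v \<Rightarrow> 'r"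
    and q :: complex and R :: "'v endo2" +
  fixes M D :: 'r
  assumes away_M: "0 < j \<Longrightarrow> away j M" and away_D: "0 < j \<Longrightarrow> away j D"
    and perm: "D * r 0 * M * r 0 = r 0 * M * rb 0 * D + r 0"
begin

abbreviation "r0 \<equiv> r 0"
abbreviation "r1 \<equiv> r (Suc 0)"
abbreviation "s0 \<equiv> rb 0"
abbreviation "s1 \<equiv> rb (Suc 0)"

text \<open>\<open>P1\<close> and \<open>P2\<close> are the overlined copies of M in slots 1 and 2.
  \<open>Theta\<close> and \<open>Phi\<close> are the defects of the defining relations of D(R^-1)
  and M(R), measured in slots 0 and 1.\<close>

definition "P1 = r0 * M * s0"
definition "P2 = r1 * P1 * s1"
definition "D2 = s0 * D * s0"
definition "Theta = D2 * D - D * D2"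
definition "Phi = r0 * M * r0 * M - M * r0 * M * r0"

lemma P2_over: "P2 = over R M (Suc (Suc 0))"
  by (simp_all add: P1_def P2_def over_Suc)

lemma comm_D: "r1 * D = D * r1" "s1 * D = D * s1" and comm_M: "r1 * M = M * r1" "s1 * M = M * s1"
  by (auto intro!: r_away_comm rb_away_comm away_D away_M)

lemma comm_D': "s1 * (D * Z) = D * (s1 * Z)"
  by (simp only: mult.assoc[symmetric] comm_D)

lemma comm_P2: "r0 * P2 = P2 * r0" "s0 * P2 = P2 * s0"
proof -
  show 1: "r0 * P2 = P2 * r0"
    unfolding P2_over by (rule over_r[OF away_M]) auto
  have "s0 * (r0 * P2) * s0 = s0 * (P2 * r0) * s0" by (simp only: 1)
  then show "s0 * P2 = P2 * s0" by (simp add: mult.assoc)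
qed

lemma comm_P2': "s0 * (P2 * Z) = P2 * (s0 * Z)"
  by (simp only: mult.assoc[symmetric] comm_P2)

lemmas braid_rb_sym = braid_rb[of 0, symmetric] braid_rb'[of 0, symmetric]

lemma D_P1: "D * P1 = P1 * D * s0 * s0 + s0"
proof -
  have "D * P1 = (D * r0 * M * r0) * s0 * s0" by (simp add: P1_def mult.assoc)
  also have "\<dots> = P1 * D * s0 * s0 + s0" by (simp only: perm distrib_right) (simp add: P1_def mult.assoc)
  finally show ?thesis .
qed

lemma D_P2: "D * P2 = P2 * D * (r1 * s0 * s0 * s1) + s0 * s1 * r0"
proof -
  have "D * P2 = r1 * (D * P1) * s1"
    by (simp only: P2_def mult.assoc[symmetric] comm_D)
  also have "\<dots> = r1 * P1 * D * s0 * s0 * s1 + r1 * s0 * s1"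
    by (simp add: D_P1 distrib_left distrib_right mult.assoc)
  also have "r1 * P1 * D * s0 * s0 * s1 = r1 * P1 * (s1 * r1) * D * s0 * s0 * s1"
    by simp
  also have "\<dots> = P2 * (r1 * D) * s0 * s0 * s1"
    by (simp only: P2_def mult.assoc)
  also have "\<dots> = P2 * D * (r1 * s0 * s0 * s1)"
    by (simp only: comm_D mult.assoc)
  also have "r1 * s0 * s1 = s0 * s1 * r0"
    by (simp add: r_rb_rb mult.assoc)
  finally show ?thesis .
qed

lemma x_rb: "(r1 * s0 * s0 * s1) * s0 = s0 * s1 * s1"
proof -
  have "(r1 * s0 * s0 * s1) * s0 = r1 * (s0 * (s0 * (s1 * s0)))" by (simp only: mult.assoc)
  also have "\<dots> = r1 * ((s0 * (s1 * s0)) * s1)" by (simp only: braid_rb) (simp only: braid_rb' mult.assoc)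
  also have "\<dots> = (r1 * s1) * s0 * s1 * s1" by (simp only: braid_rb) (simp only: mult.assoc)
  finally show ?thesis by simp
qed

lemma D2_P2: "D2 * P2 = P2 * D2 * (s1 * s1) + s0 * s0 * s1"
proof -
  have "D2 * P2 = s0 * (D * P2) * s0"
    by (simp only: D2_def mult.assoc comm_P2)
  also have "\<dots> = (s0 * P2) * D * ((r1 * s0 * s0 * s1) * s0) + s0 * s0 * s1 * (r0 * s0)"
    by (simp only: D_P2 distrib_left distrib_right mult.assoc)
  also have "\<dots> = P2 * D2 * (s1 * s1) + s0 * s0 * s1"
    by (simp only: x_rb comm_P2 r_rb mult_1_right) (simp only: D2_def mult.assoc)
  finally show ?thesis .
qed

text \<open>Moving \<open>P2\<close> to the left through either product in \<open>Theta\<close>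
  leaves inhomogeneous terms. The Hecke relation for \<open>r0\<close> in fact 3 and for
  \<open>s0\<close> in fact 4 produces the same multiple of \<open>lam\<close> with opposite signs,
  and what remains is common to both products.\<close>

lemma Theta_P2: "Theta * P2 = P2 * Theta * (s1 * s0 * s0 * s1)"
proof -
  let ?x = "r1 * s0 * s0 * s1" and ?y = "s0 * s1 * r0" and ?j = "s1 * s0 * s0 * s1"
  have bbx: "s1 * s1 * ?x = ?j" and bx: "s1 * ?x = s0 * s0 * s1" and ya: "?y * s0 = s0 * s1"
    by (simp_all add: mult.assoc)
  have "D2 * D * P2 = D2 * (D * P2)" by (simp only: mult.assoc)
  also have "\<dots> = (D2 * P2) * D * ?x + D2 * ?y"
    by (simp only: D_P2 distrib_left mult.assoc)
  also have "\<dots> = P2 * D2 * D * (s1 * s1 * ?x) + s0 * s0 * D * (s1 * ?x) + D2 * ?y"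
    by (simp only: D2_P2 distrib_right) (simp only: comm_D' mult.assoc)
  finally have 1: "D2 * D * P2 = P2 * D2 * D * ?j + s0 * s0 * D * (s0 * s0 * s1) + D2 * ?y"
    unfolding bbx bx .
  have bbabb: "s1 * s1 * s0 * s1 * s1 = s0 * ?j"
    by (simp only: braid_rb_sym mult.assoc)
  have "D * D2 * P2 = D * (D2 * P2)" by (simp only: mult.assoc)
  also have "\<dots> = (D * P2) * D2 * (s1 * s1) + D * s0 * s0 * s1"
    by (simp only: D2_P2 distrib_left mult.assoc)
  also have "\<dots> = P2 * D * (?x * s0) * D * s0 * (s1 * s1) + (?y * s0) * D * s0 * (s1 * s1) + D * s0 * s0 * s1"
    by (simp only: D_P2 distrib_right D2_def mult.assoc)
  also have "\<dots> = P2 * D * s0 * D * (s1 * s1 * s0 * s1 * s1) + s0 * D * (s1 * (s0 * s1)) * s1 + D * s0 * s0 * s1"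
    by (simp only: x_rb ya) (simp only: comm_D' mult.assoc)
  also have "\<dots> = P2 * (D * D2) * ?j + s0 * D * (s1 * (s0 * s1)) * s1 + D * s0 * s0 * s1"
    by (simp only: bbabb) (simp only: D2_def mult.assoc)
  finally have 2: "D * D2 * P2 = P2 * (D * D2) * ?j + s0 * D * (s1 * (s0 * s1)) * s1 + D * s0 * s0 * s1" .
  have "D2 * ?y = s0 * D * (s0 * s0 * s1) * r0"
    by (simp only: D2_def mult.assoc)
  also have "\<dots> = s0 * D * (s0 * s0 * s1) * (s0 + sc lam)"
    by (simp add: rb_eq[of 0])
  also have "\<dots> = s0 * D * s0 * (s0 * (s1 * s0)) + sc lam * (s0 * D * (s0 * s0 * s1))"
    by (simp only: distrib_left sc_comm mult.assoc)
  also have "s0 * D * s0 * (s0 * (s1 * s0)) = s0 * D * (s1 * (s0 * s1)) * s1"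
    by (simp only: braid_rb_sym mult.assoc)
  finally have 3: "D2 * ?y = s0 * D * (s1 * (s0 * s1)) * s1 + sc lam * (s0 * D * (s0 * s0 * s1))" .
  have 4: "s0 * s0 * D * (s0 * s0 * s1) = D * s0 * s0 * s1 - sc lam * (s0 * D * (s0 * s0 * s1))"
  proof -
    have "s0 * s0 * D * X = D * X - sc lam * (s0 * D * X)" for X
      by (simp only: rb_rb left_diff_distrib mult_1_left mult.assoc)
    from this[of "s0 * s0 * s1"] show ?thesis by (simp only: mult.assoc)
  qed
  show ?thesis
    by (simp only: Theta_def left_diff_distrib right_diff_distrib 1 2 3 4) (simp add: mult.assoc)
qed

text \<open>\<open>r0 * r1\<close> carries \<open>Phi * s0\<close> to \<open>L\<close>, the same
  defect formed from \<open>P1\<close> and \<open>P2\<close>. As D moves through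
  \<open>P1 * P2\<close>, its inhomogeneous terms cancel in the commutator with \<open>r1\<close>,
  so D passes \<open>L\<close> up to the numerical factor \<open>?g\<close>.\<close>

lemma D_Phi:
  "D * r0 * r1 * (Phi * s0) = r0 * r1 * (Phi * s0) * (s1 * s0 * D * (r1 * s0 * s0 * s1 * s0 * s0) * r0 * r1)"
proof -
  let ?x = "r1 * s0 * s0 * s1" and ?y = "s0 * s1 * r0"
  let ?g = "?x * s0 * s0" and ?S = "r0 * r1"
  define L where "L = r1 * P1 * P2 - P1 * P2 * r1"
  have ya: "?y * s0 = s0 * s1" by (simp add: mult.assoc)
  have "D * P1 * P2 = (P1 * D * s0 * s0 + s0) * P2"
    by (simp only: D_P1)
  also have "\<dots> = P1 * (D * P2) * s0 * s0 + P2 * s0"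
    by (simp only: distrib_right mult.assoc comm_P2 comm_P2')
  also have "\<dots> = P1 * P2 * D * ?g + P1 * (?y * s0) * s0 + P2 * s0"
    by (simp only: D_P2 distrib_left distrib_right mult.assoc)
  also have "\<dots> = P1 * P2 * D * ?g + P1 * (s0 * (s1 * s0)) + r1 * P1 * s1 * s0"
    by (simp only: ya) (simp only: P2_def mult.assoc)
  finally have DPP: "D * P1 * P2 = P1 * P2 * D * ?g + P1 * (s0 * (s1 * s0)) + r1 * P1 * s1 * s0" .
  \<comment> \<open>By \<open>x_rb\<close> the factor is the Jucys-Murphy type product
    \<open>s0 * s1 * s1 * s0\<close>, which commutes with \<open>s1\<close> by two braid
    moves.\<close>
  have gb: "?g * r1 = r1 * ?g"
  proof -
    have g: "?g = s0 * s1 * s1 * s0" by (simp only: x_rb)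
    have "(s0 * s1 * s1 * s0) * s1 = s0 * (s1 * (s1 * (s0 * s1)))" by (simp only: mult.assoc)
    also have "\<dots> = (s0 * (s1 * s0)) * (s1 * s0)" by (simp only: braid_rb[symmetric] mult.assoc)
    also have "\<dots> = s1 * (s0 * s1 * s1 * s0)" by (simp only: braid_rb mult.assoc)
    finally have "s1 * ?g = ?g * s1" by (simp only: g)
    then show ?thesis
      by (simp add: rb_eq left_diff_distrib right_diff_distrib sc_comm)
  qed
  have "D * L = r1 * (D * P1 * P2) - (D * P1 * P2) * r1"
    by (simp only: L_def right_diff_distrib mult.assoc[symmetric] comm_D)
  also have "\<dots> = r1 * P1 * P2 * D * ?g - P1 * P2 * D * (?g * r1)
      + (r1 * P1 * (s0 * (s1 * s0)) + (r1 * r1) * P1 * s1 * s0 - P1 * (s0 * (s1 * s0)) * r1 - r1 * P1 * s1 * s0 * r1)"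
    unfolding DPP distrib_left distrib_right by (simp add: mult.assoc)
  also have "P1 * P2 * D * (?g * r1) = P1 * P2 * r1 * D * ?g"
    by (simp only: gb) (simp only: mult.assoc[symmetric], simp only: mult.assoc comm_D)
  also have "r1 * P1 * (s0 * (s1 * s0)) + (r1 * r1) * P1 * s1 * s0 - P1 * (s0 * (s1 * s0)) * r1 - r1 * P1 * s1 * s0 * r1 = 0"
  proof -
    have "P1 * (s0 * (s1 * s0)) * r1 = P1 * s1 * s0"
      by (simp add: braid_rb mult.assoc)
    moreover have "r1 * P1 * s1 * s0 * r1 = r1 * P1 * s1 * s0 * (s1 + sc lam)"
      by (simp add: rb_eq[of "Suc 0"])
    then have "r1 * P1 * s1 * s0 * r1 = r1 * P1 * (s0 * (s1 * s0)) + sc lam * (r1 * P1 * s1 * s0)"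
      by (simp only: distrib_left sc_comm braid_rb mult.assoc)
    moreover have "(r1 * r1) * P1 * s1 * s0 = P1 * s1 * s0 + sc lam * (r1 * P1 * s1 * s0)"
      by (simp only: r_r distrib_right mult_1_left mult.assoc)
    ultimately show ?thesis by simp
  qed
  also have "r1 * P1 * P2 * D * ?g - P1 * P2 * r1 * D * ?g + 0 = L * D * ?g"
    by (simp only: L_def left_diff_distrib add_0_right)
  finally have DL: "D * L = L * D * ?g" .
  have Sa: "?S * r0 = r1 * ?S" by (simp add: braid mult.assoc)
  have SM: "?S * M = P1 * ?S" by (simp add: P1_def comm_M mult.assoc)
  have SP: "?S * P1 = P2 * ?S"
  proof -
    have "?S * P1 = r0 * P2 * r1" by (simp add: P2_def mult.assoc)
    then show ?thesis by (simp only: comm_P2 mult.assoc)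
  qed
  have SL: "?S * (Phi * s0) = L * ?S"
  proof -
    have Phi: "Phi * s0 = r0 * M * P1 - M * P1 * r0"
      by (simp add: Phi_def P1_def left_diff_distrib mult.assoc)
    have "?S * (r0 * M * P1) = r1 * P1 * P2 * ?S" "?S * (M * P1 * r0) = P1 * P2 * r1 * ?S"
      using intertwine_mult[OF intertwine_mult[OF Sa SM] SP] intertwine_mult[OF intertwine_mult[OF SM SP] Sa]
      by (simp_all only: mult.assoc)
    then show ?thesis
      by (simp only: Phi L_def right_diff_distrib left_diff_distrib)
  qed
  have "D * r0 * r1 * (Phi * s0) = D * L * ?S"
    by (simp only: SL[symmetric] mult.assoc)
  also have "\<dots> = (L * ?S) * (s1 * s0 * D * ?g * r0 * r1)"
    by (simp add: DL mult.assoc)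
  finally show ?thesis by (simp only: SL[symmetric] mult.assoc)
qed

text \<open>The permutation relations leave one cubic term on each side, M R M R^-1 D R^-1 and R^-1
  M R M D R^-1. Their difference is the defect \<open>Phi\<close> between numerical factors and D,
  so the exchange relation holds modulo the relations of M(R).\<close>

lemma K_M:
  assumes "K = 1 - sc lam * M * D"
  shows "K * r0 * M - s0 * M * r0 * K * s0 = - (sc lam * (s0 * (Phi * (s0 * (D * s0)))))"
proof -
  have DrM: "D * r0 * M = r0 * M * s0 * D * s0 + 1"
  proof -
    have "D * r0 * M = (D * r0 * M * r0) * s0" by (simp add: mult.assoc)
    then show ?thesis by (simp only: perm distrib_right) (simp add: mult.assoc)
  qed
  have "K * r0 * M = r0 * M - sc lam * M * (D * r0 * M)"
    by (simp only: assms left_diff_distrib mult_1_left mult.assoc)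
  \<comment> \<open>The constant term of the permutation relations joins the constant term of K, and
    \<open>r0 - sc lam\<close> is R^-1; this fixes the coefficient of M D in K.\<close>
  also have "\<dots> = (r0 - sc lam) * M - sc lam * (M * r0 * M * s0 * D * s0)"
    by (simp only: DrM) (simp add: distrib_left left_diff_distrib mult.assoc)
  finally have 1: "K * r0 * M = s0 * M - sc lam * (M * r0 * M * s0 * D * s0)"
    by (simp only: rb_eq)
  have 2: "s0 * M * r0 * K * s0 = s0 * M - sc lam * (s0 * M * r0 * M * D * s0)"
    by (simp add: assms right_diff_distrib left_diff_distrib mult.assoc
        sc_left[of "r _"] sc_left[of "rb _"] sc_left[of M])
  have "s0 * (Phi * (s0 * (D * s0))) = M * r0 * M * s0 * D * s0 - s0 * M * r0 * M * D * s0"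
    by (simp add: Phi_def right_diff_distrib left_diff_distrib mult.assoc)
  then show ?thesis
    by (simp only: 1 2 right_diff_distrib) simp
qed

lemma away_Theta: "Suc 0 < j \<Longrightarrow> away j Theta" and away_Phi: "Suc 0 < j \<Longrightarrow> away j Phi"
  unfolding Theta_def D2_def Phi_def
  by (auto intro!: away_diff away_mult away_r away_rb away_D away_M)

text \<open>Since \<open>P2 * r1 * r0 = r1 * r0 * M\<close>, the commutation with \<open>P2\<close>
  becomes a statement about \<open>Theta * r1 * r0 * M\<close>. The skew inverse removes
  \<open>r1\<close> and then \<open>r0\<close>, at the price of passing from \<open>Theta\<close> to
  its entries.\<close>

lemma Theta_M_mem:
  assumes L: "slot_closed L" and P: "P2 * Theta * (s1 * s0 * s0 * s1) * r1 * r0 \<in> L"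
  shows "co 0 c d (co (Suc 0) e f Theta) * M \<in> L"
proof -
  have "P2 * r1 * r0 = r1 * (r0 * M)"
    by (simp add: P2_def P1_def mult.assoc)
  then have "Theta * r1 * (r0 * M) = Theta * P2 * r1 * r0"
    by (simp only: mult.assoc)
  then have "Theta * r1 * (r0 * M) \<in> L"
    using P by (simp only: Theta_P2)
  then have "co (Suc 0) e f Theta * (r0 * M) \<in> L"
    by (rule co_mult_mem'[OF L, rotated 2]) (auto intro!: away_Theta away_mult away_r away_M)
  then have "co (Suc 0) e f Theta * r0 * M \<in> L"
    by (simp only: mult.assoc)
  then show ?thesis
    by (rule co_mult_mem'[OF L, rotated 2]) (auto intro: away_co_same away_M)
qed

lemma D_Phi_mem:
  assumes L: "slot_closed L"
    and P: "r0 * r1 * (Phi * s0) * (s1 * s0 * D * (r1 * s0 * s0 * s1 * s0 * s0) * r0 * r1) \<in> L"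
  shows "co 0 c d D * (Phi * s0) \<in> L"
\<comment> \<open>\<open>Phi\<close> touches slot 1, so \<open>r0\<close> is removed in coordinates;
  these coordinates are what the removal of \<open>r1\<close> through slot 2 supplies.\<close>
proof (rule co_mult_mem[OF L])
  fix e f
  have "D * r0 * r1 * (Phi * s0) \<in> L"
    using D_Phi P by simp
  then have "co (Suc 0) e f (D * r0) * (Phi * s0) \<in> L"
    by (rule co_mult_mem'[OF L, rotated 2]) (auto intro!: away_Phi away_mult away_r away_D away_rb)
  then show "D * co (Suc 0) e f r0 * (Phi * s0) \<in> L"
    by (simp add: co_away_left away_D)
qed

end


section \<open>Free algebras\<close>

lemma word_add [simp]: "letters (u + v) = letters u @ letters v"
  by (simp add: plus_word_def)

lemma letters_0 [simp]: "letters 0 = []"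
  by (simp add: zero_word_def)

lemma const_add: "const (x + y) = const x + const y"
  by (simp add: const_def single_add)

lemma const_mult: "const (x * y) = const x * const y"
  by (simp add: const_def mult_single)

lemma const_1 [simp]: "const 1 = 1" and const_0 [simp]: "const 0 = 0"
  by (simp_all add: const_def)

lemma const_minus: "const (- x) = - const x"
  by (simp add: const_def single_uminus)

lemma sum_monomials: "(\<Sum>w\<in>Poly_Mapping.keys p. Poly_Mapping.single w (Poly_Mapping.lookup p w)) = p"
  by (rule poly_mapping_eqI) (simp add: lookup_sum lookup_single when_def in_keys_iff)

lemma single_eq_const_mult: "Poly_Mapping.single w c = const c * prod_list (map gen (letters w))"
proof -
  have "prod_list (map gen xs) = Poly_Mapping.single (Word xs) 1" for xs :: "'a list"
    by (induction xs) (simp_all add: gen_def mult_single plus_word_def single_one[symmetric] zero_word_def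
        del: single_one)
  then show ?thesis by (simp add: const_def mult_single plus_word_def zero_word_def)
qed

lemma const_central: "x * const c = const c * (x :: 'a falg)"
proof -
  have "Poly_Mapping.single w d * const c = const c * Poly_Mapping.single w d" for w :: "'a word" and d
    by (simp add: const_def mult_single mult.commute)
  then have "(\<Sum>w\<in>Poly_Mapping.keys x. Poly_Mapping.single w (Poly_Mapping.lookup x w)) * const c
      = const c * (\<Sum>w\<in>Poly_Mapping.keys x. Poly_Mapping.single w (Poly_Mapping.lookup x w))"
    by (simp only: sum_distrib_left sum_distrib_right)
  then show ?thesis by (simp only: sum_monomials)
qed

section \<open>Free subalgebras and the ideals generated by relations\<close>

abbreviation "FA A \<equiv> carrier (free_algebra A)"

lemma FA_iff: "p \<in> FA A \<longleftrightarrow> (\<forall>w\<in>Poly_Mapping.keys p. set (letters w) \<subseteq> A)"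
  by (simp add: free_algebra_def)

lemma FA_0 [simp]: "0 \<in> FA A" and FA_const [simp]: "const c \<in> FA A" and FA_1 [simp]: "1 \<in> FA A"
  and FA_gen: "x \<in> A \<Longrightarrow> gen x \<in> FA A" and FA_UNIV [simp]: "p \<in> FA UNIV"
  by (simp_all add: FA_iff const_def gen_def)

lemma FA_add: "p \<in> FA A \<Longrightarrow> p' \<in> FA A \<Longrightarrow> p + p' \<in> FA A"
  unfolding FA_iff using keys_add[of p p'] by blast

lemma FA_mult: "p \<in> FA A \<Longrightarrow> p' \<in> FA A \<Longrightarrow> p * p' \<in> FA A"
  unfolding FA_iff
proof
  fix w assume p: "\<forall>w\<in>Poly_Mapping.keys p. set (letters w) \<subseteq> A" "\<forall>w\<in>Poly_Mapping.keys p'. set (letters w) \<subseteq> A"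
    and "w \<in> Poly_Mapping.keys (p * p')"
  then obtain u v where "w = u + v" "u \<in> Poly_Mapping.keys p" "v \<in> Poly_Mapping.keys p'"
    using keys_mult[of p p'] by blast
  with p show "set (letters w) \<subseteq> A" by simp
qed

lemma FA_minus: "p \<in> FA A \<Longrightarrow> - p \<in> FA A"
  using FA_mult[OF FA_const[of "-1"]] by (simp add: const_minus)

lemma FA_diff: "p \<in> FA A \<Longrightarrow> p' \<in> FA A \<Longrightarrow> p - p' \<in> FA A"
  using FA_add[OF _ FA_minus, of p A p'] by simp

lemma FA_sum: "(\<And>x. x \<in> B \<Longrightarrow> f x \<in> FA A) \<Longrightarrow> sum f B \<in> FA A"
  by (induction B rule: infinite_finite_induct) (auto intro: FA_add)

lemma falg_induct [consumes 1, case_names const gen add mult]: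
  assumes "p \<in> FA A" and const: "\<And>c. P (const c)" and gen: "\<And>x. x \<in> A \<Longrightarrow> P (gen x)"
    and add: "\<And>p p'. p \<in> FA A \<Longrightarrow> p' \<in> FA A \<Longrightarrow> P p \<Longrightarrow> P p' \<Longrightarrow> P (p + p')"
    and mult: "\<And>p p'. p \<in> FA A \<Longrightarrow> p' \<in> FA A \<Longrightarrow> P p \<Longrightarrow> P p' \<Longrightarrow> P (p * p')"
  shows "P p"
proof -
  have word: "set xs \<subseteq> A \<Longrightarrow> P (prod_list (map gen xs)) \<and> prod_list (map gen xs) \<in> FA A" for xs
    using const[of 1] by (induction xs) (auto intro: gen mult FA_mult FA_gen)
  have sum: "P (sum f B) \<and> sum f B \<in> FA A" if "\<And>w. w \<in> B \<Longrightarrow> P (f w) \<and> f w \<in> FA A"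
    for f and B :: "'a word set"
    using that
  proof (induction B rule: infinite_finite_induct)
    case (insert x B)
    then show ?case by (simp add: add FA_add)
  qed (use const[of 0] in simp_all)
  have "P (\<Sum>w\<in>Poly_Mapping.keys p. Poly_Mapping.single w (Poly_Mapping.lookup p w)) \<and>
    (\<Sum>w\<in>Poly_Mapping.keys p. Poly_Mapping.single w (Poly_Mapping.lookup p w)) \<in> FA A"
  proof (rule sum)
    fix w assume "w \<in> Poly_Mapping.keys p"
    then have "set (letters w) \<subseteq> A" using assms(1) by (simp add: FA_iff)
    then show "P (Poly_Mapping.single w (Poly_Mapping.lookup p w)) \<and>
        Poly_Mapping.single w (Poly_Mapping.lookup p w) \<in> FA A"
      using word[of "letters w"] unfolding single_eq_const_mult by (simp add: mult const FA_mult)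
  qed
  then show ?thesis by (simp only: sum_monomials)
qed

lemma free_algebra_simps [simp]:
  "mult (free_algebra A) = (*)" "one (free_algebra A) = 1"
  "zero (free_algebra A) = 0" "add (free_algebra A) = (+)"
  by (simp_all add: free_algebra_def)

lemma ring_free_algebra: "ring (free_algebra A)"
proof (rule ringI)
  show "abelian_group (free_algebra A)"
  proof (rule abelian_groupI)
    fix x assume "x \<in> FA A"
    then show "\<exists>y\<in>FA A. y \<oplus>\<^bsub>free_algebra A\<^esub> x = \<zero>\<^bsub>free_algebra A\<^esub>"
      by (intro bexI[of _ "- x"] FA_minus) auto
  qed (auto simp: FA_add ac_simps)
  show "Group.monoid (free_algebra A)"
    by (rule monoidI) (auto simp: FA_mult mult.assoc)
qed (auto simp: distrib_left distrib_right)

lemma free_algebra_a_inv: "x \<in> FA A \<Longrightarrow> \<ominus>\<^bsub>free_algebra A\<^esub> x = - x"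
proof -
  interpret ring "free_algebra A" by (rule ring_free_algebra)
  assume x: "x \<in> FA A"
  then have "(- x) \<oplus>\<^bsub>free_algebra A\<^esub> x = \<zero>\<^bsub>free_algebra A\<^esub>" by simp
  then show ?thesis using minus_equality x FA_minus by blast
qed

lemma free_algebra_minus: "x \<in> FA A \<Longrightarrow> y \<in> FA A \<Longrightarrow> x \<ominus>\<^bsub>free_algebra A\<^esub> y = x - y"
  by (simp add: a_minus_def free_algebra_a_inv)

lemma ideal_free_algebraI:
  assumes "I \<subseteq> FA A" "0 \<in> I" "\<And>x y. x \<in> I \<Longrightarrow> y \<in> I \<Longrightarrow> x + y \<in> I"
    and l: "\<And>x y. x \<in> I \<Longrightarrow> y \<in> FA A \<Longrightarrow> y * x \<in> I" and "\<And>x y. x \<in> I \<Longrightarrow> y \<in> FA A \<Longrightarrow> x * y \<in> I"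
  shows "ideal I (free_algebra A)"
proof (rule idealI[OF ring_free_algebra])
  interpret ring "free_algebra A" by (rule ring_free_algebra)
  show "subgroup I (add_monoid (free_algebra A))"
  proof (rule group.subgroupI)
    show "Group.group (add_monoid (free_algebra A))" by (rule a_group)
    fix x assume x: "x \<in> I"
    then have "inv\<^bsub>add_monoid (free_algebra A)\<^esub> x = const (- 1) * x"
      using free_algebra_a_inv[of x A] assms(1) by (auto simp: a_inv_def const_minus)
    then show "inv\<^bsub>add_monoid (free_algebra A)\<^esub> x \<in> I"
      using l[OF x FA_const[of "- 1"]] by simp
  qed (use assms in auto)
qed (use assms in auto)

lemma genideal_induct [consumes 2, case_names relation zero add left right]:
  assumes "x \<in> genideal (free_algebra A) S" "S \<subseteq> FA A"
    and "\<And>x. x \<in> S \<Longrightarrow> P x" "P 0" "\<And>x y. P x \<Longrightarrow> P y \<Longrightarrow> P (x + y)"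
    and "\<And>x y. P x \<Longrightarrow> x \<in> FA A \<Longrightarrow> y \<in> FA A \<Longrightarrow> P (y * x)" "\<And>x y. P x \<Longrightarrow> x \<in> FA A \<Longrightarrow> y \<in> FA A \<Longrightarrow> P (x * y)"
  shows "P x"
proof -
  interpret ring "free_algebra A" by (rule ring_free_algebra)
  have "ideal {x \<in> FA A. P x} (free_algebra A)"
    using assms(4-) by (intro ideal_free_algebraI) (auto intro: FA_add FA_mult)
  then have "genideal (free_algebra A) S \<subseteq> {x \<in> FA A. P x}"
    using assms(2,3) by (intro genideal_minimal) auto
  then show ?thesis using assms(1) by auto
qed

locale relations =
  fixes A :: "'a set" and S :: "'a falg set"
  assumes S: "S \<subseteq> FA A"
begin

definition "J = genideal (free_algebra A) S"

lemma ideal_J: "ideal J (free_algebra A)"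
proof -
  interpret ring "free_algebra A" by (rule ring_free_algebra)
  show ?thesis unfolding J_def by (rule genideal_ideal) (use S in simp)
qed

lemma J_FA: "x \<in> J \<Longrightarrow> x \<in> FA A"
  using ideal.Icarr[OF ideal_J] .

lemma J_0: "0 \<in> J" and J_add: "x \<in> J \<Longrightarrow> y \<in> J \<Longrightarrow> x + y \<in> J"
  and J_left: "x \<in> J \<Longrightarrow> y \<in> FA A \<Longrightarrow> y * x \<in> J" and J_right: "x \<in> J \<Longrightarrow> y \<in> FA A \<Longrightarrow> x * y \<in> J"
proof -
  interpret ideal J "free_algebra A" by (rule ideal_J)
  show "0 \<in> J" "x \<in> J \<Longrightarrow> y \<in> J \<Longrightarrow> x + y \<in> J"
    "x \<in> J \<Longrightarrow> y \<in> FA A \<Longrightarrow> y * x \<in> J" "x \<in> J \<Longrightarrow> y \<in> FA A \<Longrightarrow> x * y \<in> J"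
    using additive_subgroup.zero_closed[OF ideal.axioms(1)[OF ideal_J]]
      additive_subgroup.a_closed[OF ideal.axioms(1)[OF ideal_J], of x y]
      I_l_closed[of x y] I_r_closed[of x y] by simp_all
qed

lemma J_S: "x \<in> S \<Longrightarrow> x \<in> J"
proof -
  interpret ring "free_algebra A" by (rule ring_free_algebra)
  show "x \<in> S \<Longrightarrow> x \<in> J" unfolding J_def using genideal_self[of S] S by auto
qed

lemma class_eq_iff:
  "x \<in> FA A \<Longrightarrow> y \<in> FA A \<Longrightarrow> presented_class A S x = presented_class A S y \<longleftrightarrow> x - y \<in> J"
  using ring.quotient_eq_iff_same_a_r_cos[OF ring_free_algebra ideal_J, of x y]
  by (simp add: free_algebra_minus presented_class_def J_def)

lemma class_add:
  "x \<in> FA A \<Longrightarrow> y \<in> FA A \<Longrightarrow>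
    presented_class A S x \<oplus>\<^bsub>presented_algebra A S\<^esub> presented_class A S y = presented_class A S (x + y)"
  using ring_hom_add[OF ideal.rcos_ring_hom[OF ideal_J], of x y]
  by (simp add: presented_class_def presented_algebra_def J_def)

lemma class_mult:
  "x \<in> FA A \<Longrightarrow> y \<in> FA A \<Longrightarrow>
    presented_class A S x \<otimes>\<^bsub>presented_algebra A S\<^esub> presented_class A S y = presented_class A S (x * y)"
  using ring_hom_mult[OF ideal.rcos_ring_hom[OF ideal_J], of x y]
  by (simp add: presented_class_def presented_algebra_def J_def)

lemma carrier_presented: "carrier (presented_algebra A S) = presented_class A S ` FA A"
  by (auto simp: presented_algebra_def presented_class_def FactRing_def A_RCOSETS_def'
      J_def[symmetric])

lemma class_mem:
  assumes "x \<in> FA A" "p \<in> presented_class A S x"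
  shows "p \<in> FA A" "p - x \<in> J"
proof -
  obtain y where "y \<in> J" "p = y + x"
    using assms(2) by (auto simp: presented_class_def J_def[symmetric] a_r_coset_def')
  then show "p \<in> FA A" "p - x \<in> J"
    using J_FA assms(1) by (auto intro: FA_add)
qed

lemma class_self: "x \<in> FA A \<Longrightarrow> x \<in> presented_class A S x"
  using J_0 by (force simp: presented_class_def J_def[symmetric] a_r_coset_def')

end

section \<open>Homomorphisms from a free algebra to the slot ring\<close>

context tensor_slots
begin

definition falg_hom :: "('a \<Rightarrow> 'r) \<Rightarrow> 'a falg \<Rightarrow> 'r" where
  "falg_hom g p = (\<Sum>w\<in>Poly_Mapping.keys p. sc (Poly_Mapping.lookup p w) * prod_list (map g (letters w)))"

lemma falg_hom_superset:
  "finite K \<Longrightarrow> Poly_Mapping.keys p \<subseteq> K \<Longrightarrow>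
    falg_hom g p = (\<Sum>w\<in>K. sc (Poly_Mapping.lookup p w) * prod_list (map g (letters w)))"
  unfolding falg_hom_def by (rule sum.mono_neutral_left) (auto simp: in_keys_iff)

lemma falg_hom_add: "falg_hom g (p + p') = falg_hom g p + falg_hom g p'"
proof -
  let ?K = "Poly_Mapping.keys p \<union> Poly_Mapping.keys p'"
  have "falg_hom g (p + p') = (\<Sum>w\<in>?K. sc (Poly_Mapping.lookup (p + p') w) * prod_list (map g (letters w)))"
    by (intro falg_hom_superset keys_add) simp
  also have "\<dots> = falg_hom g p + falg_hom g p'"
    by (simp add: falg_hom_superset[of ?K] lookup_add sc_add distrib_right sum.distrib)
  finally show ?thesis .
qed

lemma falg_hom_0 [simp]: "falg_hom g 0 = 0"
  by (simp add: falg_hom_def)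

lemma falg_hom_sum: "falg_hom g (sum f B) = (\<Sum>x\<in>B. falg_hom g (f x))"
  by (induction B rule: infinite_finite_induct) (simp_all add: falg_hom_add)

lemma falg_hom_single: "falg_hom g (Poly_Mapping.single w c) = sc c * prod_list (map g (letters w))"
  by (subst falg_hom_superset[of "{w}"]) auto

lemma falg_hom_const [simp]: "falg_hom g (const c) = sc c"
  by (simp add: const_def falg_hom_single)

lemma falg_hom_1 [simp]: "falg_hom g 1 = 1"
  using falg_hom_const[of g 1] by (simp del: falg_hom_const)

lemma falg_hom_gen [simp]: "falg_hom g (gen x) = g x"
  by (simp add: gen_def falg_hom_single)

lemma falg_hom_mult: "falg_hom g (p * p') = falg_hom g p * falg_hom g p'"
proof -
  let ?s = "\<lambda>p w. Poly_Mapping.single w (Poly_Mapping.lookup p w)"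
  have single: "falg_hom g (?s p u * ?s p' v) = falg_hom g (?s p u) * falg_hom g (?s p' v)" for u v
  proof -
    have "(sc x * X) * (sc y * Y) = (sc x * sc y) * (X * Y)" for x y X Y
      by (simp only: mult.assoc sc_left[of X])
    then show ?thesis by (simp add: mult_single falg_hom_single sc_mult)
  qed
  have "falg_hom g ((\<Sum>u\<in>Poly_Mapping.keys p. ?s p u) * (\<Sum>v\<in>Poly_Mapping.keys p'. ?s p' v))
      = falg_hom g (\<Sum>u\<in>Poly_Mapping.keys p. ?s p u) * falg_hom g (\<Sum>v\<in>Poly_Mapping.keys p'. ?s p' v)"
    by (simp only: sum_product falg_hom_sum single)
  then show ?thesis by (simp only: sum_monomials)
qed

lemma falg_hom_diff: "falg_hom g (p - p') = falg_hom g p - falg_hom g p'"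
  using falg_hom_add[of g "p - p'" p'] by simp

lemma falg_hom_away: "(\<And>i x. away i (g x)) \<Longrightarrow> away i (falg_hom g p)"
proof -
  assume g: "\<And>i x. away i (g x)"
  have "away i (prod_list (map g xs))" for xs
    by (induction xs) (simp_all add: g away_mult)
  then show ?thesis
    unfolding falg_hom_def by (intro away_sum away_mult away_sc)
qed

lemma coeff_hom_falg_hom:
  assumes "\<And>i x. away i (g x)"
  shows "coeff_hom (falg_hom g)"
  by (simp add: coeff_hom_def falg_hom_add falg_hom_mult falg_hom_away[of g, OF assms])

lemma opr_mem:
  assumes "0 \<in> L" "\<And>X Y. X \<in> L \<Longrightarrow> Y \<in> L \<Longrightarrow> X + Y \<in> L" "\<And>i a b X. X \<in> L \<Longrightarrow> E i a b * X \<in> L"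
    and "\<And>u v. length u = k \<Longrightarrow> length v = k \<Longrightarrow> h (X u v) \<in> L"
  shows "opr h i k X \<in> L"
  using assms(4)
proof (induction k arbitrary: i X)
  case (Suc k)
  have sum: "(\<And>x. x \<in> B \<Longrightarrow> f x \<in> L) \<Longrightarrow> sum f B \<in> L" for f :: "'v \<Rightarrow> 'r" and B
    by (induction B rule: infinite_finite_induct) (auto intro: assms(1,2))
  show ?case
    unfolding opr.simps by (intro sum assms(3) Suc.IH) (simp add: Suc.prems)
qed simp

lemma co_opr: "coeff_hom h \<Longrightarrow> co i a b (opr h i (Suc k) X) = opr h (Suc i) k (\<lambda>u v. X (a # u) (b # v))"
proof -
  assume h: "coeff_hom h"
  have "co i a b (opr h i (Suc k) X) = (\<Sum>c\<in>UNIV. if a = c then \<Sum>d\<in>UNIV.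
      if b = d then opr h (Suc i) k (\<lambda>u v. X (c # u) (d # v)) else 0 else 0)"
    unfolding opr.simps co_sum
    by (intro sum.cong refl) (auto simp: co_away_right[OF away_opr[OF h lessI]] co_E mult_delta_left)
  then show ?thesis by simp
qed

end


section \<open>The quantum double acting on the free algebra\<close>

context hecke_slots
begin

lemma slot_closed_tens: "slot_closed L \<Longrightarrow> X \<in> L \<Longrightarrow> tens A i j * X \<in> L"
  "slot_closed L \<Longrightarrow> X \<in> L \<Longrightarrow> X * tens A i j \<in> L"
proof -
  assume L: "slot_closed L" "X \<in> L"
  show "tens A i j * X \<in> L"
    unfolding tens_def sum_distrib_right
    by (intro slot_closed_sum[OF L(1)]) (use L in \<open>simp add: slot_closed_def mult.assoc\<close>)
  have "X * (sc c * (E i a b * E j a' b')) = sc c * (X * E i a b * E j a' b')" for c a b a' b'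
    by (simp only: sc_left[of X] mult.assoc)
  then show "X * tens A i j \<in> L"
    unfolding tens_def sum_distrib_left
    by (intro slot_closed_sum[OF L(1)]) (use L in \<open>simp add: slot_closed_def\<close>)
qed

lemma slot_closed_r:
  assumes "slot_closed L" "X \<in> L"
  shows "r i * X \<in> L" "rb i * X \<in> L" "X * r i \<in> L" "X * rb i \<in> L"
  using slot_closed_tens[OF assms] by (simp_all add: r_def rb_def)

lemma co_co_tens: "co 0 a c (co (Suc 0) b d (tens A 0 (Suc 0))) = sc (A $ (a, b) $ (c, d))"
proof -
  have "co 0 a c (co (Suc 0) b d (tens A 0 (Suc 0))) = (\<Sum>a'\<in>UNIV. if a = a' then
      \<Sum>c'\<in>UNIV. if c = c' then sc (A $ (a', b) $ (c', d)) else 0 else 0)"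
    unfolding co_tens_snd[OF n_not_Suc_n] co_sum co_sc co_E
    by (intro sum.cong refl) (auto intro!: sum.cong simp: mult_delta_right)
  then show ?thesis by simp
qed

lemma co_gmat: "(\<And>a b. away 0 (x a b)) \<Longrightarrow> co 0 a b (gmat x) = x a b"
proof -
  assume x: "\<And>a b. away 0 (x a b)"
  have "co 0 a b (gmat x) = (\<Sum>c\<in>UNIV. if a = c then \<Sum>d\<in>UNIV. if b = d then x c d else 0 else 0)"
    unfolding gmat_def co_sum
    by (intro sum.cong refl) (auto simp: co_away_right[OF x] co_E mult_delta_left)
  then show ?thesis by simp
qed

lemma away_gmat: "0 < i \<Longrightarrow> (\<And>a b. away i (x a b)) \<Longrightarrow> away i (gmat x)"
  unfolding gmat_def by (intro away_sum away_mult away_E) auto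

lemma eq_coI:
  assumes "\<And>i p j t. co 0 i p (co (Suc 0) j t X) = co 0 i p (co (Suc 0) j t Y)"
  shows "X = Y"
proof -
  have "co (Suc 0) j t X = co (Suc 0) j t Y" for j t
    by (subst (1 2) co_expand[of _ 0]) (simp only: assms)
  then show ?thesis
    by (subst (1 2) co_expand[of _ "Suc 0"]) simp
qed

lemma inv_R_coords:
  "(\<Sum>c\<in>UNIV. \<Sum>e\<in>UNIV. matrix_inv R $ (p', t') $ (e, c) * R $ (e, c) $ (p, t)) = (if p' = p \<and> t = t' then 1 else 0)"
proof -
  have "(\<Sum>c\<in>UNIV. \<Sum>e\<in>UNIV. matrix_inv R $ (p', t') $ (e, c) * R $ (e, c) $ (p, t))
      = (\<Sum>e\<in>UNIV. \<Sum>c\<in>UNIV. matrix_inv R $ (p', t') $ (e, c) * R $ (e, c) $ (p, t))"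
    by (rule sum.swap)
  also have "\<dots> = (matrix_inv R ** R) $ (p', t') $ (p, t)"
    by (simp add: matrix_matrix_mult_def sum_UNIV_prod)
  finally show ?thesis
    using hecke_inverse[OF hecke] by (auto simp: mat_def)
qed

text \<open>The entry of R_1 M_1 R_1^-1 D_1 + R_1 in rows i, j and columns p, t, with numerical
  factors collected in front.\<close>

definition perm_entry :: "('v \<Rightarrow> 'v \<Rightarrow> 'r) \<Rightarrow> ('v \<Rightarrow> 'v \<Rightarrow> 'r) \<Rightarrow> 'v \<Rightarrow> 'v \<Rightarrow> 'v \<Rightarrow> 'v \<Rightarrow> 'r" where
  "perm_entry m d i j p t = (\<Sum>b\<in>UNIV. \<Sum>e\<in>UNIV. \<Sum>c\<in>UNIV. \<Sum>a\<in>UNIV.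
     sc (R $ (i, j) $ (a, b) * matrix_inv R $ (c, b) $ (e, t)) * (m a c * d e p)) + sc (R $ (i, j) $ (p, t))"

text \<open>The permutation relations solved for the products \<open>\<partial> m\<close> with the help of the skew inverse.\<close>

lemma perm_of_entries:
  assumes away: "\<And>i a b. away i (m a b)" "\<And>i a b. away i (d a b)"
    and dm: "\<And>i y b e. d i y * m b e = (\<Sum>j\<in>UNIV. \<Sum>c\<in>UNIV. sc (\<Psi> $ (c, b) $ (j, y)) *
      (\<Sum>p\<in>UNIV. \<Sum>t\<in>UNIV. sc (matrix_inv R $ (p, t) $ (e, c)) * perm_entry m d i j p t))"
  shows "gmat d * r 0 * gmat m * r 0 = r 0 * gmat m * rb 0 * gmat d + r 0"
proof (rule eq_coI)
  fix i p j t
  let ?S = "matrix_inv R"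
  define g where "g = perm_entry m d i"
  \<comment> \<open>The right side of the permutation relations times R^-1, that is, the value
    required of the entries of D_1 R_1 M_1; \<open>DRM\<close> confirms it by cancelling \<Psi>
    against R.\<close>
  define G where "G j e c = (\<Sum>p\<in>UNIV. \<Sum>t\<in>UNIV. sc (?S $ (p, t) $ (e, c)) * g j p t)" for j e c
  have aw: "away (Suc 0) (gmat m)" "away (Suc 0) (gmat d)"
    by (auto intro!: away_gmat away)
  have DRM: "(\<Sum>b\<in>UNIV. (\<Sum>a\<in>UNIV. d i a * sc (R $ (a, j) $ (b, c))) * m b e) = G j e c" for e c
  proof -
    have "(\<Sum>b\<in>UNIV. (\<Sum>a\<in>UNIV. d i a * sc (R $ (a, j) $ (b, c))) * m b e)
        = (\<Sum>b\<in>UNIV. \<Sum>a\<in>UNIV. sc (R $ (a, j) $ (b, c)) * (d i a * m b e))"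
      by (simp only: sum_distrib_right sc_comm mult.assoc)
    also have "\<dots> = (\<Sum>b\<in>UNIV. \<Sum>a\<in>UNIV. \<Sum>j'\<in>UNIV. \<Sum>c'\<in>UNIV.
        sc (\<Psi> $ (c', b) $ (j', a) * R $ (a, j) $ (b, c)) * G j' e c')"
      unfolding dm g_def[symmetric] G_def[symmetric]
      by (simp only: sum_distrib_left mult.assoc[symmetric] sc_mult[symmetric] mult.commute[of "R $ _ $ _"])
    also have "\<dots> = (\<Sum>j'\<in>UNIV. \<Sum>c'\<in>UNIV. \<Sum>b\<in>UNIV. \<Sum>a\<in>UNIV.
        sc (\<Psi> $ (c', b) $ (j', a) * R $ (a, j) $ (b, c)) * G j' e c')"
      by (rule sum_swap_2_2)
    also have "\<dots> = (\<Sum>j'\<in>UNIV. \<Sum>c'\<in>UNIV. sc (if c' = c \<and> j = j' then 1 else 0) * G j' e c')"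
      by (simp only: sum_distrib_right[symmetric] sc_sum[symmetric] skew_left)
    also have "\<dots> = (\<Sum>j'\<in>UNIV. if j = j' then \<Sum>c'\<in>UNIV. if c' = c then G j' e c' else 0 else 0)"
      by (intro sum.cong refl) (simp add: if_distrib[of sc] mult_delta_left cong: if_cong)
    finally show ?thesis by simp
  qed
  have "co (Suc 0) j t (gmat d * r 0 * gmat m * r 0)
      = (\<Sum>c\<in>UNIV. gmat d * co (Suc 0) j c (r 0) * gmat m * co (Suc 0) c t (r 0))"
    by (simp only: co_mult[of "Suc 0" j t "gmat d * r 0 * gmat m" "r 0"] co_away_right[OF aw(1)] co_away_left[OF aw(2)])
  then have "co 0 i p (co (Suc 0) j t (gmat d * r 0 * gmat m * r 0))
     = (\<Sum>c\<in>UNIV. \<Sum>e\<in>UNIV. (\<Sum>b\<in>UNIV. (\<Sum>a\<in>UNIV. d i a * sc (R $ (a, j) $ (b, c))) * m b e) * sc (R $ (e, c) $ (p, t)))"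
    by (simp add: co_sum co_mult[of 0] co_gmat away r_def co_co_tens)
  also have "\<dots> = (\<Sum>c\<in>UNIV. \<Sum>e\<in>UNIV. \<Sum>p'\<in>UNIV. \<Sum>t'\<in>UNIV.
      sc (?S $ (p', t') $ (e, c) * R $ (e, c) $ (p, t)) * g j p' t')"
    unfolding DRM unfolding G_def
    by (simp only: sum_distrib_right sc_comm[of "_ * _"] mult.assoc[symmetric] sc_mult[symmetric] mult.commute[of "R $ _ $ _"])
  also have "\<dots> = (\<Sum>p'\<in>UNIV. \<Sum>t'\<in>UNIV. \<Sum>c\<in>UNIV. \<Sum>e\<in>UNIV.
      sc (?S $ (p', t') $ (e, c) * R $ (e, c) $ (p, t)) * g j p' t')"
    by (rule sum_swap_2_2)
  also have "\<dots> = (\<Sum>p'\<in>UNIV. \<Sum>t'\<in>UNIV. sc (if p' = p \<and> t = t' then 1 else 0) * g j p' t')"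
    by (simp only: sum_distrib_right[symmetric] sc_sum[symmetric] inv_R_coords)
  also have "\<dots> = (\<Sum>p'\<in>UNIV. if p' = p then \<Sum>t'\<in>UNIV. if t = t' then g j p' t' else 0 else 0)"
    by (intro sum.cong refl) (simp add: if_distrib[of sc] mult_delta_left cong: if_cong)
  finally have 1: "co 0 i p (co (Suc 0) j t (gmat d * r 0 * gmat m * r 0)) = g j p t"
    by simp
  have "co (Suc 0) j t (r 0 * gmat m * rb 0 * gmat d + r 0)
      = (\<Sum>b\<in>UNIV. co (Suc 0) j b (r 0) * gmat m * co (Suc 0) b t (rb 0) * gmat d) + co (Suc 0) j t (r 0)"
    by (simp only: co_add co_away_right[OF aw(2)] co_mult[of "Suc 0" j t "r 0 * gmat m" "rb 0"]
        co_away_right[OF aw(1)] sum_distrib_right)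
  then have "co 0 i p (co (Suc 0) j t (r 0 * gmat m * rb 0 * gmat d + r 0))
     = (\<Sum>b\<in>UNIV. \<Sum>e\<in>UNIV. (\<Sum>c\<in>UNIV. (\<Sum>a\<in>UNIV. sc (R $ (i, j) $ (a, b)) * m a c) * sc (?S $ (c, b) $ (e, t))) * d e p)
       + sc (R $ (i, j) $ (p, t))"
    by (simp add: co_sum co_add co_mult[of 0] co_gmat away r_def rb_def co_co_tens)
  also have "\<dots> = g j p t"
  proof -
    have "sc x * m a c * sc y * d e p = sc (x * y) * (m a c * d e p)" for x y a c e
      by (simp only: sc_mult mult.assoc sc_left[of "m a c"])
    then show ?thesis
      by (simp only: g_def perm_entry_def sum_distrib_right)
  qed
  finally show "co 0 i p (co (Suc 0) j t (gmat d * r 0 * gmat m * r 0))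
      = co 0 i p (co (Suc 0) j t (r 0 * gmat m * rb 0 * gmat d + r 0))"
    by (simp only: 1)
qed

end

section \<open>Linear maps on a free algebra determined by their values on words\<close>

definition lin :: "('a falg \<Rightarrow> 'a falg) \<Rightarrow> bool" where
  "lin T \<longleftrightarrow> (\<forall>x y. T (x + y) = T x + T y) \<and> (\<forall>c x. T (const c * x) = const c * T x)"

lemma const_left: "x * (const c * y) = const c * (x * (y :: 'a falg))"
  by (simp only: mult.assoc[symmetric] const_central)

lemma lin_0: "lin T \<Longrightarrow> T 0 = 0"
proof -
  assume "lin T"
  then have "T (0 + 0) = T 0 + T 0" by (simp only: lin_def)
  then show ?thesis by simp
qed

lemma lin_sum_arg: "lin T \<Longrightarrow> T (sum f A) = (\<Sum>x\<in>A. T (f x))"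
  by (induction A rule: infinite_finite_induct) (auto simp: lin_0, simp add: lin_def)

lemma lin_zero: "lin (\<lambda>x. 0)" and lin_id: "lin (\<lambda>x. x)"
  and lin_add: "lin T \<Longrightarrow> lin U \<Longrightarrow> lin (\<lambda>x. T x + U x)"
  and lin_mult: "lin T \<Longrightarrow> lin (\<lambda>x. z * T x)"
  and lin_comp: "lin T \<Longrightarrow> lin U \<Longrightarrow> lin (\<lambda>x. T (U x))"
  by (simp_all add: lin_def distrib_left const_left ac_simps)

lemma lin_sum: "(\<And>y. y \<in> A \<Longrightarrow> lin (f y)) \<Longrightarrow> lin (\<lambda>x. \<Sum>y\<in>A. f y x)"
  by (induction A rule: infinite_finite_induct) (simp_all add: lin_zero lin_add)

lemma lin_eqI:
  assumes "lin T" "lin U" "\<And>w. T (prod_list (map gen w)) = U (prod_list (map gen w))"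
  shows "T p = U p"
proof -
  have "T (\<Sum>w\<in>Poly_Mapping.keys p. Poly_Mapping.single w (Poly_Mapping.lookup p w))
      = U (\<Sum>w\<in>Poly_Mapping.keys p. Poly_Mapping.single w (Poly_Mapping.lookup p w))"
    unfolding lin_sum_arg[OF assms(1)] lin_sum_arg[OF assms(2)] single_eq_const_mult
    using assms by (simp add: lin_def)
  then show ?thesis by (simp only: sum_monomials)
qed

definition lin_ext :: "('a list \<Rightarrow> 'a falg) \<Rightarrow> 'a falg \<Rightarrow> 'a falg" where
  "lin_ext \<phi> p = (\<Sum>w\<in>Poly_Mapping.keys p. const (Poly_Mapping.lookup p w) * \<phi> (letters w))"

lemma lin_ext_superset:
  "finite K \<Longrightarrow> Poly_Mapping.keys p \<subseteq> K \<Longrightarrow>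
    lin_ext \<phi> p = (\<Sum>w\<in>K. const (Poly_Mapping.lookup p w) * \<phi> (letters w))"
  unfolding lin_ext_def by (rule sum.mono_neutral_left) (auto simp: in_keys_iff)

lemma lookup_const_mult: "Poly_Mapping.lookup (const c * p) w = c * Poly_Mapping.lookup p w"
proof -
  have "Poly_Mapping.lookup (const c * (\<Sum>v\<in>Poly_Mapping.keys p. Poly_Mapping.single v (Poly_Mapping.lookup p v))) w
      = c * Poly_Mapping.lookup (\<Sum>v\<in>Poly_Mapping.keys p. Poly_Mapping.single v (Poly_Mapping.lookup p v)) w"
    by (simp only: sum_distrib_left lookup_sum) (simp add: const_def mult_single lookup_single when_def
        mult_delta_right in_keys_iff)
  then show ?thesis by (simp only: sum_monomials)
qed

lemma lin_lin_ext: "lin (lin_ext \<phi>)"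
  unfolding lin_def
proof (intro conjI allI)
  fix x y :: "'a falg" and c
  let ?K = "Poly_Mapping.keys x \<union> Poly_Mapping.keys y"
  have "lin_ext \<phi> (x + y) = (\<Sum>w\<in>?K. const (Poly_Mapping.lookup (x + y) w) * \<phi> (letters w))"
    by (intro lin_ext_superset keys_add) simp
  then show "lin_ext \<phi> (x + y) = lin_ext \<phi> x + lin_ext \<phi> y"
    by (simp add: lin_ext_superset[of ?K] lookup_add const_add distrib_right sum.distrib)
  have "lin_ext \<phi> (const c * x) = (\<Sum>w\<in>Poly_Mapping.keys x. const (Poly_Mapping.lookup (const c * x) w) * \<phi> (letters w))"
    by (rule lin_ext_superset) (auto simp: in_keys_iff lookup_const_mult)
  then show "lin_ext \<phi> (const c * x) = const c * lin_ext \<phi> x"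
    by (simp add: lookup_const_mult const_mult mult.assoc sum_distrib_left lin_ext_def)
qed

lemma lin_ext_word: "lin_ext \<phi> (prod_list (map gen w)) = \<phi> w"
proof -
  have "prod_list (map gen w) = Poly_Mapping.single (Word w) 1"
    by (simp add: single_eq_const_mult)
  then show ?thesis by (simp add: lin_ext_def)
qed

text \<open>\<open>perm_entry\<close> evaluated at the element x, where d lists the values of all
  derivatives at x.\<close>

definition perm_rhs :: "'v::finite endo2 \<Rightarrow> 'v \<Rightarrow> 'v \<Rightarrow> 'v \<Rightarrow> 'v \<Rightarrow> ('v \<Rightarrow> 'v \<Rightarrow> 'v dgen falg) \<Rightarrow> 'v dgen falg \<Rightarrow> 'v dgen falg" where
  "perm_rhs R i j p t d x = (\<Sum>b\<in>UNIV. \<Sum>e\<in>UNIV. \<Sum>c\<in>UNIV. \<Sum>a\<in>UNIV.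
     const (R $ (i, j) $ (a, b) * matrix_inv R $ (c, b) $ (e, t)) * (M_mat a c * d e p)) + const (R $ (i, j) $ (p, t)) * x"

text \<open>The value of a derivative on \<open>M_mat b e * x\<close>, forced by the permutation
  relations once the values d at x are known.\<close>

definition D_on_M :: "'v::finite endo2 \<Rightarrow> 'v \<Rightarrow> 'v \<Rightarrow> 'v \<Rightarrow> 'v \<Rightarrow> ('v \<Rightarrow> 'v \<Rightarrow> 'v dgen falg) \<Rightarrow> 'v dgen falg \<Rightarrow> 'v dgen falg" where
  "D_on_M R i y b e d x = (\<Sum>j\<in>UNIV. \<Sum>c\<in>UNIV. const (skew_inverse R $ (c, b) $ (j, y)) *
      (\<Sum>p\<in>UNIV. \<Sum>t\<in>UNIV. const (matrix_inv R $ (p, t) $ (e, c)) * perm_rhs R i j p t d x))"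

text \<open>The action of \<open>\<partial>\<^sub>i\<^sup>y\<close>, extended by 0 to the words that begin with a generator of
  \<open>D(R\<^sup>-\<^sup>1)\<close>: then the permutation relations hold exactly.\<close>

primrec del_word :: "'v::finite endo2 \<Rightarrow> 'v dgen list \<Rightarrow> 'v \<Rightarrow> 'v \<Rightarrow> 'v dgen falg" where
  "del_word R [] = (\<lambda>i y. 0)"
| "del_word R (x # w) = (\<lambda>i y. case x of
     MGen b e \<Rightarrow> D_on_M R i y b e (del_word R w) (prod_list (map gen w)) | DGen _ _ \<Rightarrow> 0)"

definition del :: "'v::finite endo2 \<Rightarrow> 'v \<Rightarrow> 'v \<Rightarrow> 'v dgen falg \<Rightarrow> 'v dgen falg" where
  "del R i y = lin_ext (\<lambda>w. del_word R w i y)"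

lemma lin_del: "lin (del R i y)"
  by (simp add: del_def lin_lin_ext)

lemma del_add: "del R i y (p + p') = del R i y p + del R i y p'"
  and del_const_mult: "del R i y (const c * p) = const c * del R i y p"
  using lin_del[of R i y] by (simp_all add: lin_def)

lemma del_0: "del R i y 0 = 0"
  by (rule lin_0[OF lin_del])

lemma lin_D_on_M:
  assumes "\<And>e p. lin (d e p)"
  shows "lin (\<lambda>x. D_on_M R i y b e (\<lambda>e p. d e p x) x)"
  unfolding D_on_M_def perm_rhs_def
  by (intro lin_sum lin_mult lin_add lin_id assms)

lemma del_MGen: "del R i y (gen (MGen b e) * p) = D_on_M R i y b e (\<lambda>i y. del R i y p) p"
proof (rule lin_eqI[where p = p])
  show "lin (\<lambda>p. del R i y (gen (MGen b e) * p))"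
    by (intro lin_comp[OF lin_del] lin_mult lin_id)
  show "lin (\<lambda>p. D_on_M R i y b e (\<lambda>i y. del R i y p) p)"
    by (intro lin_D_on_M lin_del)
  fix w
  show "del R i y (gen (MGen b e) * prod_list (map gen w))
      = D_on_M R i y b e (\<lambda>i y. del R i y (prod_list (map gen w))) (prod_list (map gen w))"
    using lin_ext_word[of "\<lambda>w. del_word R w i y" "MGen b e # w"]
    by (simp add: del_def lin_ext_word)
qed

lemma del_DGen: "del R i y (gen (DGen b e) * p) = 0"
proof (rule lin_eqI[where p = p and U = "\<lambda>p. 0"])
  show "lin (\<lambda>p. del R i y (gen (DGen b e) * p))"
    by (intro lin_comp[OF lin_del] lin_mult lin_id)
  fix w
  show "del R i y (gen (DGen b e) * prod_list (map gen w)) = 0"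
    using lin_ext_word[of "\<lambda>w. del_word R w i y" "DGen b e # w"]
    by (simp add: del_def)
qed (rule lin_zero)

lemma del_1: "del R i y 1 = 0"
  using lin_ext_word[of "\<lambda>w. del_word R w i y" "[]"] by (simp add: del_def)

lemma del_const: "del R i y (const c) = 0"
  using del_const_mult[of R i y c 1] by (simp add: del_1)

lemma M_mat_FA: "M_mat i j \<in> FA M_gens" and D_mat_FA: "D_mat i j \<in> FA D_gens"
  by (auto simp: M_mat_def D_mat_def M_gens_def D_gens_def intro!: FA_gen)

text \<open>Each derivative of a product \<open>M_mat b e * p\<close> is a combination of p and of
  multiples of the derivatives of p. With X the subalgebra generated by M this shows that
  derivatives stay in it; with X the ideal of relations it gives the induction step for left
  multiples.\<close>

lemma del_closed:
  assumes X: "0 \<in> X" "\<And>x y. x \<in> X \<Longrightarrow> y \<in> X \<Longrightarrow> x + y \<in> X" "\<And>x y. x \<in> X \<Longrightarrow> y \<in> FA M_gens \<Longrightarrow> y * x \<in> X"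
    and y: "y \<in> FA M_gens" and p: "p \<in> X" "\<And>i j. del R i j p \<in> X"
  shows "y * p \<in> X \<and> (\<forall>i j. del R i j (y * p) \<in> X)"
  using y p
proof (induction arbitrary: p rule: falg_induct)
  case (const c)
  then show ?case by (simp add: X(3) del_const_mult)
next
  case (gen g)
  then obtain b e where g: "g = MGen b e" by (auto simp: M_gens_def)
  have sum: "(\<And>x. x \<in> B \<Longrightarrow> f x \<in> X) \<Longrightarrow> sum f B \<in> X" for f :: "'a \<Rightarrow> 'a dgen falg" and B
    by (induction B rule: infinite_finite_induct) (auto intro: X(1,2))
  show ?case
    unfolding g del_MGen D_on_M_def perm_rhs_def
    by (intro conjI allI sum X(2,3) gen.prems M_mat_FA FA_const FA_gen) (simp add: M_gens_def)
next
  case (add y y')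
  then show ?case by (simp add: X(2) distrib_right del_add)
next
  case (mult y y')
  then show ?case by (simp add: mult.assoc)
qed

lemma del_FA: "p \<in> FA M_gens \<Longrightarrow> del R i j p \<in> FA M_gens"
  using del_closed[of "FA M_gens" p 1 R] by (auto simp: del_1 FA_add FA_mult)

section \<open>The ring of linear operators\<close>

text \<open>Functions of an infinite index sequence stand in for vectors of an infinite tensor power
  with coefficients in the free algebra. Linearity is required over the constants only, since the
  derivatives are not linear over the free algebra.\<close>

typedef ('v, 'a) fop =
  "{T :: ((nat \<Rightarrow> 'v) \<Rightarrow> 'a falg) \<Rightarrow> ((nat \<Rightarrow> 'v) \<Rightarrow> 'a falg).
    (\<forall>f g. T (\<lambda>s. f s + g s) = (\<lambda>s. T f s + T g s)) \<and>
    (\<forall>c f. T (\<lambda>s. const c * f s) = (\<lambda>s. const c * T f s))}"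
  morphisms app Fop
  by (rule exI[of _ "\<lambda>f. f"]) simp

setup_lifting type_definition_fop

instantiation fop :: (type, type) ring_1
begin

lift_definition zero_fop :: "('a, 'b) fop" is "\<lambda>f s. 0" by simp
lift_definition one_fop :: "('a, 'b) fop" is "\<lambda>f. f" by simp
lift_definition plus_fop :: "('a, 'b) fop \<Rightarrow> ('a, 'b) fop \<Rightarrow> ('a, 'b) fop" is "\<lambda>T U f s. T f s + U f s"
  by (simp add: distrib_left ac_simps)
lift_definition minus_fop :: "('a, 'b) fop \<Rightarrow> ('a, 'b) fop \<Rightarrow> ('a, 'b) fop" is "\<lambda>T U f s. T f s - U f s"
  by (simp add: right_diff_distrib add_diff_add)
lift_definition uminus_fop :: "('a, 'b) fop \<Rightarrow> ('a, 'b) fop" is "\<lambda>T f s. - T f s"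
  by simp
lift_definition times_fop :: "('a, 'b) fop \<Rightarrow> ('a, 'b) fop \<Rightarrow> ('a, 'b) fop" is "\<lambda>T U f. T (U f)"
  by simp

instance
proof
  show "(0 :: ('a, 'b) fop) \<noteq> 1"
    by transfer (auto simp: fun_eq_iff intro: exI[of _ "\<lambda>_. 1"])
qed (transfer; simp add: fun_eq_iff algebra_simps)+

end

lift_definition opsc :: "complex \<Rightarrow> ('v, 'a) fop" is "\<lambda>c f s. const c * f s"
  by (simp add: distrib_left const_left[of "const _"])

lift_definition opE :: "nat \<Rightarrow> 'v \<Rightarrow> 'v \<Rightarrow> ('v, 'a) fop" is
  "\<lambda>i a b f s. if s i = a then f (s(i := b)) else 0"
  by (simp add: fun_eq_iff)

definition lft :: "('a falg \<Rightarrow> 'a falg) \<Rightarrow> ('v, 'a) fop" where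
  "lft T = Fop (\<lambda>f s. T (f s))"

lemma app_lft: "lin T \<Longrightarrow> app (lft T) f s = T (f s)"
  unfolding lft_def by (subst Fop_inverse) (simp_all add: lin_def)

lemma fop_eqI: "(\<And>f s. app x f s = app y f s) \<Longrightarrow> x = y"
  by (simp add: app_inject[symmetric] fun_eq_iff)

lemma app_simps [simp]:
  "app 0 f s = 0" "app 1 f s = f s" "app (x + y) f s = app x f s + app y f s"
  "app (x - y) f s = app x f s - app y f s" "app (x * y) f = app x (app y f)"
  "app (opsc c) f s = const c * f s" "app (opE i a b) f s = (if s i = a then f (s(i := b)) else 0)"
  by (simp_all add: zero_fop.rep_eq one_fop.rep_eq plus_fop.rep_eq minus_fop.rep_eq times_fop.rep_eq
      opsc.rep_eq opE.rep_eq)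

lemma app_arg_add: "app x (\<lambda>s. f s + g s) = (\<lambda>s. app x f s + app x g s)"
  and app_arg_const: "app x (\<lambda>s. const c * f s) = (\<lambda>s. const c * app x f s)"
  using app[of x] by auto

lemma app_arg_0: "app x (\<lambda>s. 0) = (\<lambda>s. 0)"
  using app_arg_const[of x 0 "\<lambda>s. 0"] by simp

lemma app_opsc: "app (opsc c) f = (\<lambda>s. const c * f s)"
  by (simp add: fun_eq_iff)

lemma app_sum: "app (sum g A) f s = (\<Sum>x\<in>A. app (g x) f s)"
  by (induction A rule: infinite_finite_induct) simp_all

lemma tensor_slots_ops: "tensor_slots opsc (opE :: nat \<Rightarrow> 'v::finite \<Rightarrow> 'v \<Rightarrow> ('v, 'a) fop)"
proof
  show "inj (opsc :: complex \<Rightarrow> ('v, 'a) fop)"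
  proof (rule injI)
    fix x y assume "(opsc x :: ('v, 'a) fop) = opsc y"
    then have "app (opsc x :: ('v, 'a) fop) (\<lambda>_. 1) undefined = app (opsc y :: ('v, 'a) fop) (\<lambda>_. 1) undefined"
      by simp
    then have "const x = (const y :: 'a falg)" by simp
    then have "Poly_Mapping.lookup (const x :: 'a falg) 0 = Poly_Mapping.lookup (const y :: 'a falg) 0"
      by simp
    then show "x = y" by (simp add: const_def)
  qed
  show "(\<Sum>a\<in>UNIV. opE i a a) = (1 :: ('v, 'a) fop)" for i
    by (rule fop_eqI) (simp add: app_sum)
qed (auto intro!: fop_eqI simp: const_add const_mult distrib_right mult.assoc app_opsc app_arg_const
    fun_upd_twist const_left[of "const _"])


section \<open>The action on \<open>M(R)\<close>\<close>

lemma tmat_prod_FA: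
  "(\<And>X u v. X \<in> set Xs \<Longrightarrow> X u v \<in> FA A) \<Longrightarrow> tmat_prod k Xs u v \<in> FA A"
proof (induction Xs arbitrary: u v)
  case Nil
  then show ?case by (simp add: tmat_prod_Nil tmat_one_def)
next
  case (Cons X Xs)
  then show ?case
    by (auto simp: tmat_prod_Cons tmat_mult_def intro!: FA_sum FA_mult)
qed

lemma lift_FA: "lift A u v \<in> FA B"
  by (simp add: lift_def)

lemma at1_FA: "(\<And>i j. X i j \<in> FA A) \<Longrightarrow> at1 i X u v \<in> FA A"
  by (simp add: at1_def)

lemma M_relations_FA: "M_relations R \<subseteq> FA M_gens"
  unfolding M_relations_def matrix_relations_def Let_def
  by (auto intro!: FA_diff tmat_prod_FA lift_FA at1_FA M_mat_FA)

lemma matrix_relationsE: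
  assumes "x \<in> matrix_relations k A B"
  obtains u v where "length u = k" "length v = k" "x = A u v - B u v"
  using assms by (auto simp: matrix_relations_def tensor_index_def)

locale quantum_double =
  fixes q :: complex and R :: "'v::finite endo2"
  assumes hecke_R: "hecke_symmetry q R" and skew_R: "skew_invertible R"
begin

sublocale hecke_slots opsc "opE :: nat \<Rightarrow> 'v \<Rightarrow> 'v \<Rightarrow> ('v, 'v dgen) fop" q R
  by (intro hecke_slots.intro hecke_slots_axioms.intro tensor_slots_ops hecke_R skew_R)

sublocale MR: relations M_gens "M_relations R"
  by unfold_locales (rule M_relations_FA)

lemma away_lft: "lin T \<Longrightarrow> away i (lft T)"
  unfolding away_def by (intro allI fop_eqI) (simp add: app_lft lin_0)

definition gop :: "'v dgen \<Rightarrow> ('v, 'v dgen) fop" where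
  "gop g = (case g of MGen i j \<Rightarrow> lft ((*) (gen (MGen i j))) | DGen i j \<Rightarrow> lft (del R i j))"

definition h :: "'v dgen falg \<Rightarrow> ('v, 'v dgen) fop" where
  "h = falg_hom gop"

lemma lin_left: "lin ((*) x)"
  using lin_mult[OF lin_id, of x] .

lemma app_gop: "app (gop (MGen i j)) f s = gen (MGen i j) * f s" "app (gop (DGen i j)) f s = del R i j (f s)"
  by (simp_all add: gop_def app_lft lin_left lin_del)

lemma away_gop: "away i (gop g)"
  by (cases g) (simp_all add: gop_def away_lft lin_left lin_del)

lemma h_hom: "coeff_hom h"
  unfolding h_def by (rule coeff_hom_falg_hom) (rule away_gop)

lemma h_simps [simp]: "h (const c) = opsc c" "h (gen g) = gop g" "h (x + y) = h x + h y"
  "h (x - y) = h x - h y" "h (x * y) = h x * h y" "h 1 = 1" "h 0 = 0"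
  by (simp_all add: h_def falg_hom_add falg_hom_diff falg_hom_mult)

lemma h_sum: "h (sum f A) = (\<Sum>x\<in>A. h (f x))"
  by (rule coeff_hom_sum[OF h_hom])

lemma away_h: "away i (h x)"
  using h_hom by (simp add: coeff_hom_def)

lemma app_h_M: "p \<in> FA M_gens \<Longrightarrow> app (h p) f s = p * f s"
proof (induction arbitrary: f s rule: falg_induct)
  case (gen x)
  then show ?case by (auto simp: M_gens_def app_gop)
qed (simp_all add: distrib_right mult.assoc)

definition Mop where "Mop = gmat (\<lambda>a b. h (M_mat a b))"
definition Dop where "Dop = gmat (\<lambda>a b. h (D_mat a b))"

lemma app_mat: "app (h (M_mat a b)) f s = M_mat a b * f s" "app (h (D_mat a b)) f s = del R a b (f s)"
  by (simp_all add: M_mat_def D_mat_def app_gop)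

text \<open>The derivatives were defined by the solved relations, so \<open>del_MGen\<close>, read
  as an identity of operators, is the hypothesis of \<open>perm_of_entries\<close>.\<close>

lemma perm_op: "Dop * r 0 * Mop * r 0 = r 0 * Mop * rb 0 * Dop + r 0"
  unfolding Mop_def Dop_def
proof (rule perm_of_entries)
  fix i y b e
  show "h (D_mat i y) * h (M_mat b e) = (\<Sum>j\<in>UNIV. \<Sum>c\<in>UNIV. opsc (\<Psi> $ (c, b) $ (j, y)) *
      (\<Sum>p\<in>UNIV. \<Sum>t\<in>UNIV. opsc (matrix_inv R $ (p, t) $ (e, c)) *
        perm_entry (\<lambda>a b. h (M_mat a b)) (\<lambda>a b. h (D_mat a b)) i j p t))"
  proof (rule fop_eqI)
    fix f s
    have "app (perm_entry (\<lambda>a b. h (M_mat a b)) (\<lambda>a b. h (D_mat a b)) i j p t) f s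
        = perm_rhs R i j p t (\<lambda>i y. del R i y (f s)) (f s)" for j p t
      by (simp add: perm_entry_def perm_rhs_def app_sum app_mat)
    then show "app (h (D_mat i y) * h (M_mat b e)) f s = app (\<Sum>j\<in>UNIV. \<Sum>c\<in>UNIV. opsc (\<Psi> $ (c, b) $ (j, y)) *
      (\<Sum>p\<in>UNIV. \<Sum>t\<in>UNIV. opsc (matrix_inv R $ (p, t) $ (e, c)) *
        perm_entry (\<lambda>a b. h (M_mat a b)) (\<lambda>a b. h (D_mat a b)) i j p t)) f s"
      by (simp add: app_sum app_mat) (simp add: M_mat_def del_MGen D_on_M_def)
  qed
qed (rule away_h)+

lemma away_ops: "0 < j \<Longrightarrow> away j Mop" "0 < j \<Longrightarrow> away j Dop"
  unfolding Mop_def Dop_def by (auto intro: away_gmat away_h)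

sublocale weyl_slots opsc opE q R Mop Dop
  by unfold_locales (auto intro: away_ops perm_op)

lemma opr_basic:
  "opr h 0 2 (lift (at2 1 A)) = tens A 0 (Suc 0)"
  "opr h 0 2 (at1 1 M_mat) = Mop" "opr h 0 2 (at1 1 D_mat) = Dop"
  using opr_at2'[of 0 2 A] opr_at1[OF h_hom, of 0 "Suc 0" M_mat] opr_at1[OF h_hom, of 0 "Suc 0" D_mat]
  by (simp_all add: opr_lift Mop_def Dop_def gmat_def numeral_2_eq_2 del: opr.simps)

lemma opr_tmat_prod_diff:
  "opr h 0 2 (\<lambda>u v. tmat_prod 2 Xs u v - tmat_prod 2 Ys u v)
    = prod_list (map (opr h 0 2) Xs) - prod_list (map (opr h 0 2) Ys)"
  by (simp only: opr_diff[OF h_hom] opr_prod[OF h_hom])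

lemma opr_entry:
  assumes "length u = 2" "length v = 2"
  shows "co (Suc 0) (u ! 1) (v ! 1) (co 0 (u ! 0) (v ! 0) (opr h 0 2 X)) = h (X u v)"
proof -
  obtain a b a' b' where "u = [a, b]" "v = [a', b']"
    using assms by (auto simp: numeral_2_eq_2 length_Suc_conv)
  then show ?thesis
    by (simp add: numeral_2_eq_2 co_opr[OF h_hom] del: opr.simps(2))
qed

definition mval :: "((nat \<Rightarrow> 'v) \<Rightarrow> 'v dgen falg) \<Rightarrow> bool" where "mval f \<longleftrightarrow> (\<forall>s. f s \<in> FA M_gens)"
definition jval :: "((nat \<Rightarrow> 'v) \<Rightarrow> 'v dgen falg) \<Rightarrow> bool" where "jval f \<longleftrightarrow> (\<forall>s. f s \<in> MR.J)"

definition SJ :: "('v, 'v dgen) fop set" where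
  "SJ = {X. \<forall>f. mval f \<longrightarrow> jval (app X f)}"
definition N :: "('v, 'v dgen) fop set" where
  "N = {X. \<forall>f. (mval f \<longrightarrow> mval (app X f)) \<and> (jval f \<longrightarrow> jval (app X f))}"
text \<open>The vacuum comprises all scalar-valued functions of the index sequence and not only the
  constant 1, since matrix units turn constant functions into nonconstant ones.\<close>

definition VJ :: "('v, 'v dgen) fop set" where
  "VJ = {X. \<forall>\<phi>. jval (app X (\<lambda>s. const (\<phi> s)))}"

lemma mval_E: "mval f \<Longrightarrow> mval (app (opE i a b) f)" and jval_E: "jval f \<Longrightarrow> jval (app (opE i a b) f)"
  by (simp_all add: mval_def jval_def MR.J_0)

lemma mval_sc: "mval f \<Longrightarrow> mval (app (opsc c) f)" and jval_sc: "jval f \<Longrightarrow> jval (app (opsc c) f)"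
  by (simp_all add: mval_def jval_def MR.J_left FA_mult)

lemma slot_closed_SJ: "slot_closed SJ"
  by (auto simp: slot_closed_def SJ_def mval_E jval_E jval_sc)
    (simp_all add: jval_def MR.J_0 MR.J_add)

lemma D_mval: "mval f \<Longrightarrow> mval (app Dop f)"
  unfolding Dop_def gmat_def by (auto simp: mval_def app_sum app_mat intro!: FA_sum del_FA)

lemma Phi_SJ: "Phi \<in> SJ"
proof -
  let ?A = "tmat_prod 2 [lift (at2 1 R), at1 1 M_mat, lift (at2 1 R), at1 1 M_mat]"
  let ?B = "tmat_prod 2 [at1 1 M_mat, lift (at2 1 R), at1 1 M_mat, lift (at2 1 R)]"
  have "opr h 0 2 (\<lambda>u v. ?A u v - ?B u v) = Phi"
    unfolding opr_tmat_prod_diff by (simp add: opr_basic[simplified] Phi_def r_def mult.assoc)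
  moreover have "opr h 0 2 (\<lambda>u v. ?A u v - ?B u v) \<in> SJ"
  proof (rule opr_mem)
    fix u v :: "'v list" assume "length u = 2" "length v = 2"
    then have "?A u v - ?B u v \<in> M_relations R"
      by (auto simp: M_relations_def Let_def matrix_relations_def tensor_index_def)
    then have J: "?A u v - ?B u v \<in> MR.J" "?A u v - ?B u v \<in> FA M_gens"
      using MR.J_S MR.J_FA by blast+
    then show "h (?A u v - ?B u v) \<in> SJ"
      unfolding SJ_def jval_def mval_def using app_h_M[OF J(2)] by (simp add: MR.J_right del: h_simps)
  qed (use slot_closed_SJ in \<open>auto simp: slot_closed_def\<close>)
  ultimately show ?thesis by simp
qed

lemma SJ_D: "X \<in> SJ \<Longrightarrow> X * Dop \<in> SJ"
  by (simp add: SJ_def D_mval)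

text \<open>By \<open>D_Phi\<close>, D to the left of \<open>Phi\<close> becomes, up to numerical
  factors, D to its right, where it does no harm because derivatives preserve the free algebra of M.
  \<open>D_Phi_mem\<close> extracts the single entries of D.\<close>

lemma del_relation:
  assumes "x \<in> M_relations R" "p \<in> FA M_gens"
  shows "del R i j (x * p) \<in> MR.J"
proof -
  let ?A = "tmat_prod 2 [lift (at2 1 R), at1 1 M_mat, lift (at2 1 R), at1 1 M_mat]"
  let ?B = "tmat_prod 2 [at1 1 M_mat, lift (at2 1 R), at1 1 M_mat, lift (at2 1 R)]"
  note sl = slot_closed_r[OF slot_closed_SJ]
  have "co 0 i j Dop * (Phi * s0) \<in> SJ"
  proof (rule D_Phi_mem[OF slot_closed_SJ])
    have "r0 * r1 * Phi \<in> SJ"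
      unfolding mult.assoc by (intro sl Phi_SJ)
    then show "r0 * r1 * (Phi * s0) * (s1 * s0 * Dop * (r1 * s0 * s0 * s1 * s0 * s0) * r0 * r1) \<in> SJ"
      unfolding mult.assoc[symmetric] by (intro sl SJ_D)
  qed
  then have "co 0 i j Dop * (Phi * s0) * r0 \<in> SJ"
    by (rule sl)
  then have "h (D_mat i j) * Phi \<in> SJ"
    by (simp add: mult.assoc Dop_def co_gmat away_h)
  obtain u v where uv: "length u = 2" "length v = 2" "x = ?A u v - ?B u v"
    using assms(1) by (auto simp: M_relations_def Let_def elim: matrix_relationsE)
  have "opr h 0 2 (\<lambda>u v. ?A u v - ?B u v) = Phi"
    unfolding opr_tmat_prod_diff by (simp add: opr_basic[simplified] Phi_def r_def mult.assoc)
  then have hx: "h x = co (Suc 0) (u ! 1) (v ! 1) (co 0 (u ! 0) (v ! 0) Phi)"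
    using opr_entry[OF uv(1,2), of "\<lambda>u v. ?A u v - ?B u v"] uv(3) by simp
  have "co (Suc 0) (u ! 1) (v ! 1) (co 0 (u ! 0) (v ! 0) (h (D_mat i j) * Phi)) \<in> SJ"
    by (intro slot_closed_co[OF slot_closed_SJ]) fact
  then have "h (D_mat i j) * h x \<in> SJ"
    by (simp add: co_away_left away_h hx)
  then have "jval (app (h (D_mat i j) * h x) (\<lambda>s. p))"
    using assms(2) by (simp add: SJ_def mval_def)
  moreover have "x \<in> FA M_gens"
    using assms(1) M_relations_FA by blast
  ultimately show ?thesis
    by (simp add: jval_def app_mat app_h_M)
qed

lemma del_J: "p \<in> MR.J \<Longrightarrow> del R i j p \<in> MR.J"
proof -
  assume p: "p \<in> MR.J"
  \<comment> \<open>A derivative of \<open>x * a\<close> is not determined by derivatives of x and a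
    through a Leibniz rule; quantifying over the right factor makes the claim stable under right
    multiplication.\<close>
  define P where "P x \<longleftrightarrow> x \<in> MR.J \<and> (\<forall>a\<in>FA M_gens. \<forall>i j. del R i j (x * a) \<in> MR.J)" for x
  have "P p"
    using p[unfolded MR.J_def] M_relations_FA
  proof (induction rule: genideal_induct)
    case (relation x)
    then show ?case by (simp add: P_def MR.J_S del_relation)
  next
    case zero
    show ?case by (simp add: P_def MR.J_0 del_0)
  next
    case (add x y)
    then show ?case by (simp add: P_def MR.J_add distrib_right del_add)
  next
    case (left x y)
    have "y * (x * a) \<in> MR.J \<and> (\<forall>i j. del R i j (y * (x * a)) \<in> MR.J)" if "a \<in> FA M_gens" for a
      using left that
      by (intro del_closed[where X = MR.J and p = "x * a"])
        (simp_all add: P_def MR.J_0 MR.J_add MR.J_left MR.J_right)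
    then show ?case
      using left by (simp add: P_def MR.J_left mult.assoc)
  next
    case (right x y)
    then show ?case by (simp add: P_def MR.J_right mult.assoc FA_mult)
  qed
  then have "\<forall>i j. del R i j (p * 1) \<in> MR.J"
    unfolding P_def using FA_1 by blast
  then show ?thesis by simp
qed

text \<open>The scalars may vary with the index sequence, which makes the set stable under numerical
  matrices on the right.\<close>

definition killed :: "'v dgen falg \<Rightarrow> ('v, 'v dgen) fop set" where
  "killed p = {X. \<forall>\<phi>. app X (\<lambda>s. const (\<phi> s) * p) = (\<lambda>s. 0)}"

lemma killed_left: "Y \<in> killed p \<Longrightarrow> X * Y \<in> killed p"
  by (simp add: killed_def app_arg_0)

lemma slot_closed_killed: "slot_closed (killed p)"
proof -
  have "X * opE i a b \<in> killed p" if "X \<in> killed p" for X i a b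
  proof -
    have "app (opE i a b) (\<lambda>s. const (\<phi> s) * p) = (\<lambda>s. const (if s i = a then \<phi> (s(i := b)) else 0) * p)" for \<phi>
      by (simp add: fun_eq_iff)
    then show ?thesis using that by (simp add: killed_def)
  qed
  then show ?thesis
    by (auto simp: slot_closed_def killed_left) (simp_all add: killed_def fun_eq_iff)
qed

lemma Theta_killed_D: "Dop \<in> killed p \<Longrightarrow> Theta \<in> killed p"
proof -
  assume D: "Dop \<in> killed p"
  have "D2 * Dop \<in> killed p" "Dop * s0 * (Dop * s0) \<in> killed p"
    by (intro killed_left slot_closed_r[OF slot_closed_killed] D)+
  then have "D2 * Dop - Dop * s0 * (Dop * s0) \<in> killed p"
    by (simp add: killed_def fun_eq_iff)
  then show ?thesis by (simp add: Theta_def D2_def mult.assoc)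
qed

lemma Dop_killed: "(\<And>i j c. del R i j (const c * p) = 0) \<Longrightarrow> Dop \<in> killed p"
  unfolding Dop_def gmat_def
  by (intro slot_closed_sum[OF slot_closed_killed] killed_left) (simp add: killed_def fun_eq_iff app_mat)

text \<open>Induction on the word. D kills constants and, by construction, words beginning with a
  generator of D(R^-1); \<open>Theta_M_mem\<close> passes from a word to the word with one more
  generator of M(R) in front.\<close>

lemma Theta_killed: "Theta \<in> killed (prod_list (map gen w))"
proof (induction w)
  case Nil
  then show ?case by (intro Theta_killed_D Dop_killed) (simp add: del_const)
next
  case (Cons g w)
  let ?p = "prod_list (map gen w)"
  show ?case
  proof (cases g)
    case (DGen b e)
    then show ?thesis
      by (intro Theta_killed_D Dop_killed) (simp add: del_const_mult del_DGen)
  next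
    case (MGen b e)
    let ?m = "h (M_mat b e)"
    \<comment> \<open>The induction hypothesis for \<open>Theta\<close> survives numerical factors
      on the right and any operator, here \<open>P2\<close>, on the left.\<close>
    have "P2 * Theta * (s1 * s0 * s0 * s1) * r1 * r0 \<in> killed ?p"
      unfolding mult.assoc[symmetric]
      by (intro slot_closed_r[OF slot_closed_killed] killed_left Cons)
    then have "co 0 c d (co (Suc 0) e' f Theta) * Mop \<in> killed ?p" for c d e' f
      by (rule Theta_M_mem[OF slot_closed_killed])
    then have "co 0 b e (co 0 c d (co (Suc 0) e' f Theta) * Mop) \<in> killed ?p" for c d e' f
      by (rule slot_closed_co[OF slot_closed_killed])
    then have 1: "co 0 c d (co (Suc 0) e' f Theta) * ?m \<in> killed ?p" for c d e' f
      by (simp add: co_away_left away_co_same Mop_def co_gmat away_h)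
    have 2: "co (Suc 0) e' f Theta * ?m \<in> killed ?p" for e' f
    proof -
      have "co (Suc 0) e' f Theta * ?m = (\<Sum>c\<in>UNIV. \<Sum>d\<in>UNIV. co 0 c d (co (Suc 0) e' f Theta) * ?m * opE 0 c d)"
        by (subst co_expand[of "co (Suc 0) e' f Theta" 0])
          (simp only: sum_distrib_right mult.assoc awayD[OF away_h])
      also have "\<dots> \<in> killed ?p"
        by (intro slot_closed_sum[OF slot_closed_killed]) (use 1 slot_closed_killed in \<open>simp add: slot_closed_def\<close>)
      finally show ?thesis .
    qed
    have "Theta * ?m = (\<Sum>c\<in>UNIV. \<Sum>d\<in>UNIV. co (Suc 0) c d Theta * ?m * opE (Suc 0) c d)"
      by (subst co_expand[of Theta "Suc 0"]) (simp only: sum_distrib_right mult.assoc awayD[OF away_h])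
    also have "\<dots> \<in> killed ?p"
      by (intro slot_closed_sum[OF slot_closed_killed]) (use 2 slot_closed_killed in \<open>simp add: slot_closed_def\<close>)
    finally have "Theta * ?m \<in> killed ?p" .
    moreover have "app ?m (\<lambda>s. const (\<phi> s) * ?p) = (\<lambda>s. const (\<phi> s) * (M_mat b e * ?p))" for \<phi>
      by (simp add: fun_eq_iff app_mat const_left)
    ultimately show ?thesis
      using MGen by (simp add: killed_def M_mat_def)
  qed
qed

text \<open>\<open>h p\<close> acts separately at each index sequence (\<open>app_h\<close>), so its
  values on constant functions at one arbitrary sequence determine it.\<close>

definition act :: "'v dgen falg \<Rightarrow> 'v dgen falg \<Rightarrow> 'v dgen falg" where
  "act p x = app (h p) (\<lambda>s. x) undefined"

lemma app_h: "app (h p) f s = act p (f s)"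
proof -
  have "p \<in> FA UNIV" by simp
  then have "\<forall>f s. app (h p) f s = app (h p) (\<lambda>_. f s) undefined"
  proof (induction rule: falg_induct)
    case (gen g)
    then show ?case by (cases g rule: dgen.exhaust) (simp_all add: app_gop)
  next
    case (add p p')
    show ?case
    proof (intro allI)
      fix f :: "(nat \<Rightarrow> 'v) \<Rightarrow> 'v dgen falg" and s
      show "app (h (p + p')) f s = app (h (p + p')) (\<lambda>_. f s) undefined"
        unfolding h_simps app_simps by (intro arg_cong2[where f = "(+)"] add.IH[rule_format])
    qed
  next
    case (mult p p')
    show ?case
    proof (intro allI)
      fix f :: "(nat \<Rightarrow> 'v) \<Rightarrow> 'v dgen falg" and s
      have "app (h p) (app (h p') (\<lambda>_. f s)) undefined = app (h p) (\<lambda>_. app (h p') (\<lambda>_. f s) undefined) undefined"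
        by (rule mult.IH(1)[rule_format])
      moreover have "app (h p) (app (h p') f) s = app (h p) (\<lambda>_. app (h p') f s) undefined"
        by (rule mult.IH(1)[rule_format])
      moreover have "app (h p') f s = app (h p') (\<lambda>_. f s) undefined"
        by (rule mult.IH(2)[rule_format])
      ultimately show "app (h (p * p')) f s = app (h (p * p')) (\<lambda>_. f s) undefined"
        unfolding h_simps app_simps by (simp only:)
    qed
  qed simp
  then show ?thesis by (simp add: act_def)
qed

lemma act_simps: "act (p + p') x = act p x + act p' x" "act (p - p') x = act p x - act p' x"
  "act (p * p') x = act p (act p' x)" "act (const c) x = const c * x" "act 1 x = x" "act 0 x = 0"
proof -
  show "act (p * p') x = act p (act p' x)"
    using app_h[of p "app (h p') (\<lambda>s. x)" undefined] by (simp add: act_def)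
qed (simp_all add: act_def)

lemma act_add: "act p (x + y) = act p x + act p y"
  using app_arg_add[of "h p" "\<lambda>_. x" "\<lambda>_. y"] by (simp add: act_def)

lemma act_const: "act p (const c * x) = const c * act p x"
  using app_arg_const[of "h p" c "\<lambda>_. x"] by (simp add: act_def)

lemma act_diff: "act p (x - y) = act p x - act p y"
  using act_add[of p "x - y" y] by simp

lemma lin_act: "lin (act p)"
  by (simp add: lin_def act_add act_const)

lemma act_M: "p \<in> FA M_gens \<Longrightarrow> act p x = p * x"
  by (simp add: act_def app_h_M)

lemma act_D_mat: "act (D_mat i j) x = del R i j x"
  by (simp add: act_def app_mat)

lemma act_FA: "x \<in> FA M_gens \<Longrightarrow> act p x \<in> FA M_gens" and act_J: "x \<in> MR.J \<Longrightarrow> act p x \<in> MR.J"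
proof -
  have "p \<in> FA UNIV" by simp
  then have "\<forall>x. (x \<in> FA M_gens \<longrightarrow> act p x \<in> FA M_gens) \<and> (x \<in> MR.J \<longrightarrow> act p x \<in> MR.J)"
  proof (induction rule: falg_induct)
    case (gen g)
    show ?case
    proof (cases g rule: dgen.exhaust)
      case (MGen i j)
      then have "act (gen g) x = M_mat i j * x" for x
        using act_M[OF M_mat_FA] by (simp add: M_mat_def)
      then show ?thesis by (simp add: FA_mult MR.J_left M_mat_FA)
    next
      case (DGen i j)
      then have "act (gen g) x = del R i j x" for x
        using act_D_mat by (simp add: D_mat_def)
      then show ?thesis by (simp add: del_FA del_J)
    qed
  qed (simp_all add: act_simps FA_mult FA_add MR.J_left MR.J_add)
  then show "x \<in> FA M_gens \<Longrightarrow> act p x \<in> FA M_gens" "x \<in> MR.J \<Longrightarrow> act p x \<in> MR.J"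
    by auto
qed

lemma N_h: "h p \<in> N"
  by (simp add: N_def mval_def jval_def app_h act_FA act_J)

lemma act_D_relations: "x \<in> D_relations R \<Longrightarrow> act x p = 0"
proof -
  let ?A = "tmat_prod 2 [lift (at2 1 (matrix_inv R)), at1 1 D_mat, lift (at2 1 (matrix_inv R)), at1 1 D_mat]"
  let ?B = "tmat_prod 2 [at1 1 D_mat, lift (at2 1 (matrix_inv R)), at1 1 D_mat, lift (at2 1 (matrix_inv R))]"
  assume "x \<in> D_relations R"
  then obtain u v where uv: "length u = 2" "length v = 2" "x = ?A u v - ?B u v"
    by (auto simp: D_relations_def Let_def elim: matrix_relationsE)
  have Theta: "opr h 0 2 (\<lambda>u v. ?A u v - ?B u v) = Theta"
    unfolding opr_tmat_prod_diff
    by (simp only: list.map prod_list.Cons prod_list.Nil opr_basic Theta_def D2_def rb_def mult.assoc mult_1_right)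
  have hx: "h x = co (Suc 0) (u ! 1) (v ! 1) (co 0 (u ! 0) (v ! 0) Theta)"
    using opr_entry[OF uv(1,2), of "\<lambda>u v. ?A u v - ?B u v"] by (simp only: Theta uv(3))
  have "app (h x) (\<lambda>s. prod_list (map gen w)) = (\<lambda>s. 0)" for w
  proof -
    have "h x \<in> killed (prod_list (map gen w))"
      unfolding hx by (intro slot_closed_co[OF slot_closed_killed] Theta_killed)
    then have "\<forall>\<phi>. app (h x) (\<lambda>s. const (\<phi> s) * prod_list (map gen w)) = (\<lambda>s. 0)"
      by (simp add: killed_def)
    from spec[OF this, of "\<lambda>_. 1"] show ?thesis by simp
  qed
  then have "act x (prod_list (map gen w)) = 0" for w
    by (simp add: act_def)
  then show ?thesis
    using lin_eqI[OF lin_act lin_zero] by blast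
qed

lemma act_permutation_relations: "x \<in> permutation_relations R \<Longrightarrow> act x p = 0"
proof -
  let ?R = "lift (at2 1 R)" and ?S = "lift (at2 1 (matrix_inv R))"
  let ?A = "tmat_prod 2 [at1 1 D_mat, ?R, at1 1 M_mat, ?R]"
  let ?B = "tmat_prod 2 [?R, at1 1 M_mat, ?S, at1 1 D_mat]"
  assume "x \<in> permutation_relations R"
  then obtain u v where uv: "length u = 2" "length v = 2" "x = ?A u v - (?B u v + ?R u v)"
    by (auto simp: permutation_relations_def Let_def elim: matrix_relationsE)
  have "opr h 0 2 (\<lambda>u v. ?A u v - (?B u v + ?R u v)) = Dop * r 0 * Mop * r 0 - (r 0 * Mop * rb 0 * Dop + r 0)"
    unfolding opr_diff[OF h_hom] opr_add[OF h_hom] opr_prod[OF h_hom]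
    by (simp only: list.map prod_list.Cons prod_list.Nil opr_basic r_def rb_def mult.assoc mult_1_right)
  then have perm_0: "opr h 0 2 (\<lambda>u v. ?A u v - (?B u v + ?R u v)) = 0"
    by (simp only: perm_op diff_self)
  have "h x = 0"
    using opr_entry[OF uv(1,2), of "\<lambda>u v. ?A u v - (?B u v + ?R u v)"] by (simp only: perm_0 uv(3) co_0)
  then show ?thesis by (simp add: act_def)
qed

sublocale DR: relations UNIV "double_relations R"
  by unfold_locales (auto simp: FA_iff)

text \<open>The relations of D(R^-1) and the permutation relations act as zero. Those of M(R) act by
  multiplication into the ideal, which every further operator preserves.\<close>

lemma act_double_relation: "p \<in> DR.J \<Longrightarrow> x \<in> FA M_gens \<Longrightarrow> act p x \<in> MR.J"
proof -
  assume p: "p \<in> DR.J" and x: "x \<in> FA M_gens"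
  have "\<forall>x\<in>FA M_gens. act p x \<in> MR.J"
    using p[unfolded DR.J_def] DR.S
  proof (induction rule: genideal_induct)
    case (relation y)
    then consider "y \<in> M_relations R" | "y \<in> D_relations R" | "y \<in> permutation_relations R"
      by (auto simp: double_relations_def)
    then show ?case
    proof cases
      case 1
      then have "y \<in> MR.J" "y \<in> FA M_gens" using MR.J_S MR.J_FA by blast+
      then show ?thesis by (simp add: act_M MR.J_right)
    qed (simp_all add: act_D_relations act_permutation_relations MR.J_0)
  qed (simp_all add: act_simps MR.J_0 MR.J_add act_J act_FA)
  with x show ?thesis by blast
qed

definition Kop where "Kop = gmat (\<lambda>a b. h (K_mat q a b))"

lemma gmat_mult:
  "gmat (\<lambda>a b. h (X a b)) * gmat (\<lambda>a b. h (Y a b)) = gmat (\<lambda>a b. h (\<Sum>k\<in>UNIV. X a k * Y k b))"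
proof -
  have gm: "gmat (\<lambda>a b. h (Z a b)) = opr h 0 (Suc 0) (at1 1 Z)" for Z
    unfolding opr_at1[OF h_hom] gmat_def ..
  have "opr h 0 (Suc 0) (tmat_mult (Suc 0) (at1 1 X) (at1 1 Y))
      = opr h 0 (Suc 0) (at1 1 (\<lambda>a b. \<Sum>k\<in>UNIV. X a k * Y k b))"
    by (rule opr_cong) (auto simp: length_Suc_conv tmat_mult_def sum_tensor_index_Suc tensor_index_0 at1_def)
  then show ?thesis by (simp only: gm opr_mult[OF h_hom])
qed

lemma Kop_eq: "Kop = 1 - opsc lam * Mop * Dop"
proof -
  have "gmat (\<lambda>a b. h (K_mat q a b)) = gmat (\<lambda>a b. (if a = b then 1 else 0)) - opsc lam * gmat (\<lambda>a b. h (L_mat a b))"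
    by (simp add: gmat_def K_mat_def lam_def right_diff_distrib sum_subtractf sum_distrib_left
        sc_left[of "opE _ _ _"] if_distrib[of h] cong: if_cong)
  moreover have "gmat (\<lambda>a b. h (L_mat a b)) = Mop * Dop"
    unfolding Mop_def Dop_def gmat_mult L_mat_def ..
  moreover have "gmat (\<lambda>a b. (if a = b then 1 else 0)) = (1 :: ('v, 'v dgen) fop)"
    by (simp add: gmat_def mult_delta_right E_sum)
  ultimately show ?thesis by (simp add: Kop_def mult.assoc)
qed

sublocale casimir_slots opsc opE q R Mop Kop N SJ VJ
proof unfold_locales
  show "0 < j \<Longrightarrow> away j Kop" for j
    unfolding Kop_def by (intro away_gmat away_h)
  have NE: "opE i a b \<in> N" for i a b
    by (simp add: N_def mval_E jval_E)
  have N0: "0 \<in> N"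
    by (simp add: N_def mval_def jval_def MR.J_0)
  have Nadd: "X + Y \<in> N" if "X \<in> N" "Y \<in> N" for X Y
    using that by (simp add: N_def mval_def jval_def MR.J_add FA_add)
  have Nmult: "X * Y \<in> N" if "X \<in> N" "Y \<in> N" for X Y
    using that by (simp add: N_def)
  have Nsum: "(\<And>x. x \<in> A \<Longrightarrow> f x \<in> N) \<Longrightarrow> sum f A \<in> N" for f :: "'v \<Rightarrow> ('v, 'v dgen) fop" and A
    by (induction A rule: infinite_finite_induct) (auto intro: N0 Nadd)
  have Ngmat: "gmat (\<lambda>a b. h (X a b)) \<in> N" for X
    unfolding gmat_def by (intro Nsum Nmult NE N_h)
  show "Mop \<in> N" "Kop \<in> N"
    by (simp_all add: Mop_def Kop_def Ngmat)
  show "opsc c \<in> N" for c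
    by (simp add: N_def mval_sc jval_sc)
  show "opE i a b \<in> N" for i a b by (rule NE)
  show "X \<in> N \<Longrightarrow> Y \<in> N \<Longrightarrow> X + Y \<in> N" "X \<in> N \<Longrightarrow> Y \<in> N \<Longrightarrow> X * Y \<in> N" for X Y
    by (rule Nadd Nmult; assumption)+
  show "X \<in> N \<Longrightarrow> Y \<in> SJ \<Longrightarrow> X * Y \<in> SJ" "X \<in> N \<Longrightarrow> Y \<in> SJ \<Longrightarrow> Y * X \<in> SJ" for X Y
    by (simp_all add: N_def SJ_def)
  show SJadd: "X \<in> SJ \<Longrightarrow> Y \<in> SJ \<Longrightarrow> X + Y \<in> SJ" for X Y
    using slot_closed_SJ by (simp add: slot_closed_def)
  show "SJ \<subseteq> VJ"
    by (auto simp: SJ_def VJ_def mval_def)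
  show "0 \<in> VJ" "X \<in> VJ \<Longrightarrow> Y \<in> VJ \<Longrightarrow> X + Y \<in> VJ" for X Y
    by (simp_all add: VJ_def jval_def MR.J_0 MR.J_add)
  show VJl: "X \<in> N \<Longrightarrow> Y \<in> VJ \<Longrightarrow> X * Y \<in> VJ" for X Y
    by (simp add: VJ_def N_def)
  show "X * opE i a b \<in> VJ" if "X \<in> VJ" for X i a b
  proof -
    have "app (opE i a b) (\<lambda>s. const (\<phi> s)) = (\<lambda>s. const (if s i = a then \<phi> (s(i := b)) else 0) :: 'v dgen falg)" for \<phi>
      by (simp add: fun_eq_iff)
    then show ?thesis using that by (simp add: VJ_def)
  qed
  have "s0 * Phi * s0 * Dop * s0 \<in> SJ"
    by (intro slot_closed_r[OF slot_closed_SJ] SJ_D Phi_SJ)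
  then have "opsc (- lam) * (s0 * Phi * s0 * Dop * s0) \<in> SJ"
    using slot_closed_SJ by (simp add: slot_closed_def)
  then have "- (opsc lam * (s0 * (Phi * (s0 * (Dop * s0))))) \<in> SJ"
    by (simp add: sc_minus mult.assoc)
  then show "Kop * r 0 * Mop - rb 0 * Mop * r 0 * Kop * rb 0 \<in> SJ"
    by (simp only: K_M[OF Kop_eq])
  have "Dop \<in> killed 1"
    by (rule Dop_killed) (simp add: del_const)
  then have "app Dop (\<lambda>s. const (\<phi> s)) = (\<lambda>s. 0)" for \<phi>
    by (simp add: killed_def)
  moreover have "Kop - 1 = opsc (- lam) * Mop * Dop"
    by (simp add: Kop_eq sc_minus)
  ultimately show "Kop - 1 \<in> VJ"
    by (simp add: VJ_def jval_def app_arg_0 MR.J_0)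
qed (rule away_ops)

end


section \<open>The counit as a character\<close>

lemma counit_add: "counit (x + y) = counit x + counit y"
  by (simp add: counit_def lookup_add)

lemma counit_sum: "counit (sum f A) = (\<Sum>x\<in>A. counit (f x))"
  by (simp add: counit_def lookup_sum)

lemma counit_const [simp]: "counit (const c) = c"
  by (simp add: counit_def const_def)

lemma counit_mult: "counit (x * y) = counit x * counit y"
proof -
  let ?s = "\<lambda>x w. Poly_Mapping.single w (Poly_Mapping.lookup x w)"
  have "counit (Poly_Mapping.single u c * Poly_Mapping.single v d)
      = counit (Poly_Mapping.single u c) * counit (Poly_Mapping.single v d)" for u v :: "'a dgen word" and c d
    by (cases u; cases v)
      (simp add: counit_def mult_single lookup_single when_def plus_word_def zero_word_def)
  then have "counit ((\<Sum>u\<in>Poly_Mapping.keys x. ?s x u) * (\<Sum>v\<in>Poly_Mapping.keys y. ?s y v))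
      = counit (\<Sum>u\<in>Poly_Mapping.keys x. ?s x u) * counit (\<Sum>v\<in>Poly_Mapping.keys y. ?s y v)"
    by (simp only: sum_product counit_sum)
  then show ?thesis by (simp only: sum_monomials)
qed

lemma overlined_FA: "(\<And>i j. X i j \<in> FA A) \<Longrightarrow> overlined R k X i u v \<in> FA A"
proof (induction i arbitrary: u v)
  case 0
  then show ?case by (simp add: at1_FA)
next
  case (Suc i)
  then show ?case
    unfolding overlined.simps by (intro tmat_prod_FA) (auto simp: lift_FA)
qed

lemma ch_FA: "ch R n z \<in> FA M_gens"
  unfolding ch_def R_trace_def tmat_mult_def overlined_prod_def
  by (intro FA_sum FA_mult lift_FA tmat_prod_FA) (auto intro!: overlined_FA M_mat_FA)

lemma hecke_relations_FA: "hecke_relations q n \<subseteq> FA {1..<n}"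
  unfolding hecke_relations_def by (auto intro!: FA_diff FA_mult FA_add FA_gen)

context quantum_double
begin

lemma double_class_eq_iff: "double_class R p = double_class R p' \<longleftrightarrow> p - p' \<in> DR.J"
  unfolding double_class_def by (rule DR.class_eq_iff) simp_all

lemma M_class_eq_iff: "x \<in> FA M_gens \<Longrightarrow> y \<in> FA M_gens \<Longrightarrow> M_class R x = M_class R y \<longleftrightarrow> x - y \<in> MR.J"
  unfolding M_class_def by (rule MR.class_eq_iff)

lemma double_class_add: "double_class R p \<oplus>\<^bsub>double_algebra R\<^esub> double_class R p' = double_class R (p + p')"
  and double_class_mult: "double_class R p \<otimes>\<^bsub>double_algebra R\<^esub> double_class R p' = double_class R (p * p')"
  unfolding double_class_def double_algebra_def by (rule DR.class_add DR.class_mult; simp)+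

lemma M_class_add: "x \<in> FA M_gens \<Longrightarrow> y \<in> FA M_gens \<Longrightarrow> M_class R x \<oplus>\<^bsub>M_algebra R\<^esub> M_class R y = M_class R (x + y)"
  and M_class_mult: "x \<in> FA M_gens \<Longrightarrow> y \<in> FA M_gens \<Longrightarrow> M_class R x \<otimes>\<^bsub>M_algebra R\<^esub> M_class R y = M_class R (x * y)"
  unfolding M_class_def M_algebra_def by (rule MR.class_add MR.class_mult; assumption)+

text \<open>Passage to the quotients in both arguments: relations of the double send representatives
  into the ideal of M(R), and this ideal is preserved.\<close>

lemma act_cong:
  assumes "double_class R p = double_class R p'" "M_class R x = M_class R x'"
    and x: "x \<in> FA M_gens" "x' \<in> FA M_gens"
  shows "M_class R (act p x) = M_class R (act p' x')"
proof -
  have "act p x - act p' x' = act (p - p') x + act p' (x - x')"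
    by (simp add: act_simps act_diff)
  also have "\<dots> \<in> MR.J"
    using assms by (intro MR.J_add act_double_relation act_J) (simp_all add: double_class_eq_iff M_class_eq_iff)
  finally show ?thesis
    using x by (simp add: M_class_eq_iff act_FA)
qed

lemma act_D_1: "d \<in> FA D_gens \<Longrightarrow> act d 1 = const (counit d)"
proof (induction rule: falg_induct)
  case (gen g)
  then obtain i j where "gen g = D_mat i j" by (auto simp: D_gens_def D_mat_def)
  moreover have "counit (gen g) = 0"
    by (simp add: counit_def gen_def lookup_single when_def zero_word_def)
  ultimately show ?case by (simp add: act_D_mat del_1)
next
  case (mult p p')
  have "act p (const c) = const c * act p 1" for c
    using act_const[of p c 1] by simp
  with mult.IH show ?case
    by (simp add: act_simps counit_mult const_mult[symmetric] mult.commute)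
qed (simp_all add: act_simps counit_add const_add)

text \<open>The uniqueness half of \<open>action\<close>: whatever the rules derive is realised by
  \<open>act\<close> on representatives. For the rewriting rule, both sides of the equation in the
  double are applied to 1; there \<open>bs i * ds i\<close> gives the counit of \<open>ds i\<close>
  times \<open>bs i\<close>, which is the prescribed result.\<close>

lemma acts_sound:
  "acts R X x y \<Longrightarrow> \<exists>p b. b \<in> FA M_gens \<and> X = double_class R p \<and> x = M_class R b \<and> y = M_class R (act p b)"
proof (induction rule: acts.induct)
  case (rewriting a b k bs ds)
  have "act (bs i * ds i) 1 = const (counit (ds i)) * bs i" if "i < k" for i
    using rewriting(3,4)[OF that] by (simp add: act_simps act_D_1 act_M const_central[of "bs i"])
  moreover have "act (\<Sum>i<k. bs i * ds i) 1 = (\<Sum>i<k. act (bs i * ds i) 1)"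
    unfolding act_def by (simp add: h_sum app_sum del: h_simps)
  ultimately have "act (\<Sum>i<k. bs i * ds i) 1 = (\<Sum>i<k. const (counit (ds i)) * bs i)"
    by simp
  moreover have "act (a * b) 1 = act a b"
    using rewriting(2) by (simp add: act_simps act_M)
  ultimately have "M_class R (\<Sum>i<k. const (counit (ds i)) * bs i) = M_class R (act a b)"
    using act_cong[OF rewriting(5) refl FA_1 FA_1] by simp
  then show ?case using rewriting(2) by blast
next
  case (left_mult b' a x y)
  then obtain p b where *: "b \<in> FA M_gens" "double_class R a = double_class R p" "x = M_class R b"
    "y = M_class R (act p b)" by blast
  have "y = M_class R (act a b)"
    using act_cong[OF *(2) refl *(1) *(1)] *(4) by simp
  then have "M_class R b' \<otimes>\<^bsub>M_algebra R\<^esub> y = M_class R (act (b' * a) b)"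
    using left_mult(1) *(1) by (simp add: M_class_mult act_FA act_simps act_M)
  then show ?case using * by blast
next
  case (sum X x y Y z)
  then obtain p b p' b' where *: "b \<in> FA M_gens" "X = double_class R p" "x = M_class R b"
    "y = M_class R (act p b)" "b' \<in> FA M_gens" "Y = double_class R p'" "x = M_class R b'"
    "z = M_class R (act p' b')" by blast
  have "z = M_class R (act p' b)"
    using act_cong[of p' p' b' b, OF refl _ *(5,1)] * by simp
  then have "y \<oplus>\<^bsub>M_algebra R\<^esub> z = M_class R (act (p + p') b)"
    using * by (simp add: M_class_add act_FA act_simps)
  then show ?case using * double_class_add by blast
next
  case (composition Y x y X z)
  then obtain p b p' b' where *: "b \<in> FA M_gens" "Y = double_class R p" "x = M_class R b"
    "y = M_class R (act p b)" "b' \<in> FA M_gens" "X = double_class R p'" "y = M_class R b'"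
    "z = M_class R (act p' b')" by blast
  have "z = M_class R (act p' (act p b))"
    using act_cong[of p' p' b' "act p b", OF refl _ *(5) act_FA[OF *(1)]] * by simp
  then have "z = M_class R (act (p' * p) b)"
    by (simp add: act_simps)
  then show ?case using * double_class_mult by blast
qed

text \<open>Elements that the relations of the double allow to be written with M to the left of D.
  The rewriting rule asks for such an expression, so its existence has to be proved.\<close>

definition ordered :: "'v dgen falg set" where
  "ordered = {x. \<exists>k bs ds. (\<forall>i<k::nat. bs i \<in> FA M_gens \<and> ds i \<in> FA D_gens) \<and>
     x - (\<Sum>i<k. bs i * ds i) \<in> DR.J}"

lemma ordered_J: "x \<in> DR.J \<Longrightarrow> x \<in> ordered"
  unfolding ordered_def by (auto intro!: exI[of _ 0])

lemma ordered_mult: "b \<in> FA M_gens \<Longrightarrow> d \<in> FA D_gens \<Longrightarrow> b * d \<in> ordered"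
  unfolding ordered_def mem_Collect_eq
  by (rule exI[of _ 1], rule exI[of _ "\<lambda>_. b"], rule exI[of _ "\<lambda>_. d"]) (simp add: DR.J_0)

lemma ordered_add:
  assumes "x \<in> ordered" "y \<in> ordered"
  shows "x + y \<in> ordered"
proof -
  obtain k bs ds where x: "\<forall>i<k::nat. bs i \<in> FA M_gens \<and> ds i \<in> FA D_gens" "x - (\<Sum>i<k. bs i * ds i) \<in> DR.J"
    using assms(1) by (auto simp: ordered_def)
  obtain k' bs' ds' where y: "\<forall>i<k'::nat. bs' i \<in> FA M_gens \<and> ds' i \<in> FA D_gens" "y - (\<Sum>i<k'. bs' i * ds' i) \<in> DR.J"
    using assms(2) by (auto simp: ordered_def)
  define cs where "cs i = (if i < k then bs i else bs' (i - k))" for i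
  define es where "es i = (if i < k then ds i else ds' (i - k))" for i
  have "(\<Sum>i<k + l. cs i * es i) = (\<Sum>i<k. bs i * ds i) + (\<Sum>i<l. bs' i * ds' i)" for l
    by (induction l) (simp_all add: cs_def es_def add.assoc)
  then have "x + y - (\<Sum>i<k + k'. cs i * es i) = (x - (\<Sum>i<k. bs i * ds i)) + (y - (\<Sum>i<k'. bs' i * ds' i))"
    by simp
  also have "\<dots> \<in> DR.J"
    by (intro DR.J_add x y)
  finally show ?thesis
    using x(1) y(1) unfolding ordered_def mem_Collect_eq
    by (intro exI[of _ "k + k'"] exI[of _ cs] exI[of _ es]) (auto simp: cs_def es_def)
qed

lemma ordered_left:
  assumes "x \<in> ordered" "b \<in> FA M_gens"
  shows "b * x \<in> ordered"
proof -
  obtain k bs ds where x: "\<forall>i<k::nat. bs i \<in> FA M_gens \<and> ds i \<in> FA D_gens" "x - (\<Sum>i<k. bs i * ds i) \<in> DR.J"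
    using assms(1) by (auto simp: ordered_def)
  have "b * x - (\<Sum>i<k. (b * bs i) * ds i) = b * (x - (\<Sum>i<k. bs i * ds i))"
    by (simp add: right_diff_distrib sum_distrib_left mult.assoc)
  also have "\<dots> \<in> DR.J"
    by (intro DR.J_left x) simp
  finally show ?thesis
    using x(1) assms(2) unfolding ordered_def mem_Collect_eq
    by (intro exI[of _ k] exI[of _ "\<lambda>i. b * bs i"] exI[of _ ds]) (auto intro: FA_mult)
qed

text \<open>The regular representation: unlike in \<open>h\<close>, generators of D(R^-1) also act
  by multiplication. Values therefore remember the whole word, as reordering requires.\<close>

definition left_mult_op :: "'v dgen falg \<Rightarrow> ('v, 'v dgen) fop" where
  "left_mult_op = falg_hom (\<lambda>g. lft ((*) (gen g)))"

lemma app_left_mult_op: "app (left_mult_op p) f s = p * f s"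
proof -
  have "p \<in> FA UNIV" by simp
  then show ?thesis
    by (induction arbitrary: f s rule: falg_induct)
      (simp_all add: left_mult_op_def app_lft lin_left falg_hom_add falg_hom_mult distrib_right mult.assoc)
qed

lemma left_mult_op_hom: "coeff_hom left_mult_op"
  unfolding left_mult_op_def by (rule coeff_hom_falg_hom) (rule away_lft[OF lin_left])

text \<open>In the regular representation the permutation relations hold up to the ideal of the
  double. Their right side, applied to w, is reorderable by hypothesis, hence so is D_1 R_1 M_1 R_1;
  R^-1 and the skew inverse then isolate a single product of entries.\<close>

lemma ordered_D_M:
  assumes w: "w \<in> FA M_gens" and D: "\<And>i j. D_mat i j * w \<in> ordered"
  shows "D_mat i y * (M_mat b e * w) \<in> ordered"
proof -
  let ?h = left_mult_op
  define L :: "('v, 'v dgen) fop set" where "L = {X. \<forall>\<phi> s. app X (\<lambda>s. const (\<phi> s) * w) s \<in> ordered}"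
  have ord_sc: "const c * x \<in> ordered" if "x \<in> ordered" for c x
    using that by (rule ordered_left) simp
  have ord_0: "0 \<in> ordered" by (rule ordered_J[OF DR.J_0])
  have "X * opE i a b \<in> L" if "X \<in> L" for X i a b
  proof -
    have "app (opE i a b) (\<lambda>s. const (\<phi> s) * w) = (\<lambda>s. const (if s i = a then \<phi> (s(i := b)) else 0) * w)" for \<phi>
      by (simp add: fun_eq_iff)
    then show ?thesis using that by (simp add: L_def)
  qed
  then have L: "slot_closed L"
    by (auto simp: slot_closed_def) (simp_all add: L_def ord_0 ordered_add ord_sc)
  have L_left: "?h (M_mat c d) * X \<in> L" if "X \<in> L" for X c d
    using that by (simp add: L_def app_left_mult_op ordered_left M_mat_FA)
  have hD: "?h (D_mat c d) \<in> L" for c d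
    by (simp add: L_def app_left_mult_op const_left ord_sc D)
  have away: "away i (?h x)" for i x
    using left_mult_op_hom by (simp add: coeff_hom_def)
  have const: "?h (const c) = opsc c" for c
    by (simp add: left_mult_op_def)
  define M0 where "M0 = gmat (\<lambda>a b. ?h (M_mat a b))"
  define D0 where "D0 = gmat (\<lambda>a b. ?h (D_mat a b))"
  have aw: "away (Suc 0) M0" "away (Suc 0) D0"
    by (auto simp: M0_def D0_def intro!: away_gmat away)
  have basic: "opr ?h 0 2 (lift (at2 1 A)) = tens A 0 (Suc 0)"
    "opr ?h 0 2 (at1 1 M_mat) = M0" "opr ?h 0 2 (at1 1 D_mat) = D0" for A
    using opr_at2'[of 0 2 A] opr_at1[OF left_mult_op_hom, of 0 "Suc 0" M_mat]
      opr_at1[OF left_mult_op_hom, of 0 "Suc 0" D_mat]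
    by (simp_all add: opr_lift const M0_def D0_def gmat_def numeral_2_eq_2 del: opr.simps)
  let ?R = "lift (at2 1 R)" and ?S = "lift (at2 1 (matrix_inv R))"
  let ?A = "tmat_prod 2 [at1 1 D_mat, ?R, at1 1 M_mat, ?R]"
  let ?B = "tmat_prod 2 [?R, at1 1 M_mat, ?S, at1 1 D_mat]"
  have "opr ?h 0 2 (\<lambda>u v. ?A u v - (?B u v + ?R u v)) \<in> L"
  proof (rule opr_mem)
    fix u v :: "'v list" assume "length u = 2" "length v = 2"
    then have "?A u v - (?B u v + ?R u v) \<in> double_relations R"
      by (auto simp: double_relations_def permutation_relations_def Let_def matrix_relations_def tensor_index_def)
    then have "?A u v - (?B u v + ?R u v) \<in> DR.J"
      by (rule DR.J_S)
    then show "?h (?A u v - (?B u v + ?R u v)) \<in> L"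
      by (simp add: L_def app_left_mult_op ordered_J DR.J_right)
  qed (use L in \<open>auto simp: slot_closed_def\<close>)
  then have rel: "D0 * r 0 * M0 * r 0 - (r 0 * M0 * rb 0 * D0 + r 0) \<in> L"
    unfolding opr_diff[OF left_mult_op_hom] opr_add[OF left_mult_op_hom] opr_prod[OF left_mult_op_hom]
    by (simp only: list.map prod_list.Cons prod_list.Nil basic r_def rb_def mult.assoc mult_1_right)
  have "D0 \<in> L"
    unfolding D0_def gmat_def by (intro slot_closed_sum[OF L]) (use L hD in \<open>simp add: slot_closed_def\<close>)
  have M0: "M0 * X \<in> L" if "X \<in> L" for X
    unfolding M0_def gmat_def sum_distrib_right
    by (intro slot_closed_sum[OF L]) (use L L_left[OF that] in \<open>simp add: slot_closed_def mult.assoc\<close>)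
  have "1 \<in> L"
    using ordered_mult[OF w FA_1] by (simp add: L_def ord_sc)
  have "r 0 * (M0 * (rb 0 * D0)) + r 0 * 1 \<in> L"
    using L by (auto simp: slot_closed_def simp del: mult_1_right intro!: slot_closed_r[OF L] M0 \<open>D0 \<in> L\<close> \<open>1 \<in> L\<close>)
  then have "(D0 * r 0 * M0 * r 0 - (r 0 * M0 * rb 0 * D0 + r 0)) + (r 0 * (M0 * (rb 0 * D0)) + r 0 * 1) \<in> L"
    using L rel by (simp only: slot_closed_def)
  then have "D0 * r 0 * M0 * r 0 \<in> L"
    by (simp add: mult.assoc)
  then have "D0 * r 0 * M0 * r 0 * rb 0 \<in> L"
    by (rule slot_closed_r[OF L])
  then have "D0 * r 0 * M0 \<in> L"
    by (simp add: mult.assoc)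
  then have "co 0 i y D0 * M0 \<in> L"
    by (rule co_mult_mem'[OF L aw(2,1)])
  then have "co 0 b e (co 0 i y D0 * M0) \<in> L"
    by (rule slot_closed_co[OF L])
  then have "?h (D_mat i y) * ?h (M_mat b e) \<in> L"
    by (simp add: co_away_left away_co_same D0_def M0_def co_gmat away)
  then have "\<forall>\<phi> s. app (?h (D_mat i y) * ?h (M_mat b e)) (\<lambda>s. const (\<phi> s) * w) s \<in> ordered"
    by (simp add: L_def)
  from this[rule_format, of "\<lambda>_. 1" undefined] show ?thesis
    by (simp add: app_left_mult_op)
qed

lemma ordered_D:
  assumes "b \<in> FA M_gens"
  shows "D_mat i j * b \<in> ordered"
proof -
  have "\<forall>w\<in>FA M_gens. (\<forall>i j. D_mat i j * w \<in> ordered) \<longrightarrow> (\<forall>i j. D_mat i j * (b * w) \<in> ordered)"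
    using assms
  proof (induction rule: falg_induct)
    case (const c)
    then show ?case by (simp add: const_left ordered_left)
  next
    case (gen g)
    then obtain b e where "gen g = M_mat b e" by (auto simp: M_gens_def M_mat_def)
    then show ?case using ordered_D_M by auto
  next
    case (add p p')
    then show ?case by (simp add: distrib_right distrib_left ordered_add)
  next
    case (mult p p')
    then show ?case by (simp add: mult.assoc FA_mult)
  qed
  moreover have "D_mat i j * 1 \<in> ordered" for i j
    using ordered_mult[OF FA_1 D_mat_FA[of i j]] by simp
  ultimately have "D_mat i j * (b * 1) \<in> ordered"
    using FA_1 by blast
  then show ?thesis by simp
qed

text \<open>The existence half of \<open>action\<close>. Reordering is needed only for single
  generators of D(R^-1), since sums and products are covered by the rules for sums and
  compositions.\<close>

lemma acts_act: "b \<in> FA M_gens \<Longrightarrow> acts R (double_class R p) (M_class R b) (M_class R (act p b))"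
proof -
  \<comment> \<open>A single term suffices: the constant commutes with b, and its counit is the
    constant itself.\<close>
  have acts_const: "acts R (double_class R (const c)) (M_class R b) (M_class R (const c * b))"
    if "b \<in> FA M_gens" for c b
    using acts.rewriting[of "const c" b 1 "\<lambda>_. b" "\<lambda>_. const c" R] that by (simp add: const_central[of b])
  have "p \<in> FA UNIV" by simp
  then show "b \<in> FA M_gens \<Longrightarrow> acts R (double_class R p) (M_class R b) (M_class R (act p b))"
  proof (induction arbitrary: b rule: falg_induct)
    case (const c)
    then show ?case by (simp add: act_simps acts_const)
  next
    case (gen g)
    show ?case
    proof (cases g rule: dgen.exhaust)
      case (MGen i j)
      have "acts R (double_class R 1) (M_class R b) (M_class R b)"
        using acts_const[OF gen.prems, of 1] by simp
      then have "acts R (double_class R (M_mat i j * 1)) (M_class R b) (M_class R (M_mat i j) \<otimes>\<^bsub>M_algebra R\<^esub> M_class R b)"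
        by (intro acts.left_mult M_mat_FA FA_1)
      then show ?thesis
        using MGen gen.prems act_M[OF M_mat_FA, of i j b] by (simp add: M_class_mult M_mat_FA) (simp add: M_mat_def)
    next
      case (DGen i j)
      obtain k bs ds where *: "\<forall>l<k::nat. bs l \<in> FA M_gens \<and> ds l \<in> FA D_gens"
        "D_mat i j * b - (\<Sum>l<k. bs l * ds l) \<in> DR.J"
        using ordered_D[OF gen.prems, of i j] by (auto simp: ordered_def)
      define y where "y = M_class R (\<Sum>l<k. const (counit (ds l)) * bs l)"
      have acts: "acts R (double_class R (D_mat i j)) (M_class R b) y"
        unfolding y_def using * gen.prems
        by (intro acts.rewriting) (simp_all add: D_mat_FA double_class_eq_iff)
      \<comment> \<open>The value read off from the reordering is identified with that of
        \<open>act\<close> through soundness, without inspecting the reordered expression.\<close>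
      then obtain p' b' where "b' \<in> FA M_gens" "double_class R (D_mat i j) = double_class R p'"
        "M_class R b = M_class R b'" "y = M_class R (act p' b')"
        using acts_sound by blast
      then have "y = M_class R (act (D_mat i j) b)"
        using act_cong[of "D_mat i j" p' b b'] gen.prems by simp
      with acts DGen show ?thesis by (simp add: D_mat_def)
    qed
  next
    case (add p p')
    from acts.sum[OF add.IH(1)[OF add.prems] add.IH(2)[OF add.prems]] show ?case
      by (simp add: double_class_add M_class_add act_FA add.prems act_simps)
  next
    case (mult p p')
    from acts.composition[OF mult.IH(2)[OF mult.prems] mult.IH(1)[OF act_FA[OF mult.prems]]] show ?case
      by (simp add: double_class_mult act_simps)
  qed
qed

lemma action_eq: "b \<in> FA M_gens \<Longrightarrow> action R (double_class R p) (M_class R b) = M_class R (act p b)"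
  unfolding action_def
proof (rule the_equality)
  assume b: "b \<in> FA M_gens"
  then show "acts R (double_class R p) (M_class R b) (M_class R (act p b))" by (rule acts_act)
  fix y assume "acts R (double_class R p) (M_class R b) y"
  then obtain p' b' where "b' \<in> FA M_gens" "double_class R p = double_class R p'"
    "M_class R b = M_class R b'" "y = M_class R (act p' b')"
    using acts_sound by blast
  then show "y = M_class R (act p b)"
    using act_cong[of p p' b b'] b by simp
qed

section \<open>Casimir operators and the characteristic subalgebra\<close>

text \<open>Letters are counted from 1 and slots from 0, whence the index \<open>i - 1\<close>.
  Letters in \<open>{1..<n}\<close> give the generators of \<open>H 0 n\<close>.\<close>

definition hecke_eval :: "nat falg \<Rightarrow> ('v, 'v dgen) fop" where
  "hecke_eval = falg_hom (\<lambda>i. r (i - 1))"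

lemma hecke_eval_H: "Q \<in> FA {1..<n} \<Longrightarrow> hecke_eval Q \<in> H 0 n"
  by (induction rule: falg_induct)
    (auto simp: hecke_eval_def falg_hom_add falg_hom_mult intro: H_sc H_r H_add H_mult)

lemma H_hecke_eval: "X \<in> H 0 n \<Longrightarrow> \<exists>Q\<in>FA {1..<n}. hecke_eval Q = X"
proof (induction rule: H.induct)
  case (H_sc c)
  show ?case by (rule bexI[of _ "const c"]) (simp_all add: hecke_eval_def)
next
  case (H_r i)
  then show ?case by (intro bexI[of _ "gen (Suc i)"] FA_gen) (auto simp: hecke_eval_def)
next
  case (H_add X Y)
  then obtain P Q where "P \<in> FA {1..<n}" "hecke_eval P = X" "Q \<in> FA {1..<n}" "hecke_eval Q = Y" by blast
  then show ?case by (intro bexI[of _ "P + Q"]) (auto simp: hecke_eval_def falg_hom_add FA_add)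
next
  case (H_mult X Y)
  then obtain P Q where "P \<in> FA {1..<n}" "hecke_eval P = X" "Q \<in> FA {1..<n}" "hecke_eval Q = Y" by blast
  then show ?case by (intro bexI[of _ "P * Q"]) (auto simp: hecke_eval_def falg_hom_mult FA_mult)
qed

lemma opr_eval_R:
  assumes "Q \<in> FA {1..<n}"
  shows "opr h 0 n (lift (eval_R R n Q)) = hecke_eval Q"
proof -
  have word: "map (opr opsc 0 n) (map (\<lambda>i. at2 i R) xs) = map (\<lambda>i. r (i - 1)) xs"
    if "set xs \<subseteq> {1..<n}" for xs
  proof -
    have "opr opsc 0 n (at2 i R) = r (i - 1)" if "1 \<le> i" "i < n" for i
      using opr_at2'[of "i - 1" n R] that by (simp add: r_def)
    with \<open>set xs \<subseteq> {1..<n}\<close> show ?thesis by (induction xs) auto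
  qed
  have "opr h 0 n (lift (eval_R R n Q)) = opr opsc 0 n (\<lambda>u v. eval_R R n Q u v)"
    by (rule opr_lift) simp
  also have "\<dots> = (\<Sum>w\<in>Poly_Mapping.keys Q. opsc (Poly_Mapping.lookup Q w) *
      prod_list (map (opr opsc 0 n) (map (\<lambda>i. at2 i R) (letters w))))"
    by (simp only: eval_R_def opr_sum[OF coeff_hom_sc] opr_scale opr_prod[OF coeff_hom_sc])
  also have "\<dots> = hecke_eval Q"
    unfolding hecke_eval_def falg_hom_def
    by (intro sum.cong refl) (use assms in \<open>simp add: FA_iff word del: map_map\<close>)
  finally show ?thesis .
qed

lemma hecke_eval_relation: "x \<in> hecke_relations q n \<Longrightarrow> hecke_eval x = 0"
proof -
  assume "x \<in> hecke_relations q n"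
  then consider i where "1 \<le> i" "x = gen i * gen (i + 1) * gen i - gen (i + 1) * gen i * gen (i + 1)"
    | i j where "1 \<le> i" "1 \<le> j" "i + 2 \<le> j \<or> j + 2 \<le> i" "x = gen i * gen j - gen j * gen i"
    | i where "x = (const q - gen i) * (const (inverse q) + gen i)"
    unfolding hecke_relations_def by auto
  then show ?thesis
  proof cases
    case 1
    then show ?thesis
      using braid[of "i - 1"] by (simp add: hecke_eval_def falg_hom_diff falg_hom_mult mult.assoc)
  next
    case 2
    then have "r (i - 1) * r (j - 1) = r (j - 1) * r (i - 1)"
      using r_far[of "i - 1" "j - 1"] r_far[of "j - 1" "i - 1"] by auto
    with 2 show ?thesis
      by (simp add: hecke_eval_def falg_hom_diff falg_hom_mult)
  next
    case 3
    have "opsc q * opsc (inverse q) = (1 :: ('v, 'v dgen) fop)"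
    proof -
      have "q * inverse q = 1" using hecke_R by (simp add: hecke_symmetry_def)
      then show ?thesis by (simp only: sc_mult[symmetric] sc_1)
    qed
    then show ?thesis
      using 3 r_r[of "i - 1"]
      by (simp add: hecke_eval_def falg_hom_diff falg_hom_mult falg_hom_add left_diff_distrib distrib_left
          lam_def sc_diff sc_comm[of "r _"])
  qed
qed

text \<open>\<open>hecke_rep\<close> evaluates a chosen representative of a coset. The Hecke
  relations evaluate to zero, so the choice does not affect the slot operator.\<close>

lemma hecke_eval_rep:
  assumes "p0 \<in> FA {1..<n}" and z: "z = presented_class {1..<n} (hecke_relations q n) p0"
  shows "(SOME p. p \<in> z) \<in> FA {1..<n}" "hecke_eval (SOME p. p \<in> z) = hecke_eval p0"
proof -
  interpret HR: relations "{1..<n}" "hecke_relations q n"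
    by unfold_locales (rule hecke_relations_FA)
  define p where "p = (SOME p. p \<in> z)"
  have "p \<in> z"
    unfolding p_def using HR.class_self[OF assms(1)] z by (auto intro: someI)
  then have p: "p \<in> FA {1..<n}" "p - p0 \<in> HR.J"
    using HR.class_mem[OF assms(1)] z by auto
  have "hecke_eval (p - p0) = 0"
    using p(2)[unfolded HR.J_def] hecke_relations_FA
    by (induction rule: genideal_induct)
      (simp_all add: hecke_eval_relation, simp_all add: hecke_eval_def falg_hom_add falg_hom_mult)
  with p show "(SOME p. p \<in> z) \<in> FA {1..<n}" "hecke_eval (SOME p. p \<in> z) = hecke_eval p0"
    by (simp_all add: p_def hecke_eval_def falg_hom_diff)
qed

lemma h_ch:
  assumes "p0 \<in> FA {1..<n}" "z = presented_class {1..<n} (hecke_relations q n) p0"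
  shows "h (ch R n z) = ptrs C 0 n (hecke_eval p0 * PM 0 n)"
proof -
  have "opr h 0 n (overlined_prod R n M_mat) = PM 0 n"
    using opr_overlined_prod[OF h_hom, of n R M_mat, folded Mop_def] by (simp add: Pi_def[OF away_ops(1)])
  moreover have "opr h 0 n (lift (hecke_rep R n z)) = hecke_eval p0"
    using hecke_eval_rep[OF assms] by (simp add: hecke_rep_def opr_eval_R)
  ultimately show ?thesis
    unfolding ch_def using R_trace_ptrs[OF h_hom] by (simp add: opr_mult[OF h_hom])
qed

lemma carrier_hecke_algebra:
  "carrier (hecke_algebra q n) = presented_class {1..<n} (hecke_relations q n) ` FA {1..<n}"
proof -
  interpret HR: relations "{1..<n}" "hecke_relations q n"
    by unfold_locales (rule hecke_relations_FA)
  show ?thesis unfolding hecke_algebra_def by (rule HR.carrier_presented)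
qed

lemma h_casimir:
  assumes "Q \<in> FA {1..<n}"
  shows "h (casimir q R n Q) = ptrs C 0 n (hecke_eval Q * KK n)"
proof -
  have "opr h 0 n (underlined_prod R n (K_mat q)) = KK n"
    using opr_underlined_prod[OF h_hom, of n R "K_mat q", folded Kop_def] by (simp add: KK_def)
  then show ?thesis
    unfolding casimir_def using R_trace_ptrs[OF h_hom] assms by (simp add: opr_mult[OF h_hom] opr_eval_R)
qed

text \<open>Evaluation on the constant function 1 turns a congruence of operators on the vacuum into
  a congruence of elements of M(R).\<close>

lemma vj_hD:
  assumes "vj (h p) (h p')"
  shows "act p 1 - act p' 1 \<in> MR.J"
proof -
  have "h p - h p' \<in> VJ"
    using assms by (simp only: vj_def)
  then have "\<forall>\<phi> s. app (h p - h p') (\<lambda>s. const (\<phi> s)) s \<in> MR.J"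
    by (simp only: VJ_def jval_def mem_Collect_eq simp_thms)
  from this[rule_format, of "\<lambda>_. 1" undefined] show ?thesis
    by (simp add: act_def)
qed

lemma casimir_act_1:
  assumes "Q \<in> FA {1..<n}"
  shows "\<exists>c. act (casimir q R n Q) 1 - const c \<in> MR.J"
proof -
  obtain c where "vj (h (casimir q R n Q)) (h (const c))"
    using casimir_1[OF hecke_eval_H[OF assms]] by (auto simp: h_casimir[OF assms])
  from vj_hD[OF this] show ?thesis by (auto simp: act_simps)
qed

lemma casimir_act_ch:
  assumes Q: "Q \<in> FA {1..<n}" and z: "z \<in> carrier (hecke_algebra q m)"
  shows "\<exists>y\<in>carrier (hecke_algebra q m). act (casimir q R n Q) (ch R m z) - ch R m y \<in> MR.J"
proof -
  obtain p0 where p0: "p0 \<in> FA {1..<m}" "z = presented_class {1..<m} (hecke_relations q m) p0"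
    using z by (auto simp: carrier_hecke_algebra)
  obtain Y where Y: "Y \<in> H 0 m" "vj (ptrs C 0 n (hecke_eval Q * KK n) * ptrs C 0 m (hecke_eval p0 * PM 0 m))
      (ptrs C 0 m (Y * PM 0 m))"
    using casimir_character[OF hecke_eval_H[OF Q] hecke_eval_H[OF p0(1)]] by blast
  obtain p1 where p1: "p1 \<in> FA {1..<m}" "hecke_eval p1 = Y"
    using H_hecke_eval[OF Y(1)] by blast
  define y where "y = presented_class {1..<m} (hecke_relations q m) p1"
  \<comment> \<open>The character is treated as an operator applied before the Casimir operator: it
    acts by multiplication, so on the unit the composition yields the Casimir image of the
    character.\<close>
  have "vj (h (casimir q R n Q * ch R m z)) (h (ch R m y))"
    using Y(2) by (simp add: h_casimir[OF Q] h_ch[OF p0] h_ch[OF p1(1) y_def] p1(2))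
  from vj_hD[OF this] have "act (casimir q R n Q) (ch R m z) - ch R m y \<in> MR.J"
    by (simp add: act_simps act_M ch_FA)
  moreover have "y \<in> carrier (hecke_algebra q m)"
    using p1(1) by (auto simp: carrier_hecke_algebra y_def)
  ultimately show ?thesis by blast
qed

lemma casimir_characteristic_subalgebra:
  assumes Q: "Q \<in> FA {1..<n}"
  shows "action R (double_class R (casimir q R n Q)) ` characteristic_subalgebra q R
    \<subseteq> characteristic_subalgebra q R"
proof -
  let ?cas = "casimir q R n Q"
  let ?B = "insert 1 {ch R n z | n z. 1 \<le> n \<and> z \<in> carrier (hecke_algebra q n)}"
  interpret falg: module "\<lambda>c x. const c * (x :: 'v dgen falg)"
    by unfold_locales (simp_all add: distrib_left distrib_right const_add const_mult mult.assoc)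
  \<comment> \<open>Images are known only modulo the ideal of relations, so membership asks for a
    congruence with an element of the span. \<open>T\<close> is a subspace, and checking the
    generators is enough.\<close>
  define T where "T = {b \<in> FA M_gens. \<exists>c\<in>falg.span ?B. act ?cas b - c \<in> MR.J}"
  have "?B \<subseteq> T"
  proof
    fix b assume "b \<in> ?B"
    then consider "b = 1" | m z where "1 \<le> m" "z \<in> carrier (hecke_algebra q m)" "b = ch R m z"
      by auto
    then show "b \<in> T"
    proof cases
      case 1
      obtain c where "act ?cas 1 - const c \<in> MR.J"
        using casimir_act_1[OF Q] by blast
      moreover have "const c * 1 \<in> falg.span ?B"
        by (intro falg.span_scale falg.span_base) simp
      ultimately show ?thesis
        using 1 by (auto simp: T_def)
    next
      case 2
      obtain y where "y \<in> carrier (hecke_algebra q m)" "act ?cas (ch R m z) - ch R m y \<in> MR.J"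
        using casimir_act_ch[OF Q 2(2)] by blast
      moreover from this(1) have "ch R m y \<in> falg.span ?B"
        using 2(1) by (intro falg.span_base) auto
      ultimately show ?thesis
        using 2(3) by (auto simp: T_def ch_FA)
    qed
  qed
  moreover have "falg.subspace T"
  proof (rule falg.subspaceI)
    show "0 \<in> T"
      using falg.span_zero[of ?B] MR.J_0 by (auto simp: T_def lin_0[OF lin_act] intro!: bexI[of _ 0])
  next
    fix x y assume "x \<in> T" "y \<in> T"
    then obtain c d where "c \<in> falg.span ?B" "act ?cas x - c \<in> MR.J" "d \<in> falg.span ?B" "act ?cas y - d \<in> MR.J"
      and xy: "x \<in> FA M_gens" "y \<in> FA M_gens" by (auto simp: T_def)
    moreover have "act ?cas (x + y) - (c + d) = (act ?cas x - c) + (act ?cas y - d)"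
      by (simp add: act_add)
    ultimately have "c + d \<in> falg.span ?B" "act ?cas (x + y) - (c + d) \<in> MR.J"
      by (simp_all only: falg.span_add MR.J_add)
    then show "x + y \<in> T"
      using xy by (auto simp: T_def intro: FA_add)
  next
    fix a x assume "x \<in> T"
    then obtain c where "c \<in> falg.span ?B" "act ?cas x - c \<in> MR.J" and x: "x \<in> FA M_gens"
      by (auto simp: T_def)
    moreover have "act ?cas (const a * x) - const a * c = const a * (act ?cas x - c)"
      by (simp add: act_const right_diff_distrib)
    ultimately have "const a * c \<in> falg.span ?B" "act ?cas (const a * x) - const a * c \<in> MR.J"
      by (simp_all only: falg.span_scale MR.J_left FA_const)
    then show "const a * x \<in> T"
      using x by (auto simp: T_def intro: FA_mult)
  qed
  ultimately have span: "falg.span ?B \<subseteq> T"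
    by (rule falg.span_minimal)
  show ?thesis
  proof
    fix w assume "w \<in> action R (double_class R ?cas) ` characteristic_subalgebra q R"
    then obtain b where b: "b \<in> falg.span ?B" "w = action R (double_class R ?cas) (M_class R b)"
      unfolding characteristic_subalgebra_def by blast
    then obtain c where c: "b \<in> FA M_gens" "c \<in> falg.span ?B" "act ?cas b - c \<in> MR.J"
      using span by (auto simp: T_def)
    have "c \<in> FA M_gens" using span c(2) by (auto simp: T_def)
    then have "w = M_class R c"
      using b(2) c by (simp add: action_eq M_class_eq_iff act_FA)
    then show "w \<in> characteristic_subalgebra q R"
      using c(2) unfolding characteristic_subalgebra_def by blast
  qed
qed

end

theorem theorem14:
  fixes q :: complex and R :: "'v::finite endo2"
    and S :: "complex set" and F :: "complex \<Rightarrow> 'v endo2" and R\<^sub>0 :: "'v endo2"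
    and n :: nat and Q :: "nat falg"
  assumes hecke: "hecke_symmetry q R"
    and generic: "\<And>k::nat. 0 < k \<Longrightarrow> q ^ k \<noteq> 1"
    and skew: "skew_invertible R" "skew_invertible (matrix_inv R)"
    and family: "\<And>p. p \<in> S \<Longrightarrow> hecke_symmetry p (F p)" "q \<in> S" "F q = R"
    and limit: "1 islimpt S" "(F \<longlongrightarrow> R\<^sub>0) (at 1 within S)" "involutive_symmetry R\<^sub>0"
    and n: "1 \<le> n"
    and Q: "Q \<in> carrier (free_algebra {1..<n})"
  shows "action R (double_class R (casimir q R n Q)) ` characteristic_subalgebra q R
           \<subseteq> characteristic_subalgebra q R"
proof -
  interpret quantum_double q R
    by unfold_locales (rule hecke, rule skew(1))
  show ?thesis
    by (rule casimir_characteristic_subalgebra[OF Q])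
qed

end
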